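(* Let $F:\mathbf T\to\gamma\subset\mathbf C$ be an orientation preserving Lipschitz weak homeomorphism of the unit circle $\mathbf T$ onto a $C^{1,\alpha}$ smooth Jordan curve $\gamma$. Let $D$ be a bounded domain such that $\partial D=\gamma$, and let $w=P[F]$ be the Poisson extension of $F$ to the unit disk $\mathbf U$. Then $J_w(e^{it})/|F'(t)|$ exists a.e. in $\mathbf T$ and has a continuous extension $T_w(e^{it})$ to $\mathbf T$. If $$T_w(e^{it})>0\quad\text{everywhere on }\mathbf T,$$ then the mapping $w=P[F]$ is a diffeomorphism of $\mathbf U$ onto $D$.
   Context: $\mathbf U$ is the open unit disk in $\mathbf C$ and $\mathbf T=\partial\mathbf U$ is the unit circle. A function $F$ on $\mathbf T$ is identified with the $2\pi$-periodic function $F(t)=F(e^{it})$, and $F'(t)$ denotes $\frac{d}{dt}F(e^{it})$. Let $\gamma$ be a rectifiable Jordan curve of length $l=|\gamma|$ and let $g:[0,l]\to\gamma$ be an arc length parameterization, i.e. $|g'(s)|=1$ for all $s\in[0,l]$. The curve $\gamma$ is of class $C^{1,\alpha}$, $0<\alpha\le1$, if $g$ (regarded as an $l$-periodic function) is of class $C^1$ and $\sup_{t\neq s}\frac{|g'(t)-g'(s)|}{|t-s|^\alpha}<\infty$. A surjective function $F=g\circ f:\mathbf T\to\gamma$, meaning $F(e^{it})=g(f(t))$, is a weak homeomorphism if $f:[0,2\pi]\to[0,l]$ is a nondecreasing surjective function. Orientation preserving means that here $g$ is positively oriented, so that $ig'(s)$ is the inner unit normal vector of $\gamma$ at $g(s)$.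 The Poisson extension is $P[F](re^{i\tau})=\int_0^{2\pi}P(r,t-\tau)F(e^{it})\,dt$ with $P(r,t)=\frac{1-r^2}{2\pi(1-2r\cos t+r^2)}$, $0\le r<1$. The Jacobian of $w$ is $J_w=|w_z|^2-|w_{\bar z}|^2$, and on the boundary $J_w(e^{it}):=\lim_{r\to1^-}J_w(re^{it})$.
   Formalization: Where F'(t)=0 the quotient J_w/|F'| is 0/0, so T_w is required to equal it only for a.e. t with F'(t)≠0; on open arcs where F is constant, T_w is fixed as the radial derivative of w at the boundary along the inner normal, -<∂_r w, i g'(f(t))>. *)

theory Defs
  imports "HOL-Complex_Analysis.Complex_Analysis"
begin

section \<open>Curves\<close>

text \<open>\<open>g\<close> is regarded as an \<open>l\<close>-periodic function on the whole line; it runs once through the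
  Jordan curve \<open>\<gamma>\<close> as \<open>s\<close> runs through \<open>[0, l]\<close>. Since it has unit speed, \<open>l\<close> is the length of \<open>\<gamma>\<close>.\<close>

definition arc_length_param :: "(real \<Rightarrow> complex) \<Rightarrow> real \<Rightarrow> complex set \<Rightarrow> bool" where
  "arc_length_param g l \<gamma> \<longleftrightarrow>
     0 < l \<and>
     (\<forall>s. g (s + l) = g s) \<and>
     simple_path (\<lambda>x. g (l * x)) \<and>
     path_image (\<lambda>x. g (l * x)) = \<gamma> \<and>
     (\<forall>s. g differentiable (at s) \<and> norm (vector_derivative g (at s)) = 1)"

definition C1_holder :: "real \<Rightarrow> (real \<Rightarrow> complex) \<Rightarrow> bool" where
  "C1_holder \<alpha> g \<longleftrightarrow>
     (\<forall>s. g differentiable (at s)) \<and>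
     continuous_on UNIV (\<lambda>s. vector_derivative g (at s)) \<and>
     (\<exists>C. \<forall>s t. norm (vector_derivative g (at t) - vector_derivative g (at s))
                   \<le> C * \<bar>t - s\<bar> powr \<alpha>)"

text \<open>Positive orientation: \<open>i g'(s)\<close> is the inner unit normal, that is, it points into \<open>D\<close>.\<close>

definition positively_oriented :: "(real \<Rightarrow> complex) \<Rightarrow> complex set \<Rightarrow> bool" where
  "positively_oriented g D \<longleftrightarrow>
     (\<forall>s. \<forall>\<^sub>F h in at_right 0. g s + h *\<^sub>R (\<i> * vector_derivative g (at s)) \<in> D)"

definition weak_homeomorphism ::
    "(complex \<Rightarrow> complex) \<Rightarrow> (real \<Rightarrow> complex) \<Rightarrow> real \<Rightarrow> (real \<Rightarrow> real) \<Rightarrow> bool" where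
  "weak_homeomorphism F g l f \<longleftrightarrow>
     mono_on {0..2*pi} f \<and> f ` {0..2*pi} = {0..l} \<and>
     (\<forall>t\<in>{0..2*pi}. F (cis t) = g (f t))"


section \<open>Poisson extension and Jacobian\<close>

definition poisson_kernel :: "real \<Rightarrow> real \<Rightarrow> real" where
  "poisson_kernel r t = (1 - r\<^sup>2) / (2 * pi * (1 - 2 * r * cos t + r\<^sup>2))"

definition poisson_extension :: "(complex \<Rightarrow> complex) \<Rightarrow> complex \<Rightarrow> complex" where
  "poisson_extension F z =
     integral {0..2*pi} (\<lambda>t. poisson_kernel (norm z) (t - Arg z) *\<^sub>R F (cis t))"

definition wirtinger :: "(complex \<Rightarrow> complex) \<Rightarrow> complex \<Rightarrow> complex" where
  "wirtinger w z =
     (frechet_derivative w (at z) 1 - \<i> * frechet_derivative w (at z) \<i>) / 2"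

definition wirtinger_bar :: "(complex \<Rightarrow> complex) \<Rightarrow> complex \<Rightarrow> complex" where
  "wirtinger_bar w z =
     (frechet_derivative w (at z) 1 + \<i> * frechet_derivative w (at z) \<i>) / 2"

definition jacobian :: "(complex \<Rightarrow> complex) \<Rightarrow> complex \<Rightarrow> real" where
  "jacobian w z = (norm (wirtinger w z))\<^sup>2 - (norm (wirtinger_bar w z))\<^sup>2"

definition circle_deriv :: "(complex \<Rightarrow> complex) \<Rightarrow> real \<Rightarrow> complex" where
  "circle_deriv F t = vector_derivative (\<lambda>s. F (cis s)) (at t)"

text \<open>
  \<open>T\<close> is the continuous extension to the circle of \<open>J\<^sub>w / |F'|\<close>, where \<open>w = P[F]\<close> and
  \<open>F(e\<^sup>i\<^sup>t) = g(f(t))\<close>. As \<open>f\<close> need not be strictly increasing, \<open>F'\<close> may vanish on a set of positive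
  measure, where the quotient is \<open>0/0\<close>. The values at almost all \<open>t\<close> with \<open>F'(t) \<noteq> 0\<close> and continuity
  determine \<open>T\<close> except on open arcs where \<open>F\<close> is constant; the last clause fixes it there.
  It is what the quotient is everywhere else: in polar coordinates
  \<open>J\<^sub>w = - (1/r) \<langle>\<partial>\<^sub>r w, i \<partial>\<^sub>t w\<rangle>\<close>, and on the circle \<open>\<partial>\<^sub>t w = F'(t) = |F'(t)| g'(f(t))\<close>, so that
  dividing by \<open>|F'(t)|\<close> leaves \<open>- \<langle>\<partial>\<^sub>r w, i g'(f(t))\<rangle>\<close>, the inward radial derivative of \<open>w\<close> in the
  direction of the inner normal. (Leaving \<open>T\<close> free on such arcs would make the requirement \<open>T > 0\<close>
  empty there.)
\<close>

definition jacobian_ratio_extension ::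
    "(complex \<Rightarrow> complex) \<Rightarrow> (real \<Rightarrow> complex) \<Rightarrow> (real \<Rightarrow> real) \<Rightarrow> (complex \<Rightarrow> real) \<Rightarrow> bool" where
  "jacobian_ratio_extension F g f T \<longleftrightarrow>
     continuous_on (sphere 0 1) T \<and>
     (AE t in lebesgue_on {0..2*pi}.
        (\<lambda>s. F (cis s)) differentiable (at t) \<and>
        (\<exists>J. ((\<lambda>r. jacobian (poisson_extension F) (rcis r t)) \<longlongrightarrow> J) (at_left 1) \<and>
             (circle_deriv F t \<noteq> 0 \<longrightarrow> T (cis t) = J / norm (circle_deriv F t)))) \<and>
     (\<forall>t\<in>{0..2*pi}. (\<forall>\<^sub>F s in nhds t. F (cis s) = F (cis t)) \<longrightarrow>
        ((\<lambda>r. ((poisson_extension F (rcis r t) - F (cis t))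
                 \<bullet> (\<i> * vector_derivative g (at (f t)))) / (1 - r))
           \<longlongrightarrow> T (cis t)) (at_left 1))"


section \<open>Diffeomorphisms\<close>

text \<open>Only used on open sets \<open>S\<close>: all partial derivatives up to order \<open>k\<close> exist and are continuous.\<close>

fun Ck_on :: "nat \<Rightarrow> ('a::euclidean_space \<Rightarrow> 'b::real_normed_vector) \<Rightarrow> 'a set \<Rightarrow> bool" where
  "Ck_on 0 f S \<longleftrightarrow> continuous_on S f"
| "Ck_on (Suc k) f S \<longleftrightarrow>
     f differentiable_on S \<and> (\<forall>b\<in>Basis. Ck_on k (\<lambda>x. frechet_derivative f (at x) b) S)"

definition diffeomorphism_onto ::
    "('a::euclidean_space \<Rightarrow> 'b::euclidean_space) \<Rightarrow> 'a set \<Rightarrow> 'b set \<Rightarrow> bool" where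
  "diffeomorphism_onto w U D \<longleftrightarrow>
     bij_betw w U D \<and> (\<forall>k. Ck_on k w U) \<and> (\<forall>k. Ck_on k (inv_into U w) D)"

end

theory Submission
  imports Defs
begin

text \<open>
  The Poisson extension \<open>w = P[F]\<close> is harmonic: \<open>w = h + cnj k\<close> up to a constant, with \<open>h\<close> and \<open>k\<close>
  holomorphic, and \<open>J\<^sub>w = |h'|\<^sup>2 - |k'|\<^sup>2\<close>. For a unit vector \<open>e\<close> the function
  \<open>f\<^sub>e = cnj e * h' + e * k'\<close>, which is twice the derivative \<open>\<partial>\<^sub>z\<close> of the real function \<open>w \<bullet> e\<close>, is
  holomorphic, and \<open>J\<^sub>w(z) = 0\<close> holds exactly when \<open>f\<^sub>e(z) = 0\<close> for some unit \<open>e\<close>. The Jacobian thus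
  vanishes nowhere as soon as every \<open>f\<^sub>e\<close> is free of zeros, and these can be counted from the boundary.

  \<^bold>\<open>Boundary behaviour.\<close> Write \<open>F(e\<^sup>i\<^sup>t) = g(\<phi>(t))\<close> with a nondecreasing Lipschitz function \<open>\<phi>\<close> on the
  whole line (\<open>boundary_lift_exists\<close>). In polar coordinates \<open>z f\<^sub>e(z)\<close> at \<open>z = r e\<^sup>i\<^sup>\<tau>\<close> is an integral of
  an explicit kernel, of size \<open>1 / |e\<^sup>i\<^sup>s - r|\<^sup>2\<close>, against the increment
  \<open>s \<mapsto> (F(e\<^sup>i\<^sup>(\<^sup>\<tau>\<^sup>+\<^sup>s\<^sup>)) - F(e\<^sup>i\<^sup>\<tau>)) \<bullet> e\<close>. Call the value \<open>A\<close> when \<open>e\<close> is the normal \<open>i g'(\<phi>(\<tau>))\<close> and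
  \<open>B\<close> when \<open>e\<close> is the tangent \<open>g'(\<phi>(\<tau>))\<close>.
  \<^item> In the normal direction the increment is \<open>O(|s|\<^sup>1\<^sup>+\<^sup>\<alpha>)\<close>, because \<open>\<gamma>\<close> is \<open>C\<^sup>1\<^sup>,\<^sup>\<alpha>\<close>. Hence \<open>A\<close> converges
    to a real number \<open>- T(\<tau>)\<close>, at the rate \<open>(1 - r)\<^sup>\<alpha>\<^sup>/\<^sup>2\<close> uniformly in \<open>\<tau>\<close>; so \<open>T\<close> is continuous.
  \<^item> In the tangential direction the increment is only \<open>O(|s|)\<close>. Then \<open>B\<close> may be unbounded, but it grows
    more slowly than any negative power of \<open>1 - r\<close>, and \<open>Im B\<close> tends to \<open>- \<phi>'(\<tau>)\<close> wherever \<open>\<phi>\<close> is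
    differentiable.

  \<^noindent> Since \<open>r\<^sup>2 J\<^sub>w = Re A * Im B - Im A * Re B\<close> and \<open>Im A\<close> decays faster than \<open>Re B\<close> can grow, \<open>J\<^sub>w\<close> tends
  to \<open>T(\<tau>) \<phi>'(\<tau>)\<close> at every point of differentiability of \<open>\<phi>\<close>, that is, almost everywhere
  (\<open>mono_lipschitz_ae_differentiable\<close>). As \<open>|F'| = \<phi>'\<close>, this identifies \<open>T\<close> as the continuous extension
  of \<open>J\<^sub>w / |F'|\<close>; on arcs where \<open>F\<close> is constant it is the limit of the radial difference quotient.

  \<^bold>\<open>No zeros.\<close> Let \<open>T > 0\<close> and suppose first that \<open>\<phi>\<close> increases at least linearly. Then
  \<open>Im B \<le> - c/4\<close> and \<open>J\<^sub>w > 0\<close> on all circles \<open>|z| = r\<close> with \<open>r\<close> close to \<open>1\<close>. As \<open>|k'| < |h'|\<close> there,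
  every \<open>z f\<^sub>e\<close> has on such a circle the index of \<open>z h'\<close>, whatever \<open>e\<close> is, and \<open>Im B < 0\<close> shows that this is
  also the index of the tangent \<open>g'(\<phi>(\<tau>))\<close>. By Hopf's Umlaufsatz (\<open>umlaufsatz\<close>) that is \<open>1\<close> or \<open>-1\<close>, so
  \<open>f\<^sub>e\<close> has index \<open>0\<close> or \<open>-2\<close>; being its number of zeros, the index is not negative, so it is \<open>0\<close>.
  In general \<open>\<phi>\<close> is approximated by strictly increasing lifts, for which \<open>T\<close> stays positive, and Hurwitz's
  theorem carries the absence of zeros to the limit (\<open>jacobian_nonzero\<close>).

  \<^bold>\<open>Injectivity.\<close> Hence \<open>w\<close> is a local diffeomorphism. It extends continuously to the closed disk and maps
  the circle onto \<open>\<gamma>\<close>, so it is a proper map of the disk onto \<open>D\<close>, therefore a covering of the simply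
  connected domain \<open>D\<close>, therefore injective (\<open>local_homeo_onto_jordan_domain\<close>). The inverse is smooth
  because \<open>J\<^sub>w\<close> has no zeros.
\<close>

section \<open>Monotone Lipschitz functions\<close>

lemma lipschitz_image_negligible:
  fixes f :: "real \<Rightarrow> real"
  assumes lip: "\<And>x y. \<bar>f x - f y\<bar> \<le> M * \<bar>x - y\<bar>" and "negligible S"
  shows "negligible (f ` S)"
proof (rule negligible_locally_Lipschitz_image [OF _ \<open>negligible S\<close>])
  fix x assume "x \<in> S"
  show "\<exists>T B. open T \<and> x \<in> T \<and> (\<forall>y\<in>S \<inter> T. norm (f y - f x) \<le> B * norm (y - x))"
    by (rule exI[of _ UNIV], rule exI[of _ M]) (use lip in auto)
qed auto

lemma lipschitz_image_sets_lebesgue: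
  fixes f :: "real \<Rightarrow> real"
  assumes lip: "\<And>x y. \<bar>f x - f y\<bar> \<le> M * \<bar>x - y\<bar>" and "S \<in> sets lebesgue"
  shows "f ` S \<in> sets lebesgue"
proof (rule sets_lebesgue_continuous_image [OF \<open>S \<in> sets lebesgue\<close>])
  have "(max M 0)-lipschitz_on UNIV f"
  proof (rule lipschitz_onI)
    show "dist (f x) (f y) \<le> max M 0 * dist x y" for x y
      using order_trans[OF lip[of x y] mult_right_mono[of M "max M 0" "\<bar>x - y\<bar>"]]
      by (simp add: dist_real_def)
  qed auto
  then show "continuous_on S f"
    by (meson lipschitz_on_continuous_on continuous_on_subset subset_UNIV)
  show "negligible (f ` T)" if "negligible T" for T
    by (rule lipschitz_image_negligible [OF lip that])
qed auto

lemma emeasure_UN_le_nn_integral: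
  assumes "countable I" and X: "\<And>i. i \<in> I \<Longrightarrow> X i \<in> sets M"
  shows "emeasure M (\<Union>i\<in>I. X i) \<le> (\<integral>\<^sup>+i. emeasure M (X i) \<partial>count_space I)"
proof -
  have ind: "indicator (\<Union>i\<in>I. X i) x \<le> (\<integral>\<^sup>+i. indicator (X i) x \<partial>count_space I)" for x
  proof (cases "\<exists>i\<in>I. x \<in> X i")
    case True
    then obtain i where i: "i \<in> I" "x \<in> X i" by auto
    have "1 = (\<integral>\<^sup>+j. indicator {i} j \<partial>count_space I)"
      using i by (simp add: nn_integral_count_space_indicator)
    also have "\<dots> \<le> (\<integral>\<^sup>+j. indicator (X j) x \<partial>count_space I)"
      using i by (intro nn_integral_mono) (auto simp: indicator_def)
    finally show ?thesis using True by (simp add: indicator_def)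
  qed (auto simp: indicator_def)
  have "emeasure M (\<Union>i\<in>I. X i) = (\<integral>\<^sup>+x. indicator (\<Union>i\<in>I. X i) x \<partial>M)"
    using assms by (intro nn_integral_indicator [symmetric] sets.countable_UN') auto
  also have "\<dots> \<le> (\<integral>\<^sup>+x. (\<integral>\<^sup>+i. indicator (X i) x \<partial>count_space I) \<partial>M)"
    by (intro nn_integral_mono ind)
  also have "\<dots> = (\<integral>\<^sup>+i. (\<integral>\<^sup>+x. indicator (X i) x \<partial>M) \<partial>count_space I)"
    using assms by (intro nn_integral_count_space_nn_integral) auto
  also have "\<dots> = (\<integral>\<^sup>+i. emeasure M (X i) \<partial>count_space I)"
    using X by (intro nn_integral_cong) auto
  finally show ?thesis .
qed

text \<open>The covering argument behind Lebesgue's differentiation theorem. The intervals of slope at most \<open>p\<close>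
inside an open set \<open>T\<close> slightly larger than \<open>S\<close> cover \<open>S\<close> in the sense of Vitali. A disjoint subfamily
covers \<open>S\<close> up to a null set, whose image is null because \<open>f\<close> is Lipschitz; the images of the
intervals of the subfamily have total length at most \<open>p\<close> times the measure of \<open>T\<close>.\<close>

lemma emeasure_image_le_slope:
  fixes f :: "real \<Rightarrow> real"
  assumes mono: "mono f" and lip: "\<And>x y. \<bar>f x - f y\<bar> \<le> M * \<bar>x - y\<bar>"
    and S: "S \<in> lmeasurable" and p: "0 \<le> p"
    and slope: "\<And>x d. x \<in> S \<Longrightarrow> 0 < d \<Longrightarrow>
                  \<exists>u v. u < x \<and> x < v \<and> v - u < d \<and> f v - f u \<le> p * (v - u)"
  shows "emeasure lebesgue (f ` S) \<le> ennreal p * emeasure lebesgue S"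
proof -
  have main: "emeasure lebesgue (f ` S) \<le> ennreal (p * measure lebesgue S + e)" if "e > 0" for e
  proof -
    \<comment> \<open>Chosen so that \<open>p * e' \<le> e\<close>, also for \<open>p = 0\<close>.\<close>
    define e' where "e' = e / (p + 1)"
    have e': "e' > 0" using that p by (simp add: e'_def)
    obtain T where T: "open T" "S \<subseteq> T" "T \<in> lmeasurable" "measure lebesgue (T - S) < e'"
    proof -
      obtain T where T: "open T" "S \<subseteq> T" "T - S \<in> lmeasurable" "emeasure lebesgue (T - S) < ennreal e'"
        using sets_lebesgue_outer_open [OF fmeasurableD [OF S] e'] by blast
      have "T = S \<union> (T - S)" using T by blast
      then have "T \<in> lmeasurable" using S T(3) by (metis fmeasurable.Un)
      moreover have "measure lebesgue (T - S) < e'"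
        using T(3,4) e' by (simp add: emeasure_eq_measure2 ennreal_less_iff)
      ultimately show thesis using that T by blast
    qed
    have mT: "measure lebesgue T \<le> measure lebesgue S + e'"
      using T S measurable_measure_Diff[of T lebesgue S] by (simp add: fmeasurableD)
    \<comment> \<open>The admissible intervals, each encoded as a pair of centre and radius.\<close>
    define K where "K = {ar :: real \<times> real. 0 < snd ar \<and> cball (fst ar) (snd ar) \<subseteq> T \<and>
        f (fst ar + snd ar) - f (fst ar - snd ar) \<le> p * (2 * snd ar)}"
    obtain C where C: "countable C" "C \<subseteq> K"
      and dis: "pairwise (\<lambda>i j. disjnt (cball (fst i) (snd i)) (cball (fst j) (snd j))) C"
      and neg: "negligible (S - (\<Union>i\<in>C. cball (fst i) (snd i)))"
    proof (rule Vitali_covering_theorem_cballs [of K snd S fst])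
      show "0 < snd i" if "i \<in> K" for i using that by (simp add: K_def)
      fix x d :: real assume x: "x \<in> S" and d: "0 < d"
      obtain \<rho> where \<rho>: "\<rho> > 0" "cball x \<rho> \<subseteq> T"
        using T x open_contains_cball by blast
      obtain u v where uv: "u < x" "x < v" "v - u < min d \<rho>" "f v - f u \<le> p * (v - u)"
        using slope[OF x, of "min d \<rho>"] d \<rho> by auto
      define a r where "a = (u + v) / 2" and "r = (v - u) / 2"
      have v: "v = a + r" and u: "u = a - r" by (simp_all add: a_def r_def field_simps)
      have "r > 0" using uv by (simp add: r_def)
      have "cball a r \<subseteq> cball x \<rho>" "x \<in> cball a r"
        using uv unfolding u v cball_eq_atLeastAtMost by auto
      then show "\<exists>i. i \<in> K \<and> x \<in> cball (fst i) (snd i) \<and> snd i < d"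
        using uv \<rho> \<open>r > 0\<close> unfolding u v by (intro exI[of _ "(a, r)"]) (auto simp: K_def)
    qed (rule that)
    let ?B = "\<lambda>i. cball (fst i) (snd i) :: real set"
    have sub: "f ` S \<subseteq> f ` (S - (\<Union>i\<in>C. ?B i)) \<union> (\<Union>i\<in>C. {f (fst i - snd i)..f (fst i + snd i)})"
    proof (rule image_subsetI)
      fix x assume x: "x \<in> S"
      show "f x \<in> f ` (S - (\<Union>i\<in>C. ?B i)) \<union> (\<Union>i\<in>C. {f (fst i - snd i)..f (fst i + snd i)})"
      proof (cases "x \<in> (\<Union>i\<in>C. ?B i)")
        case True
        then obtain i where i: "i \<in> C" "fst i - snd i \<le> x" "x \<le> fst i + snd i"
          unfolding cball_eq_atLeastAtMost by auto
        have "f x \<in> {f (fst i - snd i)..f (fst i + snd i)}" using i by (auto intro!: monoD[OF mono])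
        then show ?thesis using i(1) by blast
      qed (use x in blast)
    qed
    have n0: "negligible (f ` (S - (\<Union>i\<in>C. ?B i)))"
      by (rule lipschitz_image_negligible [OF lip neg])
    have "emeasure lebesgue (f ` S) \<le> emeasure lebesgue (f ` (S - (\<Union>i\<in>C. ?B i)) \<union> (\<Union>i\<in>C. {f (fst i - snd i)..f (fst i + snd i)}))"
      using C(1) n0 by (intro emeasure_mono sub sets.Un sets.countable_UN') (auto simp: negligible_imp_sets)
    also have "\<dots> \<le> emeasure lebesgue (f ` (S - (\<Union>i\<in>C. ?B i))) + emeasure lebesgue (\<Union>i\<in>C. {f (fst i - snd i)..f (fst i + snd i)})"
      using C(1) n0 by (intro emeasure_subadditive sets.countable_UN') (auto simp: negligible_imp_sets)
    also have "\<dots> = emeasure lebesgue (\<Union>i\<in>C. {f (fst i - snd i)..f (fst i + snd i)})"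
      using null_setsD1[OF n0[unfolded negligible_iff_null_sets]] by simp
    also have "\<dots> \<le> (\<integral>\<^sup>+i. emeasure lebesgue {f (fst i - snd i)..f (fst i + snd i)} \<partial>count_space C)"
      using C(1) by (intro emeasure_UN_le_nn_integral) auto
    also have "\<dots> \<le> (\<integral>\<^sup>+i. ennreal p * emeasure lebesgue (?B i) \<partial>count_space C)"
    proof (rule nn_integral_mono)
      fix i assume "i \<in> space (count_space C)"
      then have i: "i \<in> K" using C by auto
      have "f (fst i - snd i) \<le> f (fst i + snd i)" using i by (intro monoD[OF mono]) (auto simp: K_def)
      then have "emeasure lebesgue {f (fst i - snd i)..f (fst i + snd i)} = ennreal (f (fst i + snd i) - f (fst i - snd i))"
        by simp
      also have "\<dots> \<le> ennreal (p * (2 * snd i))" using i by (intro ennreal_leI) (auto simp: K_def)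
      also have "\<dots> = ennreal p * emeasure lebesgue (?B i)"
        using i p by (simp add: K_def cball_eq_atLeastAtMost ennreal_mult)
      finally show "emeasure lebesgue {f (fst i - snd i)..f (fst i + snd i)} \<le> ennreal p * emeasure lebesgue (?B i)" .
    qed
    also have "\<dots> = ennreal p * (\<integral>\<^sup>+i. emeasure lebesgue (?B i) \<partial>count_space C)"
      by (intro nn_integral_cmult) auto
    also have "(\<integral>\<^sup>+i. emeasure lebesgue (?B i) \<partial>count_space C) = emeasure lebesgue (\<Union>i\<in>C. ?B i)"
    proof (rule emeasure_UN_countable [symmetric])
      show "disjoint_family_on ?B C"
        using dis by (auto simp: disjoint_family_on_def pairwise_def disjnt_def)
    qed (use C in auto)
    also have "ennreal p * emeasure lebesgue (\<Union>i\<in>C. ?B i) \<le> ennreal p * emeasure lebesgue T"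
      using C(2) T(3) by (intro mult_left_mono emeasure_mono) (auto simp: K_def)
    also have "\<dots> = ennreal (p * measure lebesgue T)"
      using T p by (simp add: emeasure_eq_measure2 ennreal_mult)
    also have "\<dots> \<le> ennreal (p * measure lebesgue S + e)"
    proof (rule ennreal_leI)
      have "p * measure lebesgue T \<le> p * (measure lebesgue S + e')" using mT p by (intro mult_left_mono)
      moreover have "p * e' \<le> e" using p that by (simp add: e'_def field_simps)
      ultimately show "p * measure lebesgue T \<le> p * measure lebesgue S + e" by (simp add: algebra_simps)
    qed
    finally show ?thesis .
  qed
  have "emeasure lebesgue (f ` S) \<le> ennreal (p * measure lebesgue S)"
  proof (rule ennreal_le_epsilon)
    fix e :: real assume "0 < e"
    from main[OF this] show "emeasure lebesgue (f ` S) \<le> ennreal (p * measure lebesgue S) + ennreal e"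
      using p \<open>0 < e\<close> by (simp add: ennreal_plus[symmetric] del: ennreal_plus)
  qed
  then show ?thesis using S p by (simp add: emeasure_eq_measure2 ennreal_mult)
qed

text \<open>The set is a \<open>G\<^sub>\<delta>\<close>: for each \<open>n\<close>, the open intervals \<open>{u<..<v}\<close> with \<open>P u v\<close> that are shorter than
\<open>1 / Suc n\<close> have an open union.\<close>

lemma arbitrarily_small_intervals_borel:
  "{x::real. \<forall>d>0. \<exists>u v. u < x \<and> x < v \<and> v - u < d \<and> P u v} \<in> sets borel"
proof -
  have "{x::real. \<forall>d>0. \<exists>u v. u < x \<and> x < v \<and> v - u < d \<and> P u v} =
        (\<Inter>n::nat. \<Union>{{u<..<v} |u v. v - u < 1 / real (Suc n) \<and> P u v})" (is "?L = ?R")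
  proof (intro equalityI subsetI)
    fix x assume x: "x \<in> ?L"
    show "x \<in> ?R"
    proof (rule INT_I)
      fix n :: nat
      have "0 < 1 / real (Suc n)" by simp
      then obtain u v where "u < x" "x < v" "v - u < 1 / real (Suc n)" "P u v" using x by blast
      then show "x \<in> \<Union>{{u<..<v} |u v. v - u < 1 / real (Suc n) \<and> P u v}"
        by (intro UnionI[of "{u<..<v}"]) (auto simp del: of_nat_Suc)
    qed
  next
    fix x assume x: "x \<in> ?R"
    show "x \<in> ?L"
    proof (clarify)
      fix d :: real assume "d > 0"
      then obtain n where n: "1 / real (Suc n) < d" using nat_approx_posE by blast
      have "x \<in> \<Union>{{u<..<v} |u v. v - u < 1 / real (Suc n) \<and> P u v}" using x by (rule INT_D) simp
      then obtain u v where "x \<in> {u<..<v}" "v - u < 1 / real (Suc n)" "P u v" by blast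
      with n show "\<exists>u v. u < x \<and> x < v \<and> v - u < d \<and> P u v"
        by (intro exI[of _ u] exI[of _ v]) auto
    qed
  qed
  also have "\<dots> \<in> sets borel"
    by (intro sets.countable_INT') (auto intro!: borel_open open_Union)
  finally show ?thesis .
qed

text \<open>If \<open>f\<close> is not differentiable at \<open>x\<close>, then \<open>x\<close> lies in arbitrarily short intervals of slope at most \<open>p\<close> and
in arbitrarily short ones of slope at least \<open>q\<close>, for some rationals \<open>p < q\<close>. On the set \<open>S\<close> of such
points in a bounded interval the slope lemma applies twice: to \<open>f\<close> it gives \<open>|f(S)| \<le> p |S|\<close>, and to the
inverse function, whose slopes there are at most \<open>1/q\<close>, it gives \<open>|S| \<le> |f(S)| / q\<close>. So
\<open>|S| \<le> (p/q) |S|\<close>, and \<open>S\<close> is a null set.\<close>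

lemma bilipschitz_ae_differentiable:
  fixes f :: "real \<Rightarrow> real"
  assumes lo: "\<And>x y. x \<le> y \<Longrightarrow> y - x \<le> f y - f x"
    and hi: "\<And>x y. x \<le> y \<Longrightarrow> f y - f x \<le> K * (y - x)"
  shows "negligible {x. \<not> f differentiable (at x)}"
proof -
  have mono: "mono f" using lo by (intro monoI) (smt (verit))
  have sm: "f x < f y" if "x < y" for x y using lo[of x y] that by linarith
  have K1: "1 \<le> K" using lo[of 0 1] hi[of 0 1] by simp
  have lip: "\<bar>f x - f y\<bar> \<le> K * \<bar>x - y\<bar>" for x y
    using lo[of x y] hi[of x y] lo[of y x] hi[of y x] by (cases "x \<le> y") auto
  have cont: "continuous_on UNIV f"
  proof (rule lipschitz_on_continuous_on)
    show "K-lipschitz_on UNIV f" using lip K1 by (intro lipschitz_onI) (auto simp: dist_real_def)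
  qed
  have inj: "inj f" by (rule injI) (metis sm linorder_neqE_linordered_idom order_less_irrefl)
  have surj: "surj f"
  proof -
    have "\<exists>x. f x = y" for y
    proof -
      define c where "c = \<bar>y - f 0\<bar>"
      have "f (-c) \<le> y" "y \<le> f c" using lo[of "-c" 0] lo[of 0 c] by (auto simp: c_def)
      moreover have "-c \<le> c" by (simp add: c_def)
      ultimately show ?thesis using IVT'[of f "-c" y c] cont continuous_on_subset by blast
    qed
    then show ?thesis by (metis surjI)
  qed
  define h where "h = inv f"
  have hf: "h (f x) = x" for x by (simp add: h_def inj)
  have fh: "f (h x) = x" for x by (simp add: h_def surj surj_f_inv_f)
  have hmono: "mono h" by (rule monoI) (metis fh sm linorder_not_le)
  have hlip: "\<bar>h x - h y\<bar> \<le> 1 * \<bar>x - y\<bar>" for x y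
    using lo[of "h x" "h y"] lo[of "h y" "h x"] by (cases "h x \<le> h y") (auto simp: fh)
  define A where "A p = {x. \<forall>d>0. \<exists>u v. u < x \<and> x < v \<and> v - u < d \<and> f v - f u \<le> p * (v - u)}" for p
  define B where "B q = {x. \<forall>d>0. \<exists>u v. u < x \<and> x < v \<and> v - u < d \<and> q * (v - u) \<le> f v - f u}" for q
  have null: "negligible (A p \<inter> B q \<inter> {-real n..real n})" if pq: "0 < p" "p < q" for p q n
  proof -
    let ?S = "A p \<inter> B q \<inter> {-real n..real n}"
    have meas: "A p \<in> sets borel" "B q \<in> sets borel"
      unfolding A_def B_def by (rule arbitrarily_small_intervals_borel)+
    then have S: "?S \<in> lmeasurable"
      by (subst Int_commute, intro fmeasurable_Int_fmeasurable) auto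
    have e1: "emeasure lebesgue (f ` ?S) \<le> ennreal p * emeasure lebesgue ?S"
      using pq by (intro emeasure_image_le_slope[OF mono lip S]) (auto simp: A_def)
    have finS: "emeasure lebesgue ?S < \<infinity>" using S by (simp only: emeasure_eq_measure2) simp
    have fS: "f ` ?S \<in> lmeasurable"
      using e1 finS lipschitz_image_sets_lebesgue[OF lip fmeasurableD[OF S]]
      by (auto simp: fmeasurable_def ennreal_mult_less_top intro: le_less_trans)
    have "emeasure lebesgue (h ` (f ` ?S)) \<le> ennreal (1/q) * emeasure lebesgue (f ` ?S)"
    proof (rule emeasure_image_le_slope[OF hmono hlip fS])
      fix y d :: real assume y: "y \<in> f ` ?S" and d: "0 < d"
      then obtain x where x: "y = f x" "x \<in> B q" by auto
      have "0 < d / K" using d K1 by simp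
      then obtain u v where uv: "u < x" "x < v" "v - u < d / K" "q * (v - u) \<le> f v - f u"
        using x(2) unfolding B_def by blast
      have "f v - f u < d" using hi[of u v] uv K1 d by (simp add: field_simps)
      then show "\<exists>u v. u < y \<and> y < v \<and> v - u < d \<and> h v - h u \<le> 1/q * (v - u)"
        using uv x sm pq by (intro exI[of _ "f u"] exI[of _ "f v"]) (auto simp: hf field_simps)
    qed (use pq in auto)
    also have "h ` (f ` ?S) = ?S" by (simp add: image_image hf)
    also have "ennreal (1/q) * emeasure lebesgue (f ` ?S) \<le> ennreal (1/q) * (ennreal p * emeasure lebesgue ?S)"
      by (intro mult_left_mono e1) auto
    finally have "ennreal (measure lebesgue ?S) \<le> ennreal ((p/q) * measure lebesgue ?S)"
      using pq S by (simp add: emeasure_eq_measure2 ennreal_mult[symmetric] field_simps)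
    then have "measure lebesgue ?S \<le> (p/q) * measure lebesgue ?S"
      using pq by (subst (asm) ennreal_le_iff) auto
    then have "measure lebesgue ?S * (q - p) \<le> 0" using pq by (simp add: field_simps)
    then have "measure lebesgue ?S \<le> 0" using pq by (simp add: mult_le_0_iff)
    then have "measure lebesgue ?S = 0" by (simp add: measure_le_0_iff)
    then show ?thesis using S by (simp add: negligible_iff_measure0)
  qed
  let ?I = "{t \<in> \<rat> \<times> \<rat> \<times> (UNIV::nat set). 0 < fst t \<and> fst t < fst (snd t)}"
  have "countable ?I"
    by (rule countable_subset[of _ "\<rat> \<times> \<rat> \<times> UNIV"]) (auto intro!: countable_SIGMA countable_rat)
  then have negU: "negligible (\<Union>t\<in>?I. A (fst t) \<inter> B (fst (snd t)) \<inter> {-real (snd (snd t))..real (snd (snd t))})"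
    by (intro negligible_countable_Union) (auto intro!: null)
  moreover have "{x. \<not> f differentiable (at x)} \<subseteq> (\<Union>t\<in>?I. A (fst t) \<inter> B (fst (snd t)) \<inter> {-real (snd (snd t))..real (snd (snd t))})"
  proof (rule subsetI, rule ccontr)
    fix x assume nd: "x \<in> {x. \<not> f differentiable (at x)}"
      and nin: "x \<notin> (\<Union>t\<in>?I. A (fst t) \<inter> B (fst (snd t)) \<inter> {-real (snd (snd t))..real (snd (snd t))})"
    obtain n :: nat where n: "\<bar>x\<bar> \<le> real n" using real_arch_simple by blast
    have sep: "x \<notin> A p \<or> x \<notin> B q" if "p \<in> \<rat>" "q \<in> \<rat>" "0 < p" "p < q" for p q
    proof (rule ccontr)
      assume "\<not> (x \<notin> A p \<or> x \<notin> B q)"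
      then have "x \<in> A (fst (p, q, n)) \<inter> B (fst (snd (p, q, n))) \<inter> {-real (snd (snd (p, q, n)))..real (snd (snd (p, q, n)))}"
        using n by auto
      moreover have "(p, q, n) \<in> ?I" using that by simp
      ultimately show False using nin by blast
    qed
    \<comment> \<open>The lower derivative of \<open>f\<close> at \<open>x\<close>, taken over intervals around \<open>x\<close>. Since \<open>x\<close> is in no
\<open>A p \<inter> B q\<close>, it is the upper derivative as well.\<close>
    define D where "D = Sup {p. x \<notin> A p}"
    have bdd: "bdd_above {p. x \<notin> A p}"
    proof (rule bdd_aboveI)
      fix p assume "p \<in> {p. x \<notin> A p}"
      then obtain d where d: "d > 0" "\<And>u v. u < x \<Longrightarrow> x < v \<Longrightarrow> v - u < d \<Longrightarrow> p * (v - u) < f v - f u"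
        unfolding A_def mem_Collect_eq not_all not_imp not_ex de_Morgan_conj not_le by blast
      have "p * (d/2) < f (x + d/4) - f (x - d/4)"
        using d(2)[of "x - d/4" "x + d/4"] d(1) by simp
      also have "\<dots> \<le> K * (d/2)" using hi[of "x - d/4" "x + d/4"] d(1) by simp
      finally show "p \<le> K" using d(1) by simp
    qed
    have half: "x \<notin> A (1/2)"
    proof
      assume "x \<in> A (1/2)"
      then obtain u v where "u < x" "x < v" "f v - f u \<le> 1/2 * (v - u)"
        unfolding A_def using zero_less_one by blast
      then show False using lo[of u v] by simp
    qed
    have D0: "D \<ge> 1/2" unfolding D_def by (rule cSup_upper) (use half bdd in auto)
    have straddle: "\<exists>d>0. \<forall>u v. u < x \<longrightarrow> x < v \<longrightarrow> v - u < d \<longrightarrow> \<bar>f v - f u - D * (v - u)\<bar> \<le> e * (v - u)"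
      if e: "e > 0" for e
    proof -
      obtain p1 where p1: "x \<notin> A p1" "D - e < p1"
        using less_cSup_iff[of "{p. x \<notin> A p}" "D - e"] half bdd e unfolding D_def[symmetric] by auto
      then obtain d1 where d1: "d1 > 0" "\<And>u v. u < x \<Longrightarrow> x < v \<Longrightarrow> v - u < d1 \<Longrightarrow> p1 * (v - u) < f v - f u"
        unfolding A_def mem_Collect_eq not_all not_imp not_ex de_Morgan_conj not_le by blast
      obtain p where p: "p \<in> \<rat>" "D < p" "p < D + e" using Rats_dense_in_real[of D "D + e"] e by auto
      obtain q where q: "q \<in> \<rat>" "p < q" "q < D + e" using Rats_dense_in_real[of p "D + e"] p by auto
      have "x \<in> A p"
      proof (rule ccontr)
        assume "x \<notin> A p"
        then have "p \<le> D" unfolding D_def by (intro cSup_upper bdd) simp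
        then show False using p by simp
      qed
      then have "x \<notin> B q" using sep[of p q] p q D0 by auto
      then obtain d2 where d2: "d2 > 0" "\<And>u v. u < x \<Longrightarrow> x < v \<Longrightarrow> v - u < d2 \<Longrightarrow> f v - f u < q * (v - u)"
        unfolding B_def mem_Collect_eq not_all not_imp not_ex de_Morgan_conj not_le by blast
      have "\<bar>f v - f u - D * (v - u)\<bar> \<le> e * (v - u)" if "u < x" "x < v" "v - u < min d1 d2" for u v
      proof -
        have "D * (v - u) - e * (v - u) \<le> p1 * (v - u)"
          using mult_right_mono[of "D - e" p1 "v - u"] p1 that by (simp only: left_diff_distrib)
        moreover have "q * (v - u) \<le> D * (v - u) + e * (v - u)"
          using mult_right_mono[of q "D + e" "v - u"] q that by (simp only: distrib_right)
        moreover have "p1 * (v - u) < f v - f u" "f v - f u < q * (v - u)"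
          using d1(2)[of u v] d2(2)[of u v] that by simp_all
        ultimately show ?thesis by linarith
      qed
      then show ?thesis using d1(1) d2(1) by (intro exI[of _ "min d1 d2"]) auto
    qed
    have "(f has_derivative (\<lambda>h. D * h)) (at x)"
      unfolding has_derivative_at_alt
    proof (intro conjI allI impI)
      show "bounded_linear ((*) D)" by (rule bounded_linear_mult_right)
      fix e :: real assume e: "e > 0"
      obtain d where d: "d > 0" "\<And>u v. u < x \<Longrightarrow> x < v \<Longrightarrow> v - u < d \<Longrightarrow> \<bar>f v - f u - D * (v - u)\<bar> \<le> e * (v - u)"
        using straddle[OF e] by blast
      have "\<bar>f y - f x - D * (y - x)\<bar> \<le> e * \<bar>y - x\<bar>" if y: "\<bar>y - x\<bar> < d" for y
      proof (rule field_le_epsilon)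
        fix \<eta> :: real assume \<eta>: "\<eta> > 0"
        define C where "C = e + K + \<bar>D\<bar>"
        have C: "C > 0" using e K1 by (simp add: C_def)
        \<comment> \<open>The bound \<open>straddle\<close> needs \<open>x\<close> in the interior of the interval, so the endpoint \<open>x\<close> is moved past
\<open>x\<close> by \<open>t\<close>, at a cost of at most \<open>C * t \<le> \<eta>\<close>.\<close>
        define t where "t = min ((d - \<bar>y - x\<bar>)/2) (\<eta>/C)"
        have t: "t > 0" "t < d - \<bar>y - x\<bar>"
          using y \<eta> C min.cobounded1[of "(d - \<bar>y - x\<bar>)/2" "\<eta>/C"] unfolding t_def[symmetric]
          by (simp_all add: t_def)
        have tC: "C * t \<le> \<eta>" using C by (simp add: t_def min_def field_simps)
        have Dt: "\<bar>D * t\<bar> = \<bar>D\<bar> * t" using t by (simp add: abs_mult)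
        consider "y > x" | "y < x" | "y = x" by linarith
        then show "\<bar>f y - f x - D * (y - x)\<bar> \<le> e * \<bar>y - x\<bar> + \<eta>"
        proof cases
          case 1
          have "\<bar>f y - f (x - t) - D * (y - (x - t))\<bar> \<le> e * (y - (x - t))"
            using d(2)[of "x - t" y] 1 t by auto
          moreover have "\<bar>f x - f (x - t)\<bar> \<le> K * t" using lip[of x "x - t"] t by simp
          moreover have "f y - f x - D * (y - x) =
              (f y - f (x - t) - D * (y - (x - t))) - (f x - f (x - t)) + D * t"
            by (simp add: algebra_simps)
          moreover have "e * (y - (x - t)) + K * t + \<bar>D\<bar> * t \<le> e * (y - x) + \<eta>"
            using tC unfolding C_def by (simp add: algebra_simps)
          ultimately show ?thesis using 1 Dt by simp
        next
          case 2
          have "\<bar>f (x + t) - f y - D * ((x + t) - y)\<bar> \<le> e * ((x + t) - y)"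
            using d(2)[of y "x + t"] 2 t by auto
          moreover have "\<bar>f (x + t) - f x\<bar> \<le> K * t" using lip[of "x + t" x] t by simp
          moreover have "f y - f x - D * (y - x) =
              (f (x + t) - f x) - (f (x + t) - f y - D * ((x + t) - y)) - D * t"
            by (simp add: algebra_simps)
          moreover have "e * ((x + t) - y) + K * t + \<bar>D\<bar> * t \<le> e * (x - y) + \<eta>"
            using tC unfolding C_def by (simp add: algebra_simps)
          ultimately show ?thesis using 2 Dt by simp
        qed (use \<eta> in auto)
      qed
      then show "\<exists>d>0. \<forall>y. norm (y - x) < d \<longrightarrow> norm (f y - f x - D * (y - x)) \<le> e * norm (y - x)"
        using d(1) by (intro exI[of _ d]) auto
    qed
    then show False using nd unfolding differentiable_def by blast
  qed
  ultimately show ?thesis by (rule negligible_subset)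
qed

text \<open>Adding the identity makes \<open>f\<close> bi-Lipschitz without affecting differentiability.\<close>

lemma mono_lipschitz_ae_differentiable:
  fixes f :: "real \<Rightarrow> real"
  assumes "mono f" and lip: "\<And>x y. \<bar>f x - f y\<bar> \<le> M * \<bar>x - y\<bar>"
  shows "negligible {x. \<not> f differentiable (at x)}"
proof -
  have "negligible {x. \<not> (\<lambda>x. f x + x) differentiable (at x)}"
  proof (rule bilipschitz_ae_differentiable[where K = "M + 1"])
    fix x y :: real assume "x \<le> y"
    then show "y - x \<le> (f y + y) - (f x + x)" "(f y + y) - (f x + x) \<le> (M + 1) * (y - x)"
      using monoD[OF \<open>mono f\<close> \<open>x \<le> y\<close>] lip[of y x] by (auto simp: algebra_simps)
  qed
  moreover have "f differentiable (at x)" if "(\<lambda>x. f x + x) differentiable (at x)" for x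
    using differentiable_diff[OF that differentiable_ident] by simp
  ultimately show ?thesis by (elim negligible_subset) auto
qed

text \<open>The points where the derivative is \<open>0\<close> lie in arbitrarily short intervals of slope at most \<open>p\<close> for every
\<open>p > 0\<close>, so their image is null by the slope lemma; the remaining null set has a null image. Thus the
interval \<open>{f a..f b}\<close> is null.\<close>

lemma mono_lipschitz_zero_derivative_constant:
  fixes f :: "real \<Rightarrow> real"
  assumes "mono f" and lip: "\<And>x y. \<bar>f x - f y\<bar> \<le> M * \<bar>x - y\<bar>"
    and neg: "negligible {x\<in>{a..b}. \<not> (f has_real_derivative 0) (at x)}"
    and "a \<le> b"
  shows "f a = f b"
proof -
  let ?N = "{x\<in>{a..b}. \<not> (f has_real_derivative 0) (at x)}"
  let ?S = "{a..b} - ?N"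
  have S: "?S \<in> lmeasurable"
    using neg by (intro fmeasurable.Diff) (auto simp: negligible_imp_measurable)
  have le: "emeasure lebesgue (f ` ?S) \<le> ennreal p * emeasure lebesgue ?S" if p: "p > 0" for p
  proof (rule emeasure_image_le_slope[OF \<open>mono f\<close> lip S])
    fix x d :: real assume x: "x \<in> ?S" and d: "0 < d"
    then have "(f has_derivative (*) 0) (at x)" by (simp add: has_field_derivative_def)
    then obtain d' where d': "d' > 0" "\<And>y. norm (y - x) < d' \<Longrightarrow> norm (f y - f x - 0 * (y - x)) \<le> p * norm (y - x)"
      unfolding has_derivative_at_alt using p by blast
    define t where "t = min d d' / 4"
    have t: "t > 0" "2 * t < d" "t < d'" using d d' by (auto simp: t_def min_def)
    have "f (x + t) - f (x - t) \<le> p * ((x + t) - (x - t))"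
      using d'(2)[of "x + t"] d'(2)[of "x - t"] t by auto
    then show "\<exists>u v. u < x \<and> x < v \<and> v - u < d \<and> f v - f u \<le> p * (v - u)"
      using t by (intro exI[of _ "x - t"] exI[of _ "x + t"]) auto
  qed (use p in auto)
  have fSm: "f ` ?S \<in> sets lebesgue" using lipschitz_image_sets_lebesgue[OF lip fmeasurableD[OF S]] .
  have "emeasure lebesgue (f ` ?S) \<le> 0"
  proof (rule ennreal_le_epsilon)
    fix e :: real assume e: "0 < e"
    define m where "m = measure lebesgue ?S"
    have m: "m \<ge> 0" by (simp add: m_def)
    have eS: "emeasure lebesgue ?S = ennreal m" unfolding m_def by (rule emeasure_eq_measure2 [OF S])
    have "emeasure lebesgue (f ` ?S) \<le> ennreal (e / (m + 1)) * ennreal m"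
      using le[of "e / (m + 1)"] e m unfolding eS by simp
    also have "\<dots> \<le> ennreal e" using e m by (auto simp: ennreal_mult[symmetric] field_simps intro!: ennreal_leI)
    finally show "emeasure lebesgue (f ` ?S) \<le> 0 + ennreal e" by simp
  qed
  then have "negligible (f ` ?S)" using fSm by (simp add: negligible_iff_emeasure0)
  then have n: "negligible (f ` ?S \<union> f ` ?N)" by (intro negligible_Un lipschitz_image_negligible[OF lip neg])
  have cont: "continuous_on {a..b} f"
  proof (rule continuous_on_subset[OF lipschitz_on_continuous_on])
    show "\<bar>M\<bar>-lipschitz_on UNIV f"
      using order_trans[OF lip mult_right_mono[OF abs_ge_self abs_ge_zero]]
      by (intro lipschitz_onI) (auto simp: dist_real_def)
  qed auto
  have "{f a..f b} \<subseteq> f ` ?S \<union> f ` ?N"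
  proof
    fix y assume "y \<in> {f a..f b}"
    then obtain x where "a \<le> x" "x \<le> b" "f x = y" using IVT'[of f a y b] cont \<open>a \<le> b\<close> by auto
    then show "y \<in> f ` ?S \<union> f ` ?N" by auto
  qed
  then have "negligible {f a..f b}" using n negligible_subset by blast
  moreover have "f a \<le> f b" using \<open>mono f\<close> \<open>a \<le> b\<close> by (rule monoD)
  moreover have "emeasure lebesgue {f a..f b} = 0"
    using \<open>negligible {f a..f b}\<close> by (subst (asm) negligible_iff_emeasure0) auto
  ultimately show ?thesis by (simp add: ennreal_eq_0_iff)
qed

section \<open>Kernel estimates near the boundary\<close>

text \<open>The kernel, up to the factor \<open>2 \<pi>\<close>, of \<open>2 z \<partial>\<^sub>z\<close> applied to a Poisson integral at \<open>z = r\<close>: it is \<open>z\<close> times the \<open>z\<close>-derivative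
of the Schwarz kernel \<open>(cis s + z) / (cis s - z)\<close>.\<close>

definition diff_kernel :: "real \<Rightarrow> real \<Rightarrow> complex" where
  "diff_kernel r s = 2 * of_real r * cis s / (cis s - of_real r)\<^sup>2"

text \<open>The limit, as \<open>r\<close> tends to \<open>1\<close>, of \<open>- diff_kernel r s\<close>, and also of \<open>2 \<pi> / (1 - r)\<close> times the Poisson
kernel. It has a second order pole at \<open>0\<close>, so it can be integrated against functions that are
\<open>O(|s|\<^sup>1\<^sup>+\<^sup>\<alpha>)\<close>.\<close>

definition normal_kernel :: "real \<Rightarrow> real" where
  "normal_kernel s = 1 / (2 * (sin (s / 2))\<^sup>2)"

lemma gap_powr_tendsto_0:
  fixes a K :: real
  assumes "a > 0"
  shows "((\<lambda>r. K * (1 - r) powr a) \<longlongrightarrow> 0) (at_left 1)"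
proof -
  have "((\<lambda>r. K * (1 - r) powr a) \<longlongrightarrow> K * (1 - 1) powr a) (at_left (1::real))"
    using assms by (intro tendsto_intros) (auto intro!: eventually_mono[OF eventually_at_left_real[of 0 1]])
  then show ?thesis by simp
qed

lemma powr_eventually_small:
  fixes a K e :: real
  assumes "a > 0" "e > 0"
  obtains \<delta> where "\<delta> > 0" "K * \<delta> powr a < e"
proof -
  have "((\<lambda>\<delta>. K * \<delta> powr a) \<longlongrightarrow> K * 0 powr a) (at_right 0)"
    using assms by (intro tendsto_intros) (auto simp: eventually_at_right_less intro!: eventually_mono[OF eventually_at_right_less[of 0]])
  then have "\<forall>\<^sub>F \<delta> in at_right 0. K * \<delta> powr a < e"
    using assms by (intro order_tendstoD(2)) auto
  moreover have "\<forall>\<^sub>F \<delta>::real in at_right 0. 0 < \<delta>" by (rule eventually_at_right_less)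
  ultimately have "\<forall>\<^sub>F \<delta> in at_right 0. 0 < \<delta> \<and> K * \<delta> powr a < e" by eventually_elim simp
  then show thesis using that eventually_happens'[of "at_right (0::real)"] by auto
qed

text \<open>By concavity the sine lies above its chord from \<open>0\<close> to \<open>\<pi>/2\<close>.\<close>

lemma jordan_sin_ineq:
  assumes "0 \<le> y" "y \<le> pi / 2"
  shows "2 * y / pi \<le> sin y"
proof -
  have "concave_on {0..pi/2} sin"
  proof (rule f''_le0_imp_concave)
    show "(sin has_real_derivative cos x) (at x)" for x by (rule DERIV_sin)
    show "(cos has_real_derivative (- sin x)) (at x)" for x by (rule DERIV_cos)
    show "- sin x \<le> 0" if "x \<in> {0..pi/2}" for x
      using that sin_ge_zero[of x] by auto
  qed simp
  then have "(1 - 2 * y / pi) * sin 0 + (2 * y / pi) * sin (pi/2) \<le> sin ((1 - 2 * y / pi) *\<^sub>R 0 + (2 * y / pi) *\<^sub>R (pi/2))"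
    using assms by (intro concave_onD) (auto simp: field_simps)
  then show ?thesis by simp
qed

lemma abs_sin_half_ge:
  assumes "\<bar>s\<bar> \<le> pi"
  shows "\<bar>s\<bar> / pi \<le> \<bar>sin (s / 2)\<bar>"
proof -
  have "2 * (\<bar>s\<bar>/2) / pi \<le> sin (\<bar>s\<bar>/2)" using assms by (intro jordan_sin_ineq) auto
  also have "\<dots> \<le> \<bar>sin (s / 2)\<bar>" by (cases "s \<ge> 0") auto
  finally show ?thesis by simp
qed

lemma cis_minus_real_sq:
  "(norm (cis s - of_real r))\<^sup>2 = (1 - r)\<^sup>2 + 4 * r * (sin (s/2))\<^sup>2"
proof -
  have "(norm (cis s - of_real r))\<^sup>2 = (cos s - r)\<^sup>2 + (sin s)\<^sup>2"
    by (simp add: cmod_power2)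
  also have "\<dots> = 1 - 2 * r * cos s + r\<^sup>2"
    using sin_cos_squared_add[of s] by (simp add: power2_eq_square algebra_simps)
  also have "cos s = 1 - 2 * (sin (s/2))\<^sup>2" using cos_double_sin[of "s/2"] by simp
  finally show ?thesis by (simp add: power2_eq_square algebra_simps)
qed

lemma cis_minus_real_ge_gap: "0 \<le> r \<Longrightarrow> 1 - r \<le> norm (cis s - of_real r)"
  using norm_triangle_ineq2[of "cis s" "of_real r"] by simp

lemma cis_minus_real_ge_arc:
  assumes "1/4 \<le> r" "\<bar>s\<bar> \<le> pi"
  shows "\<bar>s\<bar> / pi \<le> norm (cis s - of_real r)"
proof -
  have "(\<bar>s\<bar> / pi)\<^sup>2 \<le> (sin (s/2))\<^sup>2"
    using power_mono[OF abs_sin_half_ge[OF assms(2)], of 2] by simp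
  also have "\<dots> \<le> (1 - r)\<^sup>2 + 4 * r * (sin (s/2))\<^sup>2"
    using mult_right_mono[of 1 "4 * r" "(sin (s/2))\<^sup>2"] assms by (simp add: add_increasing)
  finally have "(\<bar>s\<bar> / pi)\<^sup>2 \<le> (norm (cis s - of_real r))\<^sup>2" by (simp add: cis_minus_real_sq)
  then show ?thesis by (rule power2_le_imp_le) simp
qed

text \<open>Geometric interpolation between the bounds \<open>1 - r\<close> and \<open>|s| / \<pi>\<close>. It trades part of the singularity in
\<open>s\<close>, until the kernel becomes integrable, for a power of \<open>1 - r\<close>.\<close>

lemma cis_minus_real_ge_interp:
  assumes "1/4 \<le> r" "r < 1" "\<bar>s\<bar> \<le> pi" "s \<noteq> 0" "0 \<le> x" "x \<le> 1"
  shows "(1 - r) powr (1 - x) * (\<bar>s\<bar> / pi) powr x \<le> norm (cis s - of_real r)"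
proof -
  let ?d = "norm (cis s - of_real r)"
  have d: "?d > 0" using cis_minus_real_ge_gap[of r s] assms by linarith
  have "(1 - r) powr (1 - x) * (\<bar>s\<bar> / pi) powr x \<le> ?d powr (1 - x) * ?d powr x"
    using assms cis_minus_real_ge_gap[of r s] cis_minus_real_ge_arc[of r s]
    by (intro mult_mono powr_mono2) auto
  also have "\<dots> = ?d" using d by (simp add: powr_add[symmetric])
  finally show ?thesis .
qed

lemma abs_powr_integrable:
  assumes "a > -1"
  shows "(\<lambda>s. \<bar>s\<bar> powr a) integrable_on {-pi..pi}"
proof -
  have "(\<lambda>s. s powr a) integrable_on {0..pi}"
    using has_integral_powr_from_0[OF assms, of pi] by auto
  then have 1: "(\<lambda>s. \<bar>s\<bar> powr a) integrable_on {0..pi}"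
    by (rule integrable_eq) auto
  then have "(\<lambda>s. \<bar>s\<bar> powr a) integrable_on {-pi..0}"
    using iffD2[OF Henstock_Kurzweil_Integration.integrable_reflect_real 1] by simp
  then show ?thesis
    by (rule Henstock_Kurzweil_Integration.integrable_combine[rotated 2]) (use 1 in simp_all)
qed

lemma cis_minus_real_nonzero: "0 \<le> r \<Longrightarrow> r < 1 \<Longrightarrow> cis s - of_real r \<noteq> 0"
  using cis_minus_real_ge_gap[of r s] by force

lemma continuous_diff_kernel: "0 \<le> r \<Longrightarrow> r < 1 \<Longrightarrow> continuous_on A (diff_kernel r)"
  using cis_minus_real_nonzero[of r] unfolding diff_kernel_def by (intro continuous_intros) auto

lemma norm_diff_kernel_le:
  assumes "0 \<le> r" "r < 1"
  shows "norm (diff_kernel r s) \<le> 2 / (norm (cis s - of_real r))\<^sup>2"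
  using assms by (simp add: diff_kernel_def norm_divide norm_mult norm_power divide_right_mono)

text \<open>An admissible constant for the growth estimate with exponent \<open>\<beta>\<close>. The point of the definition is the
order of quantifiers: one constant serves all kernels, densities, radii and Lipschitz bounds, and hence
all boundary points at once.\<close>

definition kernel_growth_const :: "real \<Rightarrow> real \<Rightarrow> bool" where
  "kernel_growth_const \<beta> C \<longleftrightarrow> C > 0 \<and> (\<forall>k r \<psi> M. 1/4 \<le> r \<longrightarrow> r < 1 \<longrightarrow> continuous_on {-pi..pi} k \<longrightarrow> continuous_on {-pi..pi} \<psi> \<longrightarrow>
      (\<forall>s. \<bar>s\<bar> \<le> pi \<longrightarrow> norm (k s :: complex) \<le> 2 / (norm (cis s - of_real r))\<^sup>2) \<longrightarrow>
      (\<forall>s. \<bar>s\<bar> \<le> pi \<longrightarrow> \<bar>\<psi> s\<bar> \<le> M * \<bar>s\<bar>) \<longrightarrow>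
      norm (integral {-pi..pi} (\<lambda>s. k s * of_real (\<psi> s))) \<le> C * M * (1 - r) powr (-\<beta>))"

lemma kernel_growth_constD:
  assumes "kernel_growth_const \<beta> C" "1/4 \<le> r" "r < 1" "continuous_on {-pi..pi} k" "continuous_on {-pi..pi} \<psi>"
    "\<And>s. \<bar>s\<bar> \<le> pi \<Longrightarrow> norm (k s :: complex) \<le> 2 / (norm (cis s - of_real r))\<^sup>2"
    "\<And>s. \<bar>s\<bar> \<le> pi \<Longrightarrow> \<bar>\<psi> s\<bar> \<le> M * \<bar>s\<bar>"
  shows "norm (integral {-pi..pi} (\<lambda>s. k s * of_real (\<psi> s))) \<le> C * M * (1 - r) powr (-\<beta>)"
  using assms unfolding kernel_growth_const_def by blast

text \<open>For \<open>|\<psi>(s)| \<le> M |s|\<close> the integrand is at most \<open>2 M |s| / |cis s - r|\<^sup>2\<close>. Interpolating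
\<open>|cis s - r|\<^sup>2\<close> between \<open>(1 - r)\<^sup>2\<close> and \<open>(s/\<pi>)\<^sup>2\<close> bounds it by a multiple of
\<open>(1 - r)\<^sup>-\<^sup>\<beta> |s|\<^sup>\<beta>\<^sup>-\<^sup>1\<close>, which is integrable.\<close>

lemma kernel_growth_const_exists:
  assumes \<beta>: "0 < \<beta>" "\<beta> < 1"
  shows "\<exists>C. kernel_growth_const \<beta> C"
proof -
  define W where "W = integral {-pi..pi} (\<lambda>s. \<bar>s\<bar> powr (\<beta> - 1))"
  define C where "C = 2 * pi powr (2 - \<beta>) * (\<bar>W\<bar> + 1)"
  have "C > 0" by (auto simp: C_def intro!: mult_pos_pos)
  moreover have "norm (integral {-pi..pi} (\<lambda>s. k s * of_real (\<psi> s))) \<le> C * M * (1 - r) powr (-\<beta>)"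
    if r: "1/4 \<le> r" "r < 1" and contk: "continuous_on {-pi..pi} k" and cont: "continuous_on {-pi..pi} \<psi>"
    and k: "\<And>s. \<bar>s\<bar> \<le> pi \<Longrightarrow> norm (k s :: complex) \<le> 2 / (norm (cis s - of_real r))\<^sup>2" and \<psi>: "\<And>s. \<bar>s\<bar> \<le> pi \<Longrightarrow> \<bar>\<psi> s\<bar> \<le> M * \<bar>s\<bar>"
    for k r \<psi> M
  proof -
    have "0 \<le> M * pi" using order_trans[OF abs_ge_zero \<psi>[of pi]] by simp
    then have M: "M \<ge> 0" using pi_gt_zero by (simp add: zero_le_mult_iff)
    have "norm (integral {-pi..pi} (\<lambda>s. k s * of_real (\<psi> s)))
        \<le> integral {-pi..pi} (\<lambda>s. (2 * pi powr (2 - \<beta>) * M * (1 - r) powr (-\<beta>)) * \<bar>s\<bar> powr (\<beta> - 1))"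
    proof (rule integral_norm_bound_integral)
      show "(\<lambda>s. k s * of_real (\<psi> s)) integrable_on {-pi..pi}"
        by (intro integrable_continuous_real continuous_intros cont contk)
      show "(\<lambda>s. (2 * pi powr (2 - \<beta>) * M * (1 - r) powr (-\<beta>)) * \<bar>s\<bar> powr (\<beta> - 1)) integrable_on {-pi..pi}"
        using \<beta> by (intro integrable_on_mult_right abs_powr_integrable) auto
      fix s assume s: "s \<in> {-pi..pi}"
      show "norm (k s * of_real (\<psi> s)) \<le> (2 * pi powr (2 - \<beta>) * M * (1 - r) powr (-\<beta>)) * \<bar>s\<bar> powr (\<beta> - 1)"
      proof (cases "s = 0")
        case True
        then show ?thesis using \<psi>[of 0] by simp
      next
        case False
        let ?d = "norm (cis s - of_real r)"
        have low: "(1 - r) powr (\<beta>/2) * (\<bar>s\<bar> / pi) powr (1 - \<beta>/2) \<le> ?d"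
          using cis_minus_real_ge_interp[of r s "1 - \<beta>/2"] r s \<beta> False by auto
        have "((1 - r) powr (\<beta>/2) * (\<bar>s\<bar> / pi) powr (1 - \<beta>/2))\<^sup>2 = (1 - r) powr \<beta> * (\<bar>s\<bar> / pi) powr (2 - \<beta>)"
          using r False by (simp add: power_mult_distrib powr_powr[symmetric] powr_realpow[symmetric] powr_powr)
        then have d2: "(1 - r) powr \<beta> * (\<bar>s\<bar> / pi) powr (2 - \<beta>) \<le> ?d\<^sup>2"
          using power_mono[OF low, of 2] by simp
        have pos: "(1 - r) powr \<beta> * (\<bar>s\<bar> / pi) powr (2 - \<beta>) > 0" using r False by simp
        have "norm (k s * of_real (\<psi> s)) \<le> 2 / ?d\<^sup>2 * (M * \<bar>s\<bar>)"
          using k[of s] \<psi>[of s] s r unfolding norm_mult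
          by (intro mult_mono) auto
        also have "\<dots> \<le> 2 / ((1 - r) powr \<beta> * (\<bar>s\<bar> / pi) powr (2 - \<beta>)) * (M * \<bar>s\<bar>)"
          using d2 pos M by (intro mult_right_mono divide_left_mono mult_pos_pos) auto
        also have "\<dots> = (2 * pi powr (2 - \<beta>) * M * (1 - r) powr (-\<beta>)) * (\<bar>s\<bar> / \<bar>s\<bar> powr (2 - \<beta>))"
          using r False by (simp add: powr_divide powr_minus field_simps)
        also have "\<bar>s\<bar> / \<bar>s\<bar> powr (2 - \<beta>) = \<bar>s\<bar> powr (\<beta> - 1)"
          using False powr_diff[of "\<bar>s\<bar>" 1 "2 - \<beta>"] by simp
        finally show ?thesis .
      qed
    qed
    also have "\<dots> = 2 * pi powr (2 - \<beta>) * M * (1 - r) powr (-\<beta>) * W" by (simp add: W_def)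
    also have "\<dots> \<le> 2 * pi powr (2 - \<beta>) * M * (1 - r) powr (-\<beta>) * (\<bar>W\<bar> + 1)"
      using M by (intro mult_left_mono) auto
    also have "\<dots> = C * M * (1 - r) powr (-\<beta>)" by (simp add: C_def)
    finally show ?thesis .
  qed
  ultimately show ?thesis unfolding kernel_growth_const_def by (intro exI[of _ C] conjI allI impI; blast)
qed

text \<open>An admissible constant for the rate of convergence of integrals against kernels \<open>k\<close> that approach \<open>\<kappa>\<close>;
again one constant serves all \<open>k\<close>, \<open>\<psi>\<close>, \<open>M\<close> and \<open>r\<close>.\<close>

definition kernel_limit_const :: "real \<Rightarrow> real \<Rightarrow> (real \<Rightarrow> complex) \<Rightarrow> real \<Rightarrow> bool" where
  "kernel_limit_const \<alpha> B \<kappa> C \<longleftrightarrow> C > 0 \<and> (\<forall>k r \<psi> M. 1/4 \<le> r \<longrightarrow> r < 1 \<longrightarrow> continuous_on {-pi..pi} k \<longrightarrow> continuous_on {-pi..pi} \<psi> \<longrightarrow>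
      (\<forall>s. \<bar>s\<bar> \<le> pi \<longrightarrow> s \<noteq> 0 \<longrightarrow> norm (k s - \<kappa> s) \<le> B * (1 - r) / (norm (cis s - of_real r) * s\<^sup>2)) \<longrightarrow>
      (\<forall>s. \<bar>s\<bar> \<le> pi \<longrightarrow> \<bar>\<psi> s\<bar> \<le> M * \<bar>s\<bar> powr (1 + \<alpha>)) \<longrightarrow>
      (\<lambda>s. \<kappa> s * of_real (\<psi> s)) integrable_on {-pi..pi} \<and>
      norm (integral {-pi..pi} (\<lambda>s. k s * of_real (\<psi> s)) - integral {-pi..pi} (\<lambda>s. \<kappa> s * of_real (\<psi> s)))
        \<le> C * M * (1 - r) powr (\<alpha>/2))"

lemma kernel_limit_constD:
  assumes "kernel_limit_const \<alpha> B \<kappa> C" "1/4 \<le> r" "r < 1" "continuous_on {-pi..pi} k" "continuous_on {-pi..pi} \<psi>"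
    "\<And>s. \<bar>s\<bar> \<le> pi \<Longrightarrow> s \<noteq> 0 \<Longrightarrow> norm (k s - \<kappa> s) \<le> B * (1 - r) / (norm (cis s - of_real r) * s\<^sup>2)"
    "\<And>s. \<bar>s\<bar> \<le> pi \<Longrightarrow> \<bar>\<psi> s\<bar> \<le> M * \<bar>s\<bar> powr (1 + \<alpha>)"
  shows "(\<lambda>s. \<kappa> s * of_real (\<psi> s)) integrable_on {-pi..pi}"
    and "norm (integral {-pi..pi} (\<lambda>s. k s * of_real (\<psi> s)) - integral {-pi..pi} (\<lambda>s. \<kappa> s * of_real (\<psi> s)))
        \<le> C * M * (1 - r) powr (\<alpha>/2)"
  using assms unfolding kernel_limit_const_def by blast+

text \<open>With \<open>|cis s - r| \<ge> (1 - r)\<^sup>1\<^sup>-\<^sup>\<alpha>\<^sup>/\<^sup>2 (|s|/\<pi>)\<^sup>\<alpha>\<^sup>/\<^sup>2\<close> the difference of the integrands is at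
most a multiple of \<open>(1 - r)\<^sup>\<alpha>\<^sup>/\<^sup>2 |s|\<^sup>\<alpha>\<^sup>/\<^sup>2\<^sup>-\<^sup>1\<close>. The limiting integrand is
integrable because it differs from a continuous function by a measurable function with this bound.\<close>

lemma kernel_limit_const_exists:
  fixes \<kappa> :: "real \<Rightarrow> complex"
  assumes \<alpha>: "0 < \<alpha>" "\<alpha> \<le> 1" and B: "B \<ge> 0"
    and \<kappa>: "\<kappa> \<in> borel_measurable lebesgue"
  shows "\<exists>C. kernel_limit_const \<alpha> B \<kappa> C"
proof -
  define W where "W = integral {-pi..pi} (\<lambda>s. \<bar>s\<bar> powr (\<alpha>/2 - 1))"
  define C where "C = (B + 1) * pi powr (\<alpha>/2) * (\<bar>W\<bar> + 1)"
  have "C > 0" using B by (auto simp: C_def intro!: mult_pos_pos)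
  moreover have "(\<lambda>s. \<kappa> s * of_real (\<psi> s)) integrable_on {-pi..pi} \<and>
      norm (integral {-pi..pi} (\<lambda>s. k s * of_real (\<psi> s)) - integral {-pi..pi} (\<lambda>s. \<kappa> s * of_real (\<psi> s)))
        \<le> C * M * (1 - r) powr (\<alpha>/2)"
    if r: "1/4 \<le> r" "r < 1" and contk: "continuous_on {-pi..pi} k" and cont: "continuous_on {-pi..pi} \<psi>"
    and k: "\<And>s. \<bar>s\<bar> \<le> pi \<Longrightarrow> s \<noteq> 0 \<Longrightarrow> norm (k s - \<kappa> s) \<le> B * (1 - r) / (norm (cis s - of_real r) * s\<^sup>2)"
    and \<psi>: "\<And>s. \<bar>s\<bar> \<le> pi \<Longrightarrow> \<bar>\<psi> s\<bar> \<le> M * \<bar>s\<bar> powr (1 + \<alpha>)"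
    for k r \<psi> M
  proof -
    have "0 \<le> M * pi powr (1 + \<alpha>)" using order_trans[OF abs_ge_zero \<psi>[of pi]] by simp
    then have M: "M \<ge> 0" using pi_gt_zero by (simp add: zero_le_mult_iff)
    let ?g = "\<lambda>s. (B * pi powr (\<alpha>/2) * M * (1 - r) powr (\<alpha>/2)) * \<bar>s\<bar> powr (\<alpha>/2 - 1)"
    have gint: "?g integrable_on {-pi..pi}"
      using \<alpha> by (intro integrable_on_mult_right abs_powr_integrable) auto
    have bnd: "norm ((k s - \<kappa> s) * of_real (\<psi> s)) \<le> ?g s" if s: "s \<in> {-pi..pi}" for s
    proof (cases "s = 0")
      case True
      then show ?thesis using \<psi>[of 0] by simp
    next
      case False
      let ?d = "norm (cis s - of_real r)"
      have low: "(1 - r) powr (1 - \<alpha>/2) * (\<bar>s\<bar> / pi) powr (\<alpha>/2) \<le> ?d"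
        using cis_minus_real_ge_interp[of r s "\<alpha>/2"] r s \<alpha> False by auto
      have pos: "(1 - r) powr (1 - \<alpha>/2) * (\<bar>s\<bar> / pi) powr (\<alpha>/2) > 0" using r False by simp
      have "norm ((k s - \<kappa> s) * of_real (\<psi> s)) \<le> B * (1 - r) / (?d * s\<^sup>2) * (M * \<bar>s\<bar> powr (1 + \<alpha>))"
        using k[of s] \<psi>[of s] s False r B unfolding norm_mult by (intro mult_mono) auto
      also have "\<dots> \<le> B * (1 - r) / (((1 - r) powr (1 - \<alpha>/2) * (\<bar>s\<bar> / pi) powr (\<alpha>/2)) * s\<^sup>2) * (M * \<bar>s\<bar> powr (1 + \<alpha>))"
        using low pos M B r False less_le_trans[OF pos low]
        by (intro mult_right_mono divide_left_mono mult_pos_pos) auto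
      also have "\<dots> = B * pi powr (\<alpha>/2) * M * ((1 - r) / (1 - r) powr (1 - \<alpha>/2)) * (\<bar>s\<bar> powr (1 + \<alpha>) / (\<bar>s\<bar> powr (\<alpha>/2) * \<bar>s\<bar> powr 2))"
        using r False by (simp add: powr_divide field_simps)
      also have "(1 - r) / (1 - r) powr (1 - \<alpha>/2) = (1 - r) powr (\<alpha>/2)"
        using r powr_diff[of "1 - r" 1 "1 - \<alpha>/2"] by simp
      also have "\<bar>s\<bar> powr (1 + \<alpha>) / (\<bar>s\<bar> powr (\<alpha>/2) * \<bar>s\<bar> powr 2) = \<bar>s\<bar> powr (\<alpha>/2 - 1)"
        unfolding powr_add[symmetric] powr_diff[symmetric] by (simp add: field_simps)
      finally show ?thesis by simp
    qed
    have m1: "(\<lambda>s. k s * of_real (\<psi> s)) \<in> borel_measurable (lebesgue_on {-pi..pi})"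
      by (intro continuous_imp_measurable_on_sets_lebesgue continuous_intros cont contk) auto
    have "\<kappa> \<in> borel_measurable (lebesgue_on {-pi..pi})"
      using \<kappa> by (rule measurable_restrict_space1)
    moreover have "(\<lambda>s. complex_of_real (\<psi> s)) \<in> borel_measurable (lebesgue_on {-pi..pi})"
      by (intro continuous_imp_measurable_on_sets_lebesgue continuous_intros cont) auto
    moreover have "k \<in> borel_measurable (lebesgue_on {-pi..pi})"
      by (intro continuous_imp_measurable_on_sets_lebesgue contk) auto
    ultimately have m: "(\<lambda>s. (k s - \<kappa> s) * of_real (\<psi> s)) \<in> borel_measurable (lebesgue_on {-pi..pi})"
      by (intro borel_measurable_times borel_measurable_diff)
    have di: "(\<lambda>s. (k s - \<kappa> s) * of_real (\<psi> s)) integrable_on {-pi..pi}"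
      by (rule measurable_bounded_by_integrable_imp_integrable [OF m gint bnd]) auto
    have ki: "(\<lambda>s. k s * of_real (\<psi> s)) integrable_on {-pi..pi}"
      by (intro integrable_continuous_real continuous_intros cont contk)
    have \<kappa>i: "(\<lambda>s. \<kappa> s * of_real (\<psi> s)) integrable_on {-pi..pi}"
      using integrable_diff[OF ki di] by (simp add: algebra_simps)
    have eq: "integral {-pi..pi} (\<lambda>s. k s * of_real (\<psi> s)) - integral {-pi..pi} (\<lambda>s. \<kappa> s * of_real (\<psi> s))
        = integral {-pi..pi} (\<lambda>s. (k s - \<kappa> s) * of_real (\<psi> s))" (is "?D = _")
      using integral_diff[OF ki \<kappa>i] by (simp add: algebra_simps)
    have "norm ?D \<le> integral {-pi..pi} ?g"
      unfolding eq by (rule integral_norm_bound_integral [OF di gint bnd])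
    then have "norm ?D \<le> (B * pi powr (\<alpha>/2) * M * (1 - r) powr (\<alpha>/2)) * W" by (simp add: W_def)
    also have "\<dots> \<le> ((B + 1) * pi powr (\<alpha>/2) * M * (1 - r) powr (\<alpha>/2)) * (\<bar>W\<bar> + 1)"
    proof -
      have "0 \<le> W" unfolding W_def using \<alpha> by (intro integral_nonneg abs_powr_integrable) auto
      then show ?thesis using B M by (intro mult_mono) auto
    qed
    also have "\<dots> = C * M * (1 - r) powr (\<alpha>/2)" by (simp add: C_def)
    finally show ?thesis using \<kappa>i by blast
  qed
  ultimately show ?thesis unfolding kernel_limit_const_def by (intro exI[of _ C] conjI allI impI; blast)
qed

lemma cis_minus_one_sq: "(norm (cis s - 1))\<^sup>2 = 4 * (sin (s/2))\<^sup>2"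
  using cis_minus_real_sq[of s 1] by simp

lemma sin_half_nonzero: "\<bar>s\<bar> \<le> pi \<Longrightarrow> s \<noteq> 0 \<Longrightarrow> sin (s / 2) \<noteq> 0"
  using abs_sin_half_ge[of s] by (auto simp: field_simps)

lemma cis_minus_one_power2: "(cis s - 1)\<^sup>2 = - 4 * of_real ((sin (s/2))\<^sup>2) * cis s"
proof -
  have c: "cos s = 1 - 2 * (sin (s/2))\<^sup>2" using cos_double_sin[of "s/2"] by simp
  have "(cis s - 1)\<^sup>2 = cis s * (cis s + cis (-s) - 2)"
    by (simp add: power2_eq_square algebra_simps cis_mult)
  also have "cis s + cis (-s) - 2 = - 4 * of_real ((sin (s/2))\<^sup>2)"
    using c by (simp add: complex_eq_iff)
  finally show ?thesis by (simp add: mult_ac)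
qed

lemma normal_kernel_measurable: "(\<lambda>s. complex_of_real (c * normal_kernel s)) \<in> borel_measurable lebesgue"
proof -
  have "(\<lambda>s. complex_of_real (c * normal_kernel s)) \<in> borel_measurable lborel"
    unfolding normal_kernel_def by measurable
  then show ?thesis by (rule measurable_completion)
qed

text \<open>Over a common denominator the difference has the numerator \<open>2 e (1 - r) (r - e\<^sup>2)\<close> with \<open>e = cis s\<close>, and
\<open>|r - e\<^sup>2| \<le> (1 - r) + |1 - e\<^sup>2|\<close> is at most a multiple of \<open>|e - r|\<close>.\<close>

lemma diff_kernel_near_normal_kernel:
  assumes r: "1/4 \<le> r" "r < 1" and s: "\<bar>s\<bar> \<le> pi" "s \<noteq> 0"
  shows "norm (diff_kernel r s - of_real (- normal_kernel s))
           \<le> ((1 + 2 * pi) * pi\<^sup>2) * (1 - r) / (norm (cis s - of_real r) * s\<^sup>2)"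
proof -
  define e where "e = cis s"
  define d where "d = norm (e - of_real r)"
  have sn: "sin (s/2) \<noteq> 0" by (rule sin_half_nonzero[OF s])
  have er: "e - of_real r \<noteq> 0" unfolding e_def using cis_minus_real_nonzero[of r s] r by simp
  have d: "d > 0" using er by (simp add: d_def)
  have e1: "(e - 1)\<^sup>2 = - 4 * of_real ((sin (s/2))\<^sup>2) * e" unfolding e_def by (rule cis_minus_one_power2)
  have e0: "e \<noteq> 0" by (simp add: e_def)
  have e1nz: "e - 1 \<noteq> 0" using e1 sn e0 by auto
  have "complex_of_real (- normal_kernel s) = 2 * e / (e - 1)\<^sup>2"
    unfolding e1 normal_kernel_def using e0 sn by (simp add: field_simps)
  then have "diff_kernel r s - of_real (- normal_kernel s) = 2 * of_real r * e / (e - of_real r)\<^sup>2 - 2 * e / (e - 1)\<^sup>2"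
    by (simp add: diff_kernel_def e_def)
  also have "\<dots> = (2 * of_real r * e * (e - 1)\<^sup>2 - 2 * e * (e - of_real r)\<^sup>2) / ((e - of_real r)\<^sup>2 * (e - 1)\<^sup>2)"
    using er e1nz by (simp add: diff_frac_eq)
  also have "2 * of_real r * e * (e - 1)\<^sup>2 - 2 * e * (e - of_real r)\<^sup>2 = 2 * e * (1 - of_real r) * (of_real r - e\<^sup>2)"
    by (simp add: power2_eq_square algebra_simps)
  finally have eq: "diff_kernel r s - of_real (- normal_kernel s) = 2 * e * (1 - of_real r) * (of_real r - e\<^sup>2) / ((e - of_real r)\<^sup>2 * (e - 1)\<^sup>2)" .
  have ne: "norm e = 1" by (simp add: e_def)
  have n1r: "norm (1 - complex_of_real r) = 1 - r"
    using r norm_of_real[of "1 - r", where 'a = complex] by simp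
  have "norm (diff_kernel r s - of_real (- normal_kernel s)) = 2 * (1 - r) * norm (of_real r - e\<^sup>2) / (d\<^sup>2 * (norm (e - 1))\<^sup>2)"
    unfolding eq by (simp add: norm_divide norm_mult norm_power ne n1r d_def)
  also have "\<dots> \<le> 2 * (1 - r) * ((1 + 2 * pi) * d) / (d\<^sup>2 * (4 * (s\<^sup>2 / pi\<^sup>2)))"
  proof (rule frac_le)
    have "e * cnj e = 1" "e - cnj e = 2 * \<i> * sin s" by (simp_all add: e_def cis_cnj cis_mult complex_eq_iff)
    moreover have "1 - e\<^sup>2 = (1 - e * cnj e) - (e - cnj e) * e" by (simp add: power2_eq_square algebra_simps)
    ultimately have "1 - e\<^sup>2 = - 2 * \<i> * sin s * e" by simp
    then have "norm (1 - e\<^sup>2) = 2 * \<bar>sin s\<bar>" by (simp add: norm_mult ne)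
    also have "\<dots> \<le> 2 * \<bar>s\<bar>" using abs_sin_x_le_abs_x[of s] by simp
    also have "\<dots> \<le> 2 * pi * d" using cis_minus_real_ge_arc[of r s] r s by (simp add: d_def e_def field_simps)
    finally have "norm (1 - e\<^sup>2) \<le> 2 * pi * d" .
    moreover have "norm (of_real r - (1::complex)) \<le> d" using n1r cis_minus_real_ge_gap[of r s] r by (simp add: d_def e_def norm_minus_commute)
    moreover have "norm (of_real r - e\<^sup>2) \<le> norm (of_real r - (1::complex)) + norm (1 - e\<^sup>2)"
      using norm_triangle_ineq[of "of_real r - 1" "1 - e\<^sup>2"] by simp
    ultimately have "norm (of_real r - e\<^sup>2) \<le> (1 + 2 * pi) * d" by (simp add: algebra_simps)
    then show "2 * (1 - r) * norm (of_real r - e\<^sup>2) \<le> 2 * (1 - r) * ((1 + 2 * pi) * d)"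
      using r by (intro mult_left_mono) auto
    have "(\<bar>s\<bar> / pi)\<^sup>2 \<le> (sin (s/2))\<^sup>2"
      using power_mono[OF abs_sin_half_ge[OF s(1)], of 2] by simp
    then show "d\<^sup>2 * (4 * (s\<^sup>2 / pi\<^sup>2)) \<le> d\<^sup>2 * (norm (e - 1))\<^sup>2"
      unfolding e_def cis_minus_one_sq by (intro mult_left_mono) (auto simp: power_divide)
    show "0 < d\<^sup>2 * (4 * (s\<^sup>2 / pi\<^sup>2))" using d s by simp
    show "0 \<le> 2 * (1 - r) * ((1 + 2 * pi) * d)" using r d by simp
  qed
  also have "\<dots> = ((1 + 2 * pi) * pi\<^sup>2) * (1 - r) / (d * s\<^sup>2) / 2"
    using d s by (simp add: power2_eq_square field_simps)
  also have "\<dots> \<le> ((1 + 2 * pi) * pi\<^sup>2) * (1 - r) / (d * s\<^sup>2)"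
  proof -
    have "0 \<le> ((1 + 2 * pi) * pi\<^sup>2) * (1 - r) / (d * s\<^sup>2)" using r d by (intro divide_nonneg_nonneg) auto
    moreover have "x / 2 \<le> x" if "0 \<le> x" for x :: real using that by simp
    ultimately show ?thesis by blast
  qed
  finally show ?thesis by (simp add: d_def e_def)
qed

text \<open>The same estimate for the Poisson kernel divided by \<open>1 - r\<close>, whose limit governs the radial difference
quotient of a Poisson integral.\<close>

lemma poisson_quotient_near_normal_kernel:
  assumes r: "1/4 \<le> r" "r < 1" and s: "\<bar>s\<bar> \<le> pi" "s \<noteq> 0"
  shows "norm (of_real ((1 + r) / (norm (cis s - of_real r))\<^sup>2) - complex_of_real (normal_kernel s))
           \<le> ((2 + 2 * pi) * pi\<^sup>2) * (1 - r) / (norm (cis s - of_real r) * s\<^sup>2)"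
proof -
  define d where "d = norm (cis s - of_real r)"
  define q where "q = 4 * (sin (s/2))\<^sup>2"
  have sn: "sin (s/2) \<noteq> 0" by (rule sin_half_nonzero[OF s])
  have q: "q > 0" using sn by (simp add: q_def)
  have d: "d > 0" unfolding d_def using cis_minus_real_nonzero[of r s] r by simp
  have d2: "d\<^sup>2 = (1 - r)\<^sup>2 + r * q" unfolding d_def cis_minus_real_sq by (simp add: q_def)
  have nk: "normal_kernel s = 2 / q" by (simp add: normal_kernel_def q_def)
  have "(1 + r) / d\<^sup>2 - 2 / q = ((1 + r) * q - 2 * d\<^sup>2) / (d\<^sup>2 * q)"
    using d q by (simp add: diff_frac_eq)
  also have "(1 + r) * q - 2 * d\<^sup>2 = (1 - r) * (q - 2 * (1 - r))"
    unfolding d2 by (simp add: power2_eq_square algebra_simps)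
  finally have eq: "\<bar>(1 + r) / d\<^sup>2 - 2 / q\<bar> = (1 - r) * \<bar>q - 2 * (1 - r)\<bar> / (d\<^sup>2 * q)"
    using r q by (simp add: abs_mult)
  have "\<bar>sin (s/2)\<bar> \<le> \<bar>s\<bar> / 2" using abs_sin_x_le_abs_x[of "s/2"] by simp
  then have "\<bar>sin (s/2)\<bar> * \<bar>sin (s/2)\<bar> \<le> (\<bar>s\<bar>/2) * 1" by (intro mult_mono) auto
  then have "q \<le> 2 * \<bar>s\<bar>" by (simp add: q_def power2_eq_square abs_mult_self_eq)
  also have "\<dots> \<le> 2 * pi * d" using cis_minus_real_ge_arc[of r s] r s by (simp add: d_def field_simps)
  finally have "q \<le> 2 * pi * d" .
  moreover have "1 - r \<le> d" using cis_minus_real_ge_gap[of r s] r by (simp add: d_def)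
  ultimately have num: "\<bar>q - 2 * (1 - r)\<bar> \<le> (2 + 2 * pi) * d"
    using q r d by (auto simp: abs_le_iff algebra_simps)
  have "(\<bar>s\<bar> / pi)\<^sup>2 \<le> (sin (s/2))\<^sup>2"
    using power_mono[OF abs_sin_half_ge[OF s(1)], of 2] by simp
  then have "s\<^sup>2 / pi\<^sup>2 \<le> (sin (s/2))\<^sup>2" by (simp add: power_divide)
  then have qs: "s\<^sup>2 / pi\<^sup>2 \<le> q" using zero_le_power2[of "sin (s/2)"] unfolding q_def by linarith
  have "(1 - r) * \<bar>q - 2 * (1 - r)\<bar> / (d\<^sup>2 * q) \<le> (1 - r) * ((2 + 2 * pi) * d) / (d\<^sup>2 * (s\<^sup>2 / pi\<^sup>2))"
    using num qs d s r by (intro frac_le mult_left_mono) auto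
  also have "\<dots> = ((2 + 2 * pi) * pi\<^sup>2) * (1 - r) / (d * s\<^sup>2)"
    using d s by (simp add: power2_eq_square field_simps)
  finally have "\<bar>(1 + r) / d\<^sup>2 - 2 / q\<bar> \<le> ((2 + 2 * pi) * pi\<^sup>2) * (1 - r) / (d * s\<^sup>2)" unfolding eq .
  then show ?thesis unfolding nk d_def by (metis norm_of_real of_real_diff)
qed

text \<open>The imaginary part is \<open>2 \<pi>\<close> times the derivative in \<open>s\<close> of the Poisson kernel, which decreases on both
sides of \<open>0\<close>. So it is odd, and its sign is opposite to that of \<open>sin s\<close>.\<close>

lemma Im_diff_kernel:
  assumes "0 \<le> r" "r < 1"
  shows "Im (diff_kernel r s) = - (2 * r * (1 - r\<^sup>2) * sin s / (norm (cis s - of_real r))^4)"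
proof -
  define e where "e = cis s"
  have er: "e - of_real r \<noteq> 0" unfolding e_def by (rule cis_minus_real_nonzero[OF assms])
  have n4: "complex_of_real ((norm (e - of_real r))^4) = (e - of_real r)\<^sup>2 * (cnj (e - of_real r))\<^sup>2"
    by (simp only: power_mult_distrib[symmetric] complex_norm_square[symmetric] of_real_power[symmetric] power_mult[symmetric]) simp
  have ec: "e * cnj e = 1" by (simp add: e_def cis_cnj cis_mult)
  have "diff_kernel r s = 2 * of_real r * e * (cnj (e - of_real r))\<^sup>2 / ((e - of_real r)\<^sup>2 * (cnj (e - of_real r))\<^sup>2)"
    unfolding diff_kernel_def e_def[symmetric] using er by (simp del: complex_cnj_diff)
  also have "\<dots> = 2 * of_real r * (e * (cnj (e - of_real r))\<^sup>2) / of_real ((norm (e - of_real r))^4)"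
    unfolding n4 by (simp add: mult.assoc)
  also have "e * (cnj (e - of_real r))\<^sup>2 = cnj e - 2 * of_real r + of_real (r\<^sup>2) * e"
  proof -
    have "e * (cnj (e - of_real r))\<^sup>2 = (e * cnj e) * cnj e - 2 * of_real r * (e * cnj e) + of_real (r\<^sup>2) * e"
      by (simp add: power2_eq_square algebra_simps)
    then show ?thesis unfolding ec by simp
  qed
  finally have "diff_kernel r s = (2 * of_real r * (cnj e - 2 * of_real r + of_real (r\<^sup>2) * e)) / of_real ((norm (e - of_real r))^4)" .
  then have "Im (diff_kernel r s) = 2 * r * (- sin s + r\<^sup>2 * sin s) / (norm (e - of_real r))^4"
    by (simp add: e_def Im_divide_of_real)
  then show ?thesis by (simp add: e_def algebra_simps minus_divide_left)
qed

section \<open>The Cauchy transform and the Poisson integral\<close>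

lemma integral_periodic_shift:
  fixes u :: "real \<Rightarrow> complex"
  assumes cont: "continuous_on UNIV u" and per: "\<And>t. u (t + p) = u t" and p: "p > 0"
  shows "integral {a..a+p} u = integral {0..p} u"
proof -
  define N where "N = \<bar>a\<bar> + p"
  define U where "U x = integral {-N..x} u" for x
  have cN: "continuous_on A u" for A using cont continuous_on_subset by blast
  have U: "(U has_vector_derivative u x) (at x within {-N..N})" if "x \<in> {-N..N}" for x
    unfolding U_def by (rule integral_has_vector_derivative [OF cN that])
  have eq: "integral {x..x+p} u = U (x + p) - U x" if "-N \<le> x" "x + p \<le> N" for x
    using Henstock_Kurzweil_Integration.integral_combine[of "-N" x "x + p" u] that p
    by (simp add: U_def integrable_continuous_real cN algebra_simps)
  have "((\<lambda>x. U (x + p) - U x) has_vector_derivative 0) (at x within {-N..N-p})" if x: "x \<in> {-N..N-p}" for x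
  proof -
    have "((\<lambda>x. U (x + p)) has_vector_derivative u (x + p)) (at x within {-N..N-p})"
    proof -
      have "(U has_vector_derivative u (x + p)) (at (x + p) within (\<lambda>x. x + p) ` {-N..N-p})"
        by (rule has_vector_derivative_within_subset [OF U]) (use x p in auto)
      moreover have "((\<lambda>x. x + p) has_vector_derivative 1) (at x within {-N..N-p})"
        by (auto intro!: derivative_eq_intros)
      ultimately show ?thesis using vector_diff_chain_within[of "\<lambda>x. x + p" 1 x "{-N..N-p}" U "u (x+p)"]
        by (simp add: o_def)
    qed
    moreover have "(U has_vector_derivative u x) (at x within {-N..N-p})"
      by (rule has_vector_derivative_within_subset [OF U]) (use x p in auto)
    ultimately show ?thesis using has_vector_derivative_diff per by fastforce
  qed
  then obtain c where "\<And>x. x \<in> {-N..N-p} \<Longrightarrow> U (x + p) - U x = c"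
    using has_vector_derivative_zero_constant[of "{-N..N-p}" "\<lambda>x. U (x + p) - U x"] by blast
  from this[of a] this[of 0] have "U (a + p) - U a = U (0 + p) - U 0"
    using p abs_ge_self[of a] abs_ge_minus_self[of a] by (simp add: N_def)
  then show ?thesis using eq[of a] eq[of 0] p by (auto simp: N_def)
qed

lemma integral_period_centered:
  fixes u :: "real \<Rightarrow> complex"
  assumes "continuous_on UNIV u" and "\<And>t. u (t + 2 * pi) = u t"
  shows "integral {-pi..pi} (\<lambda>s. u (\<tau> + s)) = integral {0..2*pi} u"
proof -
  have c: "continuous_on UNIV (\<lambda>s. u (\<tau> + s))"
    by (rule continuous_on_compose2 [OF assms(1)]) (auto intro!: continuous_intros)
  have "integral {-pi..-pi+2*pi} (\<lambda>s. u (\<tau> + s)) = integral {0..2*pi} (\<lambda>s. u (\<tau> + s))"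
    by (rule integral_periodic_shift [OF c]) (use assms(2)[of "\<tau> + _"] in \<open>auto simp: add.assoc\<close>)
  also have "\<dots> = integral {\<tau>..\<tau>+2*pi} u"
    using integral_shift_Icc_real[of 0 "2*pi" u \<tau>] by (simp add: o_def add.commute)
  also have "\<dots> = integral {0..2*pi} u"
    by (rule integral_periodic_shift) (use assms in auto)
  finally show ?thesis by simp
qed

text \<open>On the unit circle \<open>d\<zeta> / (2 \<pi> i) = cis t dt / (2 \<pi>)\<close>, so this is the Cauchy integral of \<open>\<Phi>\<close>.\<close>

definition cauchy_transform :: "(real \<Rightarrow> complex) \<Rightarrow> complex \<Rightarrow> complex" where
  "cauchy_transform \<Phi> z = integral {0..2*pi} (\<lambda>t. cis t * \<Phi> t / (cis t - z)) / (2 * pi)"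

definition cauchy_transform_deriv :: "(real \<Rightarrow> complex) \<Rightarrow> complex \<Rightarrow> complex" where
  "cauchy_transform_deriv \<Phi> z = integral {0..2*pi} (\<lambda>t. cis t * \<Phi> t / (cis t - z)\<^sup>2) / (2 * pi)"

lemma cis_minus_nonzero: "norm z < 1 \<Longrightarrow> cis t - z \<noteq> 0"
  by (metis norm_cis order_less_irrefl right_minus_eq)

lemma cauchy_transform_has_derivative:
  assumes cont: "continuous_on {0..2*pi} \<Phi>" and z: "norm z < 1"
  shows "(cauchy_transform \<Phi> has_field_derivative cauchy_transform_deriv \<Phi> z) (at z)"
proof -
  have "((\<lambda>z. integral (cbox 0 (2*pi)) (\<lambda>t. cis t * \<Phi> t / (cis t - z))) has_field_derivative
        integral (cbox 0 (2*pi)) (\<lambda>t. cis t * \<Phi> t / (cis t - z)\<^sup>2)) (at z within ball 0 1)"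
  proof (rule leibniz_rule_field_derivative)
    fix x :: complex and t :: real assume x: "x \<in> ball 0 1"
    then have nz: "cis t - x \<noteq> 0" using cis_minus_nonzero[of x t] by simp
    show "((\<lambda>x. cis t * \<Phi> t / (cis t - x)) has_field_derivative cis t * \<Phi> t / (cis t - x)\<^sup>2) (at x within ball 0 1)"
      using nz by (auto intro!: derivative_eq_intros simp: power2_eq_square)
  next
    fix x :: complex assume x: "x \<in> ball 0 1"
    then show "(\<lambda>t. cis t * \<Phi> t / (cis t - x)) integrable_on cbox 0 (2*pi)"
      using cis_minus_nonzero[of x] cont
      by (auto intro!: integrable_continuous_real continuous_intros)
  next
    have c2: "continuous_on (ball 0 1 \<times> cbox 0 (2*pi)) (\<lambda>x::complex \<times> real. \<Phi> (snd x))"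
      by (rule continuous_on_compose2 [OF cont]) (auto intro!: continuous_intros)
    show "continuous_on (ball 0 1 \<times> cbox 0 (2*pi)) (\<lambda>(x, t). cis t * \<Phi> t / (cis t - x)\<^sup>2)"
      unfolding split_beta using cis_minus_nonzero
      by (intro continuous_intros c2) auto
  qed (use z in auto)
  then have "((\<lambda>z. integral {0..2*pi} (\<lambda>t. cis t * \<Phi> t / (cis t - z)) / (2*pi)) has_field_derivative
        integral {0..2*pi} (\<lambda>t. cis t * \<Phi> t / (cis t - z)\<^sup>2) / (2*pi)) (at z)"
    using z by (intro DERIV_cdivide) (simp add: at_within_open[of z "ball 0 1"])
  then show ?thesis
    unfolding cauchy_transform_def [abs_def] cauchy_transform_deriv_def .
qed

lemma cauchy_transform_holomorphic:
  assumes cont: "continuous_on {0..2*pi} \<Phi>"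
  shows "cauchy_transform \<Phi> holomorphic_on ball 0 1"
  unfolding holomorphic_on_open[OF open_ball]
proof
  fix x :: complex assume "x \<in> ball 0 1"
  then show "\<exists>f'. (cauchy_transform \<Phi> has_field_derivative f') (at x)"
    using cauchy_transform_has_derivative[OF cont, of x] by auto
qed

lemma cauchy_transform_deriv_holomorphic:
  assumes cont: "continuous_on {0..2*pi} \<Phi>"
  shows "cauchy_transform_deriv \<Phi> holomorphic_on ball 0 1"
proof -
  have "deriv (cauchy_transform \<Phi>) holomorphic_on ball 0 1"
    by (rule holomorphic_deriv [OF cauchy_transform_holomorphic [OF cont]]) auto
  moreover have "deriv (cauchy_transform \<Phi>) z = cauchy_transform_deriv \<Phi> z" if "z \<in> ball 0 1" for z
    using cauchy_transform_has_derivative[OF cont, of z] that by (intro DERIV_imp_deriv) auto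
  ultimately show ?thesis by (rule holomorphic_transform)
qed

lemma integral_cis_over_square:
  assumes z: "norm z < 1" shows "integral {a..a+2*pi} (\<lambda>t. cis t / (cis t - z)\<^sup>2) = 0"
proof -
  have "((\<lambda>t. cis t / (cis t - z)\<^sup>2) has_integral (\<i> / (cis (a+2*pi) - z) - \<i> / (cis a - z))) {a..a+2*pi}"
  proof (rule fundamental_theorem_of_calculus)
    fix x assume "x \<in> {a..a+2*pi}"
    have "((\<lambda>t. \<i> / (cis t - z)) has_vector_derivative cis x / (cis x - z)\<^sup>2) (at x)"
      using cis_minus_nonzero[OF z, of x]
      by (auto intro!: derivative_eq_intros simp: has_vector_derivative_def power2_eq_square field_simps scaleR_conv_of_real)
    then show "((\<lambda>t. \<i> / (cis t - z)) has_vector_derivative cis x / (cis x - z)\<^sup>2) (at x within {a..a+2*pi})"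
      by (rule has_vector_derivative_at_within)
  qed simp
  moreover have "cis (a + 2 * pi) = cis a" by (simp add: complex_eq_iff)
  ultimately show ?thesis by (simp add: integral_unique)
qed

lemma cauchy_transform_one:
  assumes z: "norm z < 1" shows "integral {0..2*pi} (\<lambda>t. cis t / (cis t - z)) = 2 * pi"
proof -
  have "(cauchy_transform (\<lambda>t. 1) has_field_derivative 0) (at x within ball 0 1)" if "x \<in> ball 0 1" for x
    using cauchy_transform_has_derivative[of "\<lambda>t. 1" x] that integral_cis_over_square[of x 0]
    by (auto simp: cauchy_transform_deriv_def intro: has_field_derivative_at_within)
  then obtain c where c: "\<And>x. x \<in> ball 0 1 \<Longrightarrow> cauchy_transform (\<lambda>t. 1) x = c"
    using has_field_derivative_zero_constant[of "ball 0 1" "cauchy_transform (\<lambda>t. 1)"] by auto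
  have "cauchy_transform (\<lambda>t. 1) z = cauchy_transform (\<lambda>t. 1) 0" using c z by simp
  then show ?thesis by (simp add: cauchy_transform_def scaleR_conv_of_real)
qed

lemma cis_add_2pi: "cis (t + 2 * pi) = cis t"
  by (simp add: complex_eq_iff)

lemma periodic_of_int:
  fixes f :: "real \<Rightarrow> 'a"
  assumes "\<And>t. f (t + p) = f t"
  shows "f (t + of_int n * p) = f t"
proof (induction n rule: int_induct[where k = 0])
  case (step1 i)
  then show ?case using assms[of "t + of_int i * p"] by (simp add: algebra_simps)
next
  case (step2 i)
  then show ?case using assms[of "t + of_int (i - 1) * p"] by (simp add: algebra_simps)
qed simp

lemma translate_into_period:
  fixes p :: real
  assumes "p > 0"
  obtains n :: int where "t + of_int n * p \<in> {0..<p}"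
proof -
  have "t + of_int (- \<lfloor>t / p\<rfloor>) * p = frac (t / p) * p"
    using assms by (simp add: frac_def field_simps)
  also have "\<dots> \<in> {0..<p}"
    using assms frac_ge_0[of "t / p"] frac_lt_1[of "t / p"] by auto
  finally show thesis using that by blast
qed

text \<open>The rotation \<open>t = \<tau> + s\<close> moves the point \<open>r cis \<tau>\<close> to \<open>r\<close>.\<close>

lemma cauchy_transform_deriv_polar:
  assumes cont: "continuous_on UNIV \<Phi>" and per: "\<And>t. \<Phi> (t + 2 * pi) = \<Phi> t" and r: "0 \<le> r" "r < 1"
  shows "2 * rcis r \<tau> * cauchy_transform_deriv \<Phi> (rcis r \<tau>)
          = integral {-pi..pi} (\<lambda>s. diff_kernel r s * \<Phi> (\<tau> + s)) / (2 * pi)"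
proof -
  let ?z = "rcis r \<tau>"
  have z: "norm ?z < 1" using r by simp
  define u where "u t = 2 * ?z * (cis t * \<Phi> t / (cis t - ?z)\<^sup>2)" for t
  have "2 * ?z * integral {0..2*pi} (\<lambda>t. cis t * \<Phi> t / (cis t - ?z)\<^sup>2) = integral {0..2*pi} u"
    unfolding u_def by (rule integral_mult_right [symmetric])
  also have "\<dots> = integral {-pi..pi} (\<lambda>s. u (\<tau> + s))"
  proof (rule integral_period_centered [symmetric])
    show "continuous_on UNIV u" unfolding u_def using cis_minus_nonzero[OF z] cont
      by (intro continuous_intros) auto
    show "u (t + 2 * pi) = u t" for t by (simp add: u_def cis_add_2pi per)
  qed
  also have "(\<lambda>s. u (\<tau> + s)) = (\<lambda>s. diff_kernel r s * \<Phi> (\<tau> + s))"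
  proof
    fix s
    have c: "cis (\<tau> + s) = cis \<tau> * cis s" by (simp add: cis_mult)
    have d: "cis (\<tau> + s) - ?z = cis \<tau> * (cis s - of_real r)" by (simp add: c rcis_def algebra_simps)
    show "u (\<tau> + s) = diff_kernel r s * \<Phi> (\<tau> + s)"
      unfolding u_def diff_kernel_def d using cis_minus_real_nonzero[OF r, of s]
      by (simp add: c rcis_def power_mult_distrib power2_eq_square)
  qed
  finally show ?thesis by (simp add: cauchy_transform_deriv_def)
qed

lemma integral_cis_full: "integral {-pi..pi} (\<lambda>s. cis s / (cis s - of_real r)) = 2 * pi"
  if r: "0 \<le> r" "r < 1"
proof -
  have "integral {-pi..pi} (\<lambda>s. cis (0 + s) / (cis (0 + s) - of_real r)) = integral {0..2*pi} (\<lambda>s. cis s / (cis s - of_real r))"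
    using cis_minus_real_nonzero[OF r]
    by (intro integral_period_centered[of "\<lambda>s. cis s / (cis s - of_real r)"] continuous_intros) (auto simp: cis_add_2pi)
  then show ?thesis using cauchy_transform_one[of "of_real r"] r by simp
qed

text \<open>Because the kernel has mean zero, the value of \<open>F\<close> at the boundary point may be subtracted from \<open>F\<close>,
so that only increments of \<open>F\<close> are integrated.\<close>

lemma integral_diff_kernel: "integral {-pi..pi} (diff_kernel r) = 0" if r: "0 \<le> r" "r < 1"
proof -
  have "integral {-pi..pi} (\<lambda>t. 2 * of_real r * (cis t / (cis t - of_real r)\<^sup>2)) = 0"
    unfolding integral_mult_right using integral_cis_over_square[of "of_real r" "-pi"] r by simp
  then show ?thesis by (simp add: diff_kernel_def [abs_def])
qed

text \<open>The normalization of the kernel: for the boundary function \<open>sin\<close>, whose derivative at \<open>0\<close> is \<open>1\<close>, the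
integral is computed exactly. By partial fractions everything reduces to the integrals of \<open>cis s / (cis s - r)\<close>
and \<open>cis s / (cis s - r)\<^sup>2\<close>.\<close>

lemma integral_diff_kernel_sin:
  assumes r: "0 < r" "r < 1"
  shows "integral {-pi..pi} (\<lambda>s. diff_kernel r s * of_real (sin s)) = - 2 * pi * r * \<i>"
proof -
  let ?d = "\<lambda>s. cis s - complex_of_real r"
  have nz: "?d s \<noteq> 0" for s using cis_minus_real_nonzero[of r s] r by simp
  have i: "(\<lambda>s. cis s / ?d s) integrable_on {-pi..pi}" "(\<lambda>s. cis s / (?d s)\<^sup>2) integrable_on {-pi..pi}"
    using nz by (auto intro!: integrable_continuous_real continuous_intros)
  define c where "c = complex_of_real (2 * pi)"
  have I1: "((\<lambda>s. cis s / ?d s) has_integral c) {-pi..pi}"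
    using i(1) integral_cis_full[of r] r by (simp add: has_integral_iff c_def)
  have I2: "((\<lambda>s. cis s / (?d s)\<^sup>2) has_integral 0) {-pi..pi}"
    using i(2) integral_cis_over_square[of "of_real r" "-pi"] r by (simp add: has_integral_iff)
  have I0: "((\<lambda>s. 1::complex) has_integral c) {-pi..pi}"
    using has_integral_const_real[of "1::complex" "-pi" pi] by (simp add: scaleR_conv_of_real c_def)
  have M: "((\<lambda>s. - \<i> * of_real r * (cis s / ?d s) - \<i> * (of_real r)\<^sup>2 * (cis s / (?d s)\<^sup>2)
         + \<i> * (cis s / (?d s)\<^sup>2) - \<i> / of_real r * (cis s / ?d s - 1))
        has_integral (- \<i> * of_real r * c - \<i> * (of_real r)\<^sup>2 * 0 + \<i> * 0 - \<i> / of_real r * (c - c))) {-pi..pi}"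
    by (intro has_integral_diff has_integral_add has_integral_mult_right I0 I1 I2)
  have E1: "diff_kernel r s * of_real (sin s) = - \<i> * of_real r * (cis s / ?d s) - \<i> * (of_real r)\<^sup>2 * (cis s / (?d s)\<^sup>2)
         + \<i> * of_real r * (1 / (?d s)\<^sup>2)" for s
  proof -
    have s: "of_real (sin s) = - \<i> * (cis s - cis (-s)) / 2" by (simp add: complex_eq_iff)
    have c: "cis s * cis (-s) = 1" by (simp add: cis_mult)
    have "diff_kernel r s * of_real (sin s) = - \<i> * of_real r * (cis s * (cis s - cis (-s))) / (?d s)\<^sup>2"
      unfolding diff_kernel_def s by simp
    also have "\<dots> = - \<i> * of_real r * (cis s * cis s - cis s * cis (-s)) / (?d s)\<^sup>2"
      by (simp only: right_diff_distrib)
    also have "\<dots> = - \<i> * of_real r * (cis s * ?d s + of_real r * cis s - 1) / (?d s)\<^sup>2"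
      unfolding c by (simp add: algebra_simps)
    also have "\<dots> = - \<i> * of_real r * (cis s * ?d s / (?d s)\<^sup>2) - \<i> * (of_real r)\<^sup>2 * (cis s / (?d s)\<^sup>2)
         + \<i> * of_real r * (1 / (?d s)\<^sup>2)"
      by (simp add: diff_divide_distrib add_divide_distrib power2_eq_square algebra_simps)
    also have "cis s * ?d s / (?d s)\<^sup>2 = cis s / ?d s" using nz[of s] by (simp add: power2_eq_square)
    finally show ?thesis .
  qed
  have E2: "of_real r * (1 / (?d s)\<^sup>2) = cis s / (?d s)\<^sup>2 - (cis s / ?d s - 1) / of_real r" for s
  proof -
    have "of_real r / (?d s)\<^sup>2 = cis s / (?d s)\<^sup>2 - ?d s / (?d s)\<^sup>2"
      by (simp add: diff_divide_distrib[symmetric])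
    also have "?d s / (?d s)\<^sup>2 = 1 / ?d s" using nz[of s] by (simp add: power2_eq_square)
    also have "1 / ?d s = (cis s / ?d s - 1) / of_real r"
      using nz[of s] r by (simp add: field_simps)
    finally show ?thesis by simp
  qed
  have "\<i> * of_real r * (1 / (?d s)\<^sup>2) = \<i> * (cis s / (?d s)\<^sup>2) - \<i> / of_real r * (cis s / ?d s - 1)" for s
  proof -
    have "\<i> * of_real r * (1 / (?d s)\<^sup>2) = \<i> * (of_real r * (1 / (?d s)\<^sup>2))" by (rule mult.assoc)
    also have "\<dots> = \<i> * (cis s / (?d s)\<^sup>2) - \<i> * ((cis s / ?d s - 1) / of_real r)"
      unfolding E2 by (rule right_diff_distrib)
    finally show ?thesis by simp
  qed
  then have "((\<lambda>s. diff_kernel r s * of_real (sin s)) has_integral (- \<i> * of_real r * c)) {-pi..pi}"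
    using M unfolding E1 by (simp add: add_diff_eq)
  then have "integral {-pi..pi} (\<lambda>s. diff_kernel r s * of_real (sin s)) = - \<i> * of_real r * c"
    by (rule integral_unique)
  then show ?thesis by (simp add: c_def)
qed

lemma poisson_kernel_eq:
  "poisson_kernel (norm z) (t - Arg z) = (1 - (norm z)\<^sup>2) / (2 * pi * (norm (cis t - z))\<^sup>2)"
proof -
  have z: "z = of_real (norm z) * cis (Arg z)" using rcis_cmod_Arg[of z] by (simp add: rcis_def)
  have "(norm (cis t - z))\<^sup>2 = (cos t - norm z * cos (Arg z))\<^sup>2 + (sin t - norm z * sin (Arg z))\<^sup>2"
    by (subst z) (simp add: cmod_power2)
  also have "\<dots> = ((cos t)\<^sup>2 + (sin t)\<^sup>2) - 2 * norm z * (cos t * cos (Arg z) + sin t * sin (Arg z))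
      + (norm z)\<^sup>2 * ((cos (Arg z))\<^sup>2 + (sin (Arg z))\<^sup>2)"
    by algebra
  also have "\<dots> = 1 - 2 * norm z * cos (t - Arg z) + (norm z)\<^sup>2"
    by (simp only: sin_cos_squared_add2 cos_diff mult_1_right)
  finally show ?thesis by (simp add: poisson_kernel_def)
qed

lemma poisson_kernel_split:
  assumes z: "norm z < 1"
  shows "complex_of_real ((1 - (norm z)\<^sup>2) / (norm (cis t - z))\<^sup>2) = cis t / (cis t - z) + cnj (cis t / (cis t - z)) - 1"
proof -
  have nz: "cis t - z \<noteq> 0" "cnj (cis t) - cnj z \<noteq> 0"
    using cis_minus_nonzero[OF z, of t] complex_cnj_cancel_iff[of "cis t" z] by auto
  have c: "cis t * cnj (cis t) = 1" by (simp add: cis_cnj cis_mult)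
  have "cis t / (cis t - z) + cnj (cis t / (cis t - z)) - 1 =
      (cis t * (cnj (cis t) - cnj z) + cnj (cis t) * (cis t - z) - (cis t - z) * (cnj (cis t) - cnj z))
        / ((cis t - z) * (cnj (cis t) - cnj z))"
  proof -
    have "cis t / (cis t - z) = cis t * (cnj (cis t) - cnj z) / ((cis t - z) * (cnj (cis t) - cnj z))"
      "cnj (cis t / (cis t - z)) = cnj (cis t) * (cis t - z) / ((cis t - z) * (cnj (cis t) - cnj z))"
      "1 = (cis t - z) * (cnj (cis t) - cnj z) / ((cis t - z) * (cnj (cis t) - cnj z))"
      using nz by simp_all
    then show ?thesis by (metis add_divide_distrib diff_divide_distrib)
  qed
  also have "\<dots> = (cis t * cnj (cis t) - z * cnj z) / ((cis t - z) * cnj (cis t - z))"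
    by (simp add: algebra_simps)
  also have "\<dots> = of_real ((1 - (norm z)\<^sup>2) / (norm (cis t - z))\<^sup>2)"
    unfolding c by (simp add: complex_norm_square[symmetric] del: complex_cnj_diff)
  finally show ?thesis by simp
qed

text \<open>The Poisson kernel is \<open>2 Re (cis t / (cis t - z)) - 1\<close>, up to the factor \<open>2 \<pi>\<close>. This splits the harmonic
function into a holomorphic and an antiholomorphic part.\<close>

lemma poisson_extension_decomp:
  assumes cont: "continuous_on {0..2*pi} (\<lambda>t. F (cis t))" and z: "norm z < 1"
  shows "poisson_extension F z = cauchy_transform (\<lambda>t. F (cis t)) z + cnj (cauchy_transform (\<lambda>t. cnj (F (cis t))) z)
     - integral {0..2*pi} (\<lambda>t. F (cis t)) / (2 * pi)"
proof -
  let ?\<Phi> = "\<lambda>t. F (cis t)"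
  have nz: "cis t - z \<noteq> 0" for t by (rule cis_minus_nonzero[OF z])
  have i1: "(\<lambda>t. cis t * ?\<Phi> t / (cis t - z)) integrable_on {0..2*pi}"
    using nz cont by (intro integrable_continuous_real continuous_intros) auto
  have i2: "(\<lambda>t. cis t * cnj (?\<Phi> t) / (cis t - z)) integrable_on {0..2*pi}"
    using nz cont by (intro integrable_continuous_real continuous_intros) auto
  have i2': "(\<lambda>t. cnj (cis t * cnj (?\<Phi> t) / (cis t - z))) integrable_on {0..2*pi}"
    using i2 by (simp only: integrable_on_cnj_iff)
  have i3: "?\<Phi> integrable_on {0..2*pi}" by (rule integrable_continuous_real [OF cont])
  have "poisson_extension F z = integral {0..2*pi} (\<lambda>t. (cis t * ?\<Phi> t / (cis t - z) +
      cnj (cis t * cnj (?\<Phi> t) / (cis t - z)) - ?\<Phi> t) / (2 * pi))"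
    unfolding poisson_extension_def
  proof (rule integral_cong)
    fix t
    have "poisson_kernel (norm z) (t - Arg z) *\<^sub>R ?\<Phi> t = complex_of_real ((1 - (norm z)\<^sup>2) / (norm (cis t - z))\<^sup>2) * ?\<Phi> t / (2 * pi)"
      by (simp add: poisson_kernel_eq scaleR_conv_of_real field_simps)
    then show "poisson_kernel (norm z) (t - Arg z) *\<^sub>R ?\<Phi> t = (cis t * ?\<Phi> t / (cis t - z) +
      cnj (cis t * cnj (?\<Phi> t) / (cis t - z)) - ?\<Phi> t) / (2 * pi)"
      unfolding poisson_kernel_split[OF z] by (simp add: algebra_simps)
  qed
  also have "\<dots> = integral {0..2*pi} (\<lambda>t. cis t * ?\<Phi> t / (cis t - z) +
      cnj (cis t * cnj (?\<Phi> t) / (cis t - z)) - ?\<Phi> t) / (2 * pi)"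
    by (rule integral_divide)
  also have "integral {0..2*pi} (\<lambda>t. cis t * ?\<Phi> t / (cis t - z) + cnj (cis t * cnj (?\<Phi> t) / (cis t - z)) - ?\<Phi> t)
     = integral {0..2*pi} (\<lambda>t. cis t * ?\<Phi> t / (cis t - z)) + integral {0..2*pi} (\<lambda>t. cnj (cis t * cnj (?\<Phi> t) / (cis t - z)))
       - integral {0..2*pi} ?\<Phi>"
    by (simp only: integral_diff integral_add integrable_add i1 i2' i3)
  also have "integral {0..2*pi} (\<lambda>t. cnj (cis t * cnj (?\<Phi> t) / (cis t - z))) = cnj (integral {0..2*pi} (\<lambda>t. cis t * cnj (?\<Phi> t) / (cis t - z)))"
    by (rule Henstock_Kurzweil_Integration.integral_cnj [symmetric])
  finally show ?thesis
    by (simp add: cauchy_transform_def add_divide_distrib diff_divide_distrib)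
qed

lemma poisson_extension_polar:
  assumes cont: "continuous_on UNIV (\<lambda>t. F (cis t))" and r: "0 \<le> r" "r < 1"
  shows "poisson_extension F (rcis r \<tau>) =
      integral {-pi..pi} (\<lambda>s. of_real ((1 - r\<^sup>2) / (norm (cis s - of_real r))\<^sup>2) * F (cis (\<tau> + s))) / (2 * pi)"
proof -
  let ?z = "rcis r \<tau>"
  define u where "u t = of_real ((1 - r\<^sup>2) / (norm (cis t - ?z))\<^sup>2) * F (cis t) / (2 * pi)" for t
  have nz: "cis t - ?z \<noteq> 0" for t using r by (intro cis_minus_nonzero) simp
  have "poisson_extension F ?z = integral {0..2*pi} u"
    unfolding poisson_extension_def u_def poisson_kernel_eq using r
    by (intro integral_cong) (simp add: scaleR_conv_of_real field_simps)
  also have "\<dots> = integral {-pi..pi} (\<lambda>s. u (\<tau> + s))"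
  proof (rule integral_period_centered [symmetric])
    show "continuous_on UNIV u" unfolding u_def using nz cont
      by (intro continuous_intros) auto
    show "u (t + 2 * pi) = u t" for t by (simp add: u_def cis_add_2pi)
  qed
  also have "(\<lambda>s. u (\<tau> + s)) = (\<lambda>s. of_real ((1 - r\<^sup>2) / (norm (cis s - of_real r))\<^sup>2) * F (cis (\<tau> + s)) / (2 * pi))"
  proof
    fix s
    have "cis (\<tau> + s) - ?z = cis \<tau> * (cis s - of_real r)" by (simp add: cis_mult[symmetric] rcis_def algebra_simps)
    then have "norm (cis (\<tau> + s) - ?z) = norm (cis s - of_real r)" by (simp add: norm_mult)
    then show "u (\<tau> + s) = of_real ((1 - r\<^sup>2) / (norm (cis s - of_real r))\<^sup>2) * F (cis (\<tau> + s)) / (2 * pi)"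
      by (simp add: u_def)
  qed
  also have "integral {-pi..pi} \<dots> = integral {-pi..pi} (\<lambda>s. of_real ((1 - r\<^sup>2) / (norm (cis s - of_real r))\<^sup>2) * F (cis (\<tau> + s))) / (2 * pi)"
    by (rule integral_divide)
  finally show ?thesis .
qed

lemma integral_poisson_kernel:
  assumes r: "0 \<le> r" "r < 1"
  shows "integral {-pi..pi} (\<lambda>s. complex_of_real ((1 - r\<^sup>2) / (norm (cis s - of_real r))\<^sup>2)) = 2 * pi"
proof -
  have z: "norm (complex_of_real r) < 1" using r by simp
  have nz: "cis t - of_real r \<noteq> 0" for t by (rule cis_minus_nonzero[OF z])
  have i1: "(\<lambda>t. cis t / (cis t - of_real r)) integrable_on {-pi..pi}"
    using nz by (intro integrable_continuous_real continuous_intros) auto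
  define c where "c = complex_of_real (2 * pi)"
  have I1: "((\<lambda>t. cis t / (cis t - of_real r)) has_integral c) {-pi..pi}"
    using i1 integral_cis_full[OF r] by (simp add: has_integral_iff c_def)
  have I0: "((\<lambda>s. 1::complex) has_integral c) {-pi..pi}"
    using has_integral_const_real[of "1::complex" "-pi" pi] by (simp add: scaleR_conv_of_real c_def)
  have I2: "((\<lambda>t. cnj (cis t / (cis t - of_real r))) has_integral cnj c) {-pi..pi}"
    using iffD2[OF has_integral_cnj I1] by (simp add: o_def)
  have "((\<lambda>s. cis s / (cis s - of_real r) + cnj (cis s / (cis s - of_real r)) - 1) has_integral (c + cnj c - c)) {-pi..pi}"
    by (intro has_integral_diff has_integral_add I0 I1 I2)
  then have "((\<lambda>s. complex_of_real ((1 - r\<^sup>2) / (norm (cis s - of_real r))\<^sup>2)) has_integral 2 * pi) {-pi..pi}"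
    using poisson_kernel_split[OF z] r by (simp add: c_def)
  then show ?thesis by (rule integral_unique)
qed

text \<open>A comparison principle. The weight \<open>- Im (diff_kernel r s)\<close> has the sign of \<open>sin s\<close>, so near \<open>0\<close> a
function that lies beyond \<open>\<kappa> sin s\<close> on both sides contributes at least what \<open>\<kappa> sin s\<close> contributes, which
is \<open>\<kappa> r\<close> by the normalization. Away from \<open>0\<close> the weight is \<open>O(1 - r)\<close>.\<close>

lemma Im_diff_kernel_lower_bound:
  assumes r: "1/4 \<le> r" "r < 1" and cont: "continuous_on {-pi..pi} \<psi>" and \<delta>: "0 < \<delta>"
    and bound: "\<And>s. \<bar>s\<bar> \<le> pi \<Longrightarrow> \<bar>\<psi> s\<bar> \<le> K"
    and sign: "\<And>s. \<bar>s\<bar> \<le> \<delta> \<Longrightarrow> \<bar>s\<bar> \<le> pi \<Longrightarrow> 0 \<le> (\<psi> s - \<kappa> * sin s) * sin s"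
  shows "\<kappa> * r - 4 * (pi / \<delta>)^4 * (K + \<bar>\<kappa>\<bar>) * (1 - r)
           \<le> - Im (integral {-pi..pi} (\<lambda>s. diff_kernel r s * of_real (\<psi> s))) / (2 * pi)"
proof -
  define Q where "Q s = - Im (diff_kernel r s)" for s
  have Q: "Q s = 2 * r * (1 - r\<^sup>2) * sin s / (norm (cis s - of_real r))^4" for s
    using Im_diff_kernel[of r s] r by (simp add: Q_def)
  have contK: "continuous_on {-pi..pi} (diff_kernel r)" using r by (intro continuous_diff_kernel) auto
  have contQ: "continuous_on {-pi..pi} Q" unfolding Q_def by (intro continuous_intros contK)
  have Kint: "(\<lambda>s. diff_kernel r s * of_real (f s)) integrable_on {-pi..pi}" if "continuous_on {-pi..pi} f" for f
    by (intro integrable_continuous_real continuous_intros contK that)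
  have QI: "- Im (integral {-pi..pi} (\<lambda>s. diff_kernel r s * of_real (f s))) = integral {-pi..pi} (\<lambda>s. Q s * f s)"
    if "continuous_on {-pi..pi} f" for f
    using integral_linear[OF Kint[OF that] bounded_linear_Im] by (simp add: o_def Q_def)
  have "K \<ge> 0" using bound[of 0] by simp
  define \<epsilon> where "\<epsilon> = 4 * (pi / \<delta>)^4 * (K + \<bar>\<kappa>\<bar>) * (1 - r)"
  have \<epsilon>: "\<epsilon> \<ge> 0" using \<open>K \<ge> 0\<close> r by (simp add: \<epsilon>_def)
  have pt: "- \<epsilon> \<le> Q s * (\<psi> s - \<kappa> * sin s)" if s: "s \<in> {-pi..pi}" for s
  proof (cases "\<bar>s\<bar> \<le> \<delta>")
    case True
    have "0 \<le> 2 * r * (1 - r\<^sup>2) / (norm (cis s - of_real r))^4"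
      using r by (simp add: power_le_one)
    then have "0 \<le> 2 * r * (1 - r\<^sup>2) / (norm (cis s - of_real r))^4 * ((\<psi> s - \<kappa> * sin s) * sin s)"
      using sign[OF True] s by (intro mult_nonneg_nonneg[OF _ sign[OF True]]) auto
    also have "\<dots> = Q s * (\<psi> s - \<kappa> * sin s)" unfolding Q by simp
    finally show ?thesis using \<epsilon> by linarith
  next
    case False
    then have "\<delta> / pi \<le> \<bar>s\<bar> / pi" by (simp add: divide_right_mono)
    also have "\<dots> \<le> norm (cis s - of_real r)" using s r by (intro cis_minus_real_ge_arc) auto
    finally have d: "\<delta> / pi \<le> norm (cis s - of_real r)" .
    have "\<bar>Q s\<bar> = 2 * r * (1 - r\<^sup>2) * \<bar>sin s\<bar> / (norm (cis s - of_real r))^4"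
      unfolding Q using r by (simp add: abs_mult power_le_one)
    also have "\<dots> \<le> 4 * (1 - r) / (\<delta> / pi)^4"
    proof (rule frac_le)
      have "2 * r * (1 - r\<^sup>2) * \<bar>sin s\<bar> \<le> 2 * r * (1 - r\<^sup>2) * 1"
        using r by (intro mult_left_mono) (auto simp: power_le_one)
      also have "\<dots> = (2 * r * (1 + r)) * (1 - r)" by (simp add: power2_eq_square algebra_simps)
      also have "\<dots> \<le> 4 * (1 - r)"
      proof (intro mult_right_mono)
        have "r * (1 + r) \<le> 1 * 2" using r by (intro mult_mono) auto
        then show "2 * r * (1 + r) \<le> 4" by simp
      qed (use r in auto)
      finally show "2 * r * (1 - r\<^sup>2) * \<bar>sin s\<bar> \<le> 4 * (1 - r)" .
      show "(\<delta> / pi)^4 \<le> (norm (cis s - of_real r))^4" using d \<delta> by (intro power_mono) auto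
    qed (use \<delta> r in auto)
    also have "\<dots> = 4 * (pi / \<delta>)^4 * (1 - r)" using \<delta> by (simp add: power_divide field_simps)
    finally have q: "\<bar>Q s\<bar> \<le> 4 * (pi / \<delta>)^4 * (1 - r)" .
    have "\<bar>\<psi> s - \<kappa> * sin s\<bar> \<le> \<bar>\<psi> s\<bar> + \<bar>\<kappa>\<bar> * \<bar>sin s\<bar>" by (simp add: abs_mult[symmetric])
    also have "\<dots> \<le> K + \<bar>\<kappa>\<bar> * 1" using bound[of s] s by (intro add_mono mult_left_mono) auto
    finally have "\<bar>Q s * (\<psi> s - \<kappa> * sin s)\<bar> \<le> (4 * (pi / \<delta>)^4 * (1 - r)) * (K + \<bar>\<kappa>\<bar>)"
      unfolding abs_mult using q order_trans[OF abs_ge_zero q] by (intro mult_mono) auto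
    then show ?thesis unfolding \<epsilon>_def by (simp add: abs_le_iff mult_ac)
  qed
  have "- \<epsilon> * (2 * pi) = integral {-pi..pi} (\<lambda>s. - \<epsilon>)" by simp
  also have "\<dots> \<le> integral {-pi..pi} (\<lambda>s. Q s * (\<psi> s - \<kappa> * sin s))"
    by (intro integral_le pt integrable_continuous_real continuous_intros contQ cont) auto
  also have "\<dots> = integral {-pi..pi} (\<lambda>s. Q s * \<psi> s) - integral {-pi..pi} (\<lambda>s. \<kappa> * (Q s * sin s))"
    by (subst integral_diff[symmetric]) (auto intro!: integrable_continuous_real continuous_intros contQ cont simp: algebra_simps)
  also have "integral {-pi..pi} (\<lambda>s. \<kappa> * (Q s * sin s)) = \<kappa> * integral {-pi..pi} (\<lambda>s. Q s * sin s)"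
    by simp
  also have "integral {-pi..pi} (\<lambda>s. Q s * sin s) = 2 * pi * r"
    using QI[of sin] integral_diff_kernel_sin[of r] r by (simp add: continuous_on_sin)
  also have "integral {-pi..pi} (\<lambda>s. Q s * \<psi> s) = - Im (integral {-pi..pi} (\<lambda>s. diff_kernel r s * of_real (\<psi> s)))"
    using QI[OF cont] by simp
  finally have "(\<kappa> * r - \<epsilon>) * (2 * pi) \<le> - Im (integral {-pi..pi} (\<lambda>s. diff_kernel r s * of_real (\<psi> s)))"
    by (simp add: algebra_simps)
  then have "\<kappa> * r - \<epsilon> \<le> - Im (integral {-pi..pi} (\<lambda>s. diff_kernel r s * of_real (\<psi> s))) / (2 * pi)"
    by (subst pos_le_divide_eq) auto
  then show ?thesis by (simp add: \<epsilon>_def)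
qed

section \<open>The tangent of a smooth Jordan curve\<close>

lemma norm_diff_le_vector_derivative:
  fixes f :: "real \<Rightarrow> 'a::real_normed_vector"
  assumes "convex S" and f: "\<And>x. x \<in> S \<Longrightarrow> (f has_vector_derivative f' x) (at x)"
    and B: "\<And>x. x \<in> S \<Longrightarrow> norm (f' x) \<le> B" and "a \<in> S" "b \<in> S"
  shows "norm (f b - f a) \<le> B * \<bar>b - a\<bar>"
proof -
  have "norm (f b - f a) \<le> B * norm (b - a)"
  proof (rule differentiable_bound[OF \<open>convex S\<close> _ _ \<open>b \<in> S\<close> \<open>a \<in> S\<close>])
    show "(f has_derivative (\<lambda>h. h *\<^sub>R f' x)) (at x within S)" if "x \<in> S" for x
      using f[OF that] by (auto simp: has_vector_derivative_def intro: has_derivative_at_withinI)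
    show "onorm (\<lambda>h. h *\<^sub>R f' x) \<le> B" if "x \<in> S" for x
    proof (rule onorm_bound)
      show "0 \<le> B" using B[OF that] norm_ge_zero order_trans by blast
      show "norm (h *\<^sub>R f' x) \<le> B * norm h" for h
        using mult_right_mono[OF B[OF that], of "norm h"] by (simp add: mult.commute)
    qed
  qed
  then show ?thesis by simp
qed

lemma vector_derivative_affine:
  fixes g :: "real \<Rightarrow> 'a::real_normed_vector"
  assumes "(g has_vector_derivative v) (at (a + x * d))"
  shows "((\<lambda>x. g (a + x * d)) has_vector_derivative d *\<^sub>R v) (at x)"
proof -
  have "((\<lambda>x. a + x * d) has_vector_derivative d) (at x)"
    by (auto simp: has_real_derivative_iff_has_vector_derivative[symmetric] intro!: derivative_eq_intros)
  from vector_diff_chain_at[OF this assms] show ?thesis by (simp add: o_def)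
qed

text \<open>Two continuous logarithms of the same function on a connected set differ by a constant, because the
kernel of \<open>exp\<close> is discrete.\<close>

lemma continuous_constant_exp:
  assumes "connected S" "continuous_on S f" and c: "\<And>x. x \<in> S \<Longrightarrow> exp (f x) = exp c"
  shows "\<exists>n::int. \<forall>x\<in>S. f x = c + 2 * pi * n * \<i>"
proof (cases "S = {}")
  case False
  have "\<exists>n::int. f x = c + (of_int (2 * n) * pi) * \<i>" if "x \<in> S" for x
    using c[OF that] unfolding exp_eq by blast
  then obtain n :: "_ \<Rightarrow> int" where n: "\<And>x. x \<in> S \<Longrightarrow> f x = c + (of_int (2 * n x) * pi) * \<i>" by metis
  have "f constant_on S"
  proof (rule continuous_discrete_range_constant [OF assms(1,2)])
    fix x assume x: "x \<in> S"
    show "\<exists>e>0. \<forall>y. y \<in> S \<and> f y \<noteq> f x \<longrightarrow> e \<le> norm (f y - f x)"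
    proof (intro exI[of _ "2 * pi"] conjI allI impI)
      fix y assume y: "y \<in> S \<and> f y \<noteq> f x"
      then have ne: "n y \<noteq> n x" using n x by auto
      have "f y - f x = of_real (2 * pi * (n y - n x)) * \<i>"
        using n x y by (simp add: algebra_simps)
      then have "norm (f y - f x) = 2 * pi * \<bar>real_of_int (n y - n x)\<bar>"
        by (simp add: norm_mult abs_mult del: of_int_diff)
      moreover have "1 \<le> \<bar>real_of_int (n y - n x)\<bar>" using ne by linarith
      ultimately show "2 * pi \<le> norm (f y - f x)" by simp
    qed simp
  qed
  then obtain a where "\<And>x. x \<in> S \<Longrightarrow> f x = a" unfolding constant_on_def by blast
  moreover obtain x0 where "x0 \<in> S" using False by blast
  ultimately have "\<forall>x\<in>S. f x = c + 2 * pi * n x0 * \<i>" using n[of x0] by auto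
  then show ?thesis by blast
qed simp

text \<open>The curve is carried by its periodic arc length parametrization \<open>g\<close> on the whole line; \<open>inj\<close> says that it
is simple in a form that does not depend on the choice of a base point.\<close>

locale smooth_jordan_curve =
  fixes g g' :: "real \<Rightarrow> complex" and l \<alpha> H :: real
  assumes l_pos: "0 < l" and \<alpha>_pos: "0 < \<alpha>" and \<alpha>_le: "\<alpha> \<le> 1" and H_nonneg: "0 \<le> H"
    and per: "\<And>s. g (s + l) = g s"
    and der: "\<And>s. (g has_vector_derivative g' s) (at s)"
    and unit: "\<And>s. norm (g' s) = 1"
    and holder: "\<And>s t. norm (g' t - g' s) \<le> H * \<bar>t - s\<bar> powr \<alpha>"
    and inj: "\<And>s t. s < t \<Longrightarrow> t < s + l \<Longrightarrow> g s \<noteq> g t"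
begin

lemma per': "g' (s + l) = g' s"
proof -
  have "((\<lambda>x. g (x + l)) has_vector_derivative g' (s + l)) (at s)"
    using vector_derivative_affine[of g "g' (s + l)" l s 1] der[of "s + l"] by (simp add: add.commute)
  then have "(g has_vector_derivative g' (s + l)) (at s)" by (simp add: per)
  then show ?thesis using der vector_derivative_unique_at by blast
qed

lemma continuous_g: "continuous_on A g"
  using der by (meson continuous_at_imp_continuous_on has_vector_derivative_continuous)

lemma continuous_g': "continuous_on UNIV g'"
proof -
  have "isCont g' s" for s
  proof -
    have "((\<lambda>t. H * \<bar>t - s\<bar> powr \<alpha>) \<longlongrightarrow> H * \<bar>s - s\<bar> powr \<alpha>) (at s)"
      using \<alpha>_pos by (intro tendsto_intros) auto
    then have "((\<lambda>t. H * \<bar>t - s\<bar> powr \<alpha>) \<longlongrightarrow> 0) (at s)" by simp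
    then have "((\<lambda>t. g' t - g' s) \<longlongrightarrow> 0) (at s)"
      by (rule Lim_null_comparison[rotated]) (use holder in auto)
    then show ?thesis by (simp add: isCont_def LIM_zero_iff)
  qed
  then show ?thesis by (simp add: continuous_at_imp_continuous_on)
qed

lemma g_lipschitz: "norm (g b - g a) \<le> \<bar>b - a\<bar>"
  using norm_diff_le_vector_derivative[of UNIV g g' 1 a b] der unit by simp

lemma g_taylor: "norm (g b - g a - (b - a) *\<^sub>R g' a) \<le> H * \<bar>b - a\<bar> powr (1 + \<alpha>)"
proof -
  let ?k = "\<lambda>x. g x - x *\<^sub>R g' a"
  have "norm (?k b - ?k a) \<le> (H * \<bar>b - a\<bar> powr \<alpha>) * \<bar>b - a\<bar>"
  proof (rule norm_diff_le_vector_derivative[of "closed_segment a b" ?k "\<lambda>x. g' x - g' a"])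
    fix x assume x: "x \<in> closed_segment a b"
    show "(?k has_vector_derivative g' x - g' a) (at x)"
      by (auto intro!: derivative_eq_intros der)
    have "\<bar>x - a\<bar> \<le> \<bar>b - a\<bar>" using x by (auto simp: closed_segment_eq_real_ivl split: if_splits)
    then have "H * \<bar>x - a\<bar> powr \<alpha> \<le> H * \<bar>b - a\<bar> powr \<alpha>"
      using \<alpha>_pos H_nonneg by (intro mult_left_mono powr_mono2) auto
    then show "norm (g' x - g' a) \<le> H * \<bar>b - a\<bar> powr \<alpha>" using holder[of x a] by linarith
  qed auto
  also have "(H * \<bar>b - a\<bar> powr \<alpha>) * \<bar>b - a\<bar> = H * \<bar>b - a\<bar> powr (1 + \<alpha>)"
    by (cases "b = a") (simp_all add: powr_add)
  finally show ?thesis by (simp add: algebra_simps)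
qed

text \<open>Hopf's theorem that the tangent of a simple closed curve turns exactly once. The function
\<open>q(s, d)\<close> is the secant \<open>(g(s+d) - g(s)) / d\<close>, continuously extended by \<open>g'(s)\<close> at \<open>d = 0\<close>. On the strip
\<open>0 \<le> d \<le> l\<close>, \<open>R(s, d)\<close> is a positive multiple of the chord \<open>g(s+d) - g(s)\<close> in the interior, by
simplicity not zero, and it is \<open>g'(s)\<close> and \<open>- g'(s)\<close> on the two edges. The symmetry
\<open>R(s+d, l-d) = - R(s, d)\<close> makes the argument of \<open>R(s, d)\<close> grow by the same odd multiple of \<open>\<pi>\<close> from
\<open>(s, 0)\<close> to \<open>(s, l)\<close> and from there to \<open>(s+l, 0)\<close>. At a lowest point of the curve all chords point into
the closed upper half plane, so there the growth is at most \<open>\<pi>\<close> in absolute value.\<close>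

lemma umlaufsatz:
  obtains A :: "real \<Rightarrow> complex" and k :: int where "continuous_on UNIV A" "\<And>s. g' s = exp (A s)"
    "\<And>s. A (s + l) = A s + 2 * pi * k * \<i>" "k = 1 \<or> k = -1"
proof -
  define q where "q p = integral {0..1} (\<lambda>x. g' (fst p + x * snd p))" for p :: "real \<times> real"
  have dq: "d *\<^sub>R q (s, d) = g (s + d) - g s" for s d
  proof -
    have "((\<lambda>x. d *\<^sub>R g' (s + x * d)) has_integral g (s + 1 * d) - g (s + 0 * d)) {0..1}"
    proof (rule fundamental_theorem_of_calculus)
      fix x :: real
      have "((\<lambda>x. g (s + x * d)) has_vector_derivative d *\<^sub>R g' (s + x * d)) (at x)"
        by (rule vector_derivative_affine [OF der])
      then show "((\<lambda>x. g (s + x * d)) has_vector_derivative d *\<^sub>R g' (s + x * d)) (at x within {0..1})"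
        by (rule has_vector_derivative_at_within)
    qed simp
    from integral_unique[OF this] show ?thesis by (simp add: q_def)
  qed
  have contq: "continuous_on UNIV q"
  proof -
    have "continuous_on (UNIV \<times> cbox 0 1) (\<lambda>(p, x). g' (fst p + x * snd p))"
      unfolding split_beta
      by (rule continuous_on_compose2 [OF continuous_g']) (auto intro!: continuous_intros)
    then have "continuous_on UNIV (\<lambda>p. integral (cbox 0 1) (\<lambda>x. g' (fst p + x * snd p)))"
      by (rule integral_continuous_on_param)
    then show ?thesis unfolding q_def by simp
  qed
  have q0: "q (s, 0) = g' s" for s by (simp add: q_def)
  have ql: "q (s, l) = 0" for s using dq[of l s] l_pos by (simp add: per)
  define R where "R p = q p - q (fst p + snd p, l - snd p)" for p
  have contR: "continuous_on A R" for A
    unfolding R_def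
    by (intro continuous_intros continuous_on_compose2 [OF contq]) (auto intro!: continuous_intros)
  have R0: "R (s, 0) = g' s" for s by (simp add: R_def q0 ql)
  have Rl: "R (s, l) = - g' s" for s by (simp add: R_def q0 ql per')
  have Rsym: "R (s + d, l - d) = - R (s, d)" for s d
  proof -
    have "q (s + l, d) = q (s, d)"
    proof (cases "d = 0")
      case True
      then show ?thesis by (simp add: q0 per')
    next
      case False
      have "d *\<^sub>R q (s + l, d) = d *\<^sub>R q (s, d)"
        unfolding dq using per[of "s + d"] per[of s] by (simp add: add_ac)
      then show ?thesis using False by simp
    qed
    then show ?thesis by (simp add: R_def algebra_simps)
  qed
  have Rmid: "(d * (l - d)) *\<^sub>R R (s, d) = l *\<^sub>R (g (s + d) - g s)" for s d
  proof -
    have "(l - d) *\<^sub>R q (s + d, l - d) = g (s + l) - g (s + d)" using dq[of "l - d" "s + d"] by (simp add: algebra_simps)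
    moreover have "(d * (l - d)) *\<^sub>R R (s, d) = (l - d) *\<^sub>R (d *\<^sub>R q (s, d)) - d *\<^sub>R ((l - d) *\<^sub>R q (s + d, l - d))"
      by (simp add: R_def scaleR_diff_right mult.commute)
    ultimately show ?thesis unfolding dq per by (simp add: algebra_simps)
  qed
  define S where "S = (UNIV :: real set) \<times> {0..l}"
  have Snz: "R p \<noteq> 0" if "p \<in> S" for p
  proof -
    obtain s d where p: "p = (s, d)" "0 \<le> d" "d \<le> l" using \<open>p \<in> S\<close> by (auto simp: S_def)
    consider "d = 0" | "d = l" | "0 < d" "d < l" using p by linarith
    then show ?thesis
    proof cases
      case 1
      then have "norm (R p) = 1" by (simp add: p R0 unit)
      then show ?thesis by auto
    next
      case 2
      then have "norm (R p) = 1" by (simp add: p Rl unit)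
      then show ?thesis by auto
    next
      case 3
      then have "g (s + d) - g s \<noteq> 0" using inj[of s "s + d"] by auto
      then show ?thesis using Rmid[of d s] l_pos p(1) by auto
    qed
  qed
  have convS: "convex S" unfolding S_def by (intro convex_Times) auto
  obtain L where L: "continuous_on S L" "\<And>p. p \<in> S \<Longrightarrow> R p = exp (L p)"
    using continuous_logarithm_on_contractible[OF contR convex_imp_contractible[OF convS] Snz] by blast
  have connS: "connected S" by (rule convex_connected[OF convS])
  have "\<exists>m::int. \<forall>p\<in>S. L (fst p + snd p, l - snd p) - L p = \<i> * pi + 2 * pi * m * \<i>"
  proof (rule continuous_constant_exp [OF connS])
    show "continuous_on S (\<lambda>p. L (fst p + snd p, l - snd p) - L p)"
      by (intro continuous_intros continuous_on_compose2 [OF L(1)] L(1)) (auto simp: S_def intro!: continuous_intros)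
    fix p assume p: "p \<in> S"
    then have p': "(fst p + snd p, l - snd p) \<in> S" by (auto simp: S_def)
    have "exp (L (fst p + snd p, l - snd p) - L p) = R (fst p + snd p, l - snd p) / R p"
      using L(2)[OF p] L(2)[OF p'] by (simp add: exp_diff)
    also have "\<dots> = -1" using Rsym[of "fst p" "snd p"] Snz[OF p] by simp
    finally show "exp (L (fst p + snd p, l - snd p) - L p) = exp (\<i> * pi)" by (simp add: mult.commute)
  qed
  then obtain m :: int where m: "\<And>p. p \<in> S \<Longrightarrow> L (fst p + snd p, l - snd p) - L p = \<i> * pi + 2 * pi * m * \<i>" by blast
  have m0: "L (s, l) - L (s, 0) = \<i> * pi + 2 * pi * m * \<i>" for s
    using m[of "(s, 0)"] l_pos by (simp add: S_def)
  have ml: "L (s + l, 0) - L (s, l) = \<i> * pi + 2 * pi * m * \<i>" for s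
    using m[of "(s, l)"] l_pos by (simp add: S_def)
  have "\<exists>x\<in>{0..l}. \<forall>y\<in>{0..l}. Im (g x) \<le> Im (g y)"
    using l_pos by (intro continuous_attains_inf) (auto intro!: continuous_intros continuous_g)
  then obtain s0 where s0: "s0 \<in> {0..l}" "\<And>s. s \<in> {0..l} \<Longrightarrow> Im (g s0) \<le> Im (g s)" by blast
  have low: "Im (g s0) \<le> Im (g (s0 + d))" if "0 \<le> d" "d \<le> l" for d
  proof (cases "s0 + d \<le> l")
    case False
    then show ?thesis using s0(2)[of "s0 + d - l"] s0(1) that per[of "s0 + d - l"] by auto
  qed (use s0 that in auto)
  have cR: "continuous_on A (\<lambda>d. R (s0, d))" for A
    by (rule continuous_on_compose2 [OF contR[of UNIV], where f = "\<lambda>d. (s0, d)"]) (auto intro!: continuous_intros)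
  have ImR: "0 \<le> Im (R (s0, d))" if "d \<in> {0..l}" for d
  proof -
    have "d \<in> closure {0<..<l}" using that l_pos by simp
    then show ?thesis
    proof (rule continuous_ge_on_closure[rotated])
      show "continuous_on (closure {0<..<l}) (\<lambda>d. Im (R (s0, d)))"
        by (intro continuous_intros cR)
      fix d assume d: "d \<in> {0<..<l}"
      have "d * (l - d) * Im (R (s0, d)) = l * (Im (g (s0 + d)) - Im (g s0))"
        using arg_cong[OF Rmid[of d s0], of Im] by simp
      also have "\<dots> \<ge> 0" using low[of d] d l_pos by simp
      finally have "0 \<le> d * (l - d) * Im (R (s0, d))" .
      moreover have "0 < d * (l - d)" using d by simp
      ultimately show "0 \<le> Im (R (s0, d))" by (metis zero_le_mult_iff not_le)
    qed
  qed
  \<comment> \<open>After division by \<open>\<i>\<close> the chords from the lowest point lie in the closed right half plane,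
where the principal logarithm is continuous and has imaginary part at most \<open>\<pi>/2\<close> in absolute value.\<close>
  define P where "P d = Ln (- \<i> * R (s0, d))" for d
  have nn: "- \<i> * R (s0, d) \<notin> \<real>\<^sub>\<le>\<^sub>0" "- \<i> * R (s0, d) \<noteq> 0" "0 \<le> Re (- \<i> * R (s0, d))" if "d \<in> {0..l}" for d
    using ImR[OF that] Snz[of "(s0, d)"] that by (auto simp: complex_nonpos_Reals_iff S_def complex_eq_iff)
  have "\<exists>n::int. \<forall>d\<in>{0..l}. L (s0, d) - P d = \<i> * (pi/2) + 2 * pi * n * \<i>"
  proof (rule continuous_constant_exp)
    have "continuous_on {0..l} (\<lambda>d. - \<i> * R (s0, d))"
      by (intro continuous_intros cR)
    then have cP: "continuous_on {0..l} P" unfolding P_def by (rule continuous_on_Ln') (use nn(1) in blast)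
    have "continuous_on {0..l} (\<lambda>d. L (s0, d))"
      by (rule continuous_on_compose2 [OF L(1), where f = "\<lambda>d. (s0, d)"]) (auto simp: S_def intro!: continuous_intros)
    with cP show "continuous_on {0..l} (\<lambda>d. L (s0, d) - P d)" by (intro continuous_intros)
    fix d assume d: "d \<in> {0..l}"
    have "exp (L (s0, d) - P d) = R (s0, d) / (- \<i> * R (s0, d))"
      unfolding exp_diff P_def using L(2)[of "(s0, d)"] nn(2)[OF d] d by (simp add: S_def)
    also have "\<dots> = \<i>" using nn(2)[OF d] by (simp add: field_simps)
    also have "\<i> = exp (\<i> * (pi/2))" using cis_conv_exp[of "pi/2"] cis_pi_half by simp
    finally show "exp (L (s0, d) - P d) = exp (\<i> * (pi/2))" .
  qed simp
  then obtain n :: int where n: "\<And>d. d \<in> {0..l} \<Longrightarrow> L (s0, d) - P d = \<i> * (pi/2) + 2 * pi * n * \<i>" by blast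
  have "L (s0, l) - L (s0, 0) = P l - P 0" using n[of 0] n[of l] l_pos by (simp add: algebra_simps)
  then have "P l - P 0 = \<i> * pi + 2 * pi * m * \<i>" using m0[of s0] by simp
  then have "Im (P l) - Im (P 0) = pi * real_of_int (2 * m + 1)" by (simp add: complex_eq_iff algebra_simps)
  moreover have "\<bar>Im (P 0)\<bar> \<le> pi/2" "\<bar>Im (P l)\<bar> \<le> pi/2"
    unfolding P_def using l_pos by (intro iffD2[OF Re_Ln_pos_le] nn; simp)+
  ultimately have "\<bar>pi * real_of_int (2 * m + 1)\<bar> \<le> pi * 1" by linarith
  then have "\<bar>real_of_int (2 * m + 1)\<bar> \<le> 1" unfolding abs_mult by (simp del: of_int_add of_int_mult)
  then have "\<bar>2 * m + 1\<bar> \<le> 1" by (metis of_int_abs of_int_le_1_iff)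
  then have k: "2 * m + 1 = 1 \<or> 2 * m + 1 = -1" by presburger
  have "L (s + l, 0) = L (s, 0) + 2 * pi * (2 * m + 1) * \<i>" for s
    using m0[of s] ml[of s] by (simp add: algebra_simps)
  moreover have "continuous_on UNIV (\<lambda>s. L (s, 0))"
    by (rule continuous_on_compose2 [OF L(1)]) (use l_pos in \<open>auto simp: S_def intro!: continuous_intros\<close>)
  moreover have "g' s = exp (L (s, 0))" for s using L(2)[of "(s, 0)"] R0 l_pos by (simp add: S_def)
  ultimately show thesis using that[of "\<lambda>s. L (s, 0)" "2 * m + 1"] k by simp
qed

end

section \<open>Boundary behaviour of directional gradients\<close>

context smooth_jordan_curve
begin

text \<open>The angle functions \<open>\<phi>\<close> for which \<open>t \<mapsto> g (\<phi> t)\<close> runs once, weakly monotonically, around the curve;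
they are defined on the whole line.\<close>

definition boundary_lift :: "real \<Rightarrow> (real \<Rightarrow> real) \<Rightarrow> bool" where
  "boundary_lift M \<phi> \<longleftrightarrow> mono \<phi> \<and> (\<forall>s t. \<bar>\<phi> t - \<phi> s\<bar> \<le> M * \<bar>t - s\<bar>) \<and> (\<forall>t. \<phi> (t + 2 * pi) = \<phi> t + l)"

text \<open>This is \<open>2 \<partial>\<^sub>z\<close> of the real harmonic function \<open>w \<bullet> e\<close>, where \<open>w\<close> is the Poisson extension of \<open>g \<circ> \<phi>\<close>.\<close>

definition directional_gradient :: "(real \<Rightarrow> real) \<Rightarrow> complex \<Rightarrow> complex \<Rightarrow> complex" where
  "directional_gradient \<phi> e z =
     cnj e * cauchy_transform_deriv (\<lambda>t. g (\<phi> t)) z + e * cauchy_transform_deriv (\<lambda>t. cnj (g (\<phi> t))) z"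

definition increment :: "(real \<Rightarrow> real) \<Rightarrow> complex \<Rightarrow> real \<Rightarrow> real \<Rightarrow> real" where
  "increment \<phi> e \<tau> s = (g (\<phi> (\<tau> + s)) - g (\<phi> \<tau>)) \<bullet> e"

text \<open>The inward derivative of \<open>w \<bullet> (\<i> g'(\<phi> \<tau>))\<close> at the boundary point \<open>cis \<tau>\<close>. It is the candidate for the
continuous extension of \<open>J\<^sub>w / |F'|\<close>.\<close>

definition normal_deriv :: "(real \<Rightarrow> real) \<Rightarrow> real \<Rightarrow> real" where
  "normal_deriv \<phi> \<tau> = integral {-pi..pi} (\<lambda>s. normal_kernel s * increment \<phi> (\<i> * g' (\<phi> \<tau>)) \<tau> s) / (2 * pi)"

lemma boundary_liftD:
  assumes "boundary_lift M \<phi>"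
  shows "mono \<phi>" "\<bar>\<phi> t - \<phi> s\<bar> \<le> M * \<bar>t - s\<bar>" "\<phi> (t + 2 * pi) = \<phi> t + l" "0 \<le> M" "continuous_on A \<phi>"
proof -
  show *: "mono \<phi>" "\<bar>\<phi> t - \<phi> s\<bar> \<le> M * \<bar>t - s\<bar>" "\<phi> (t + 2 * pi) = \<phi> t + l" for t s
    using assms by (auto simp: boundary_lift_def)
  show M: "0 \<le> M" using *(2)[of 1 0] by simp
  have "M-lipschitz_on UNIV \<phi>" using M *(2) by (intro lipschitz_onI) (auto simp: dist_real_def)
  then show "continuous_on A \<phi>" using lipschitz_on_continuous_on continuous_on_subset by blast
qed

lemma continuous_boundary_values:
  assumes "boundary_lift M \<phi>" shows "continuous_on A (\<lambda>t. g (\<phi> t))"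
  by (rule continuous_on_compose2 [OF continuous_g boundary_liftD(5)[OF assms] subset_UNIV])

lemma boundary_values_periodic:
  assumes "boundary_lift M \<phi>" shows "g (\<phi> (t + 2 * pi)) = g (\<phi> t)"
  using boundary_liftD(3)[OF assms] per by simp

lemma continuous_increment: "boundary_lift M \<phi> \<Longrightarrow> continuous_on A (increment \<phi> e \<tau>)"
  unfolding increment_def
  by (intro continuous_intros continuous_on_compose2 [OF continuous_boundary_values[of M \<phi> UNIV]]) auto

lemma directional_gradient_polar:
  assumes \<phi>: "boundary_lift M \<phi>" and r: "0 \<le> r" "r < 1"
  shows "rcis r \<tau> * directional_gradient \<phi> e (rcis r \<tau>)
           = integral {-pi..pi} (\<lambda>s. diff_kernel r s * of_real (increment \<phi> e \<tau> s)) / (2 * pi)"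
proof -
  let ?z = "rcis r \<tau>" and ?\<Phi> = "\<lambda>t. g (\<phi> t)"
  have cK: "continuous_on {-pi..pi} (diff_kernel r)" using r by (intro continuous_diff_kernel) auto
  have c\<Phi>: "continuous_on {-pi..pi} (\<lambda>s. ?\<Phi> (\<tau> + s))"
    by (intro continuous_on_compose2 [OF continuous_boundary_values[OF \<phi>, of UNIV]] continuous_intros) auto
  have i1: "(\<lambda>s. diff_kernel r s * ?\<Phi> (\<tau> + s)) integrable_on {-pi..pi}"
    "(\<lambda>s. diff_kernel r s * cnj (?\<Phi> (\<tau> + s))) integrable_on {-pi..pi}"
    "diff_kernel r integrable_on {-pi..pi}"
    by (intro integrable_continuous_real continuous_intros cK c\<Phi>)+
  let ?I1 = "integral {-pi..pi} (\<lambda>s. diff_kernel r s * ?\<Phi> (\<tau> + s))"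
  let ?I2 = "integral {-pi..pi} (\<lambda>s. diff_kernel r s * cnj (?\<Phi> (\<tau> + s)))"
  have h1: "2 * ?z * cauchy_transform_deriv ?\<Phi> ?z = ?I1 / (2 * pi)"
    by (rule cauchy_transform_deriv_polar [OF continuous_boundary_values[OF \<phi>] boundary_values_periodic[OF \<phi>] r])
  have h2: "2 * ?z * cauchy_transform_deriv (\<lambda>t. cnj (?\<Phi> t)) ?z = ?I2 / (2 * pi)"
    by (rule cauchy_transform_deriv_polar [OF _ _ r])
       (auto intro!: continuous_intros continuous_boundary_values[OF \<phi>] simp: boundary_values_periodic[OF \<phi>])
  have in2: "2 * complex_of_real (x \<bullet> e) = cnj e * x + e * cnj x" for x
    by (simp add: inner_complex_def complex_eq_iff algebra_simps)
  have "((\<lambda>s. (cnj e * (diff_kernel r s * ?\<Phi> (\<tau> + s)) + e * (diff_kernel r s * cnj (?\<Phi> (\<tau> + s))))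
        - 2 * of_real (?\<Phi> \<tau> \<bullet> e) * diff_kernel r s) has_integral (cnj e * ?I1 + e * ?I2) - 2 * of_real (?\<Phi> \<tau> \<bullet> e) * 0) {-pi..pi}"
    using i1 integral_diff_kernel[OF r]
    by (intro has_integral_diff has_integral_add has_integral_mult_right) (auto simp: has_integral_iff)
  moreover have "(cnj e * (diff_kernel r s * ?\<Phi> (\<tau> + s)) + e * (diff_kernel r s * cnj (?\<Phi> (\<tau> + s))))
        - 2 * of_real (?\<Phi> \<tau> \<bullet> e) * diff_kernel r s = 2 * (diff_kernel r s * of_real (increment \<phi> e \<tau> s))" for s
  proof -
    have "2 * complex_of_real (increment \<phi> e \<tau> s) = (cnj e * ?\<Phi> (\<tau> + s) + e * cnj (?\<Phi> (\<tau> + s))) - 2 * of_real (?\<Phi> \<tau> \<bullet> e)"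
      using in2[of "?\<Phi> (\<tau> + s)"] by (simp add: increment_def inner_diff_left algebra_simps)
    then have "2 * (diff_kernel r s * of_real (increment \<phi> e \<tau> s)) = diff_kernel r s * ((cnj e * ?\<Phi> (\<tau> + s) + e * cnj (?\<Phi> (\<tau> + s))) - 2 * of_real (?\<Phi> \<tau> \<bullet> e))"
      by (metis mult.left_commute)
    then show ?thesis by (simp add: algebra_simps)
  qed
  ultimately have "((\<lambda>s. 2 * (diff_kernel r s * of_real (increment \<phi> e \<tau> s))) has_integral cnj e * ?I1 + e * ?I2) {-pi..pi}"
    by simp
  from integral_unique[OF this] have "2 * integral {-pi..pi} (\<lambda>s. diff_kernel r s * of_real (increment \<phi> e \<tau> s)) = cnj e * ?I1 + e * ?I2"
    by simp
  moreover have "2 * (?z * directional_gradient \<phi> e ?z) = (cnj e * ?I1 + e * ?I2) / (2 * pi)"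
    unfolding add_divide_distrib times_divide_eq_right[symmetric] h1[symmetric] h2[symmetric]
    by (simp add: directional_gradient_def algebra_simps)
  ultimately have "2 * (?z * directional_gradient \<phi> e ?z) = 2 * (integral {-pi..pi} (\<lambda>s. diff_kernel r s * of_real (increment \<phi> e \<tau> s)) / (2 * pi))"
    by simp
  then show ?thesis by (simp only: mult_cancel_left) simp
qed

lemma abs_increment_le:
  assumes \<phi>: "boundary_lift M \<phi>" and e: "norm e = 1"
  shows "\<bar>increment \<phi> e \<tau> s\<bar> \<le> M * \<bar>s\<bar>"
proof -
  have "\<bar>increment \<phi> e \<tau> s\<bar> \<le> norm (g (\<phi> (\<tau> + s)) - g (\<phi> \<tau>)) * norm e"
    unfolding increment_def by (rule Cauchy_Schwarz_ineq2)
  also have "\<dots> \<le> \<bar>\<phi> (\<tau> + s) - \<phi> \<tau>\<bar>" using g_lipschitz e by simp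
  also have "\<dots> \<le> M * \<bar>s\<bar>" using boundary_liftD(2)[OF \<phi>, of "\<tau> + s" \<tau>] by simp
  finally show ?thesis .
qed

text \<open>The tangential part of the Taylor expansion of \<open>g\<close> is orthogonal to the normal, which leaves the
remainder of order \<open>1 + \<alpha>\<close>.\<close>

lemma abs_increment_normal_le:
  assumes \<phi>: "boundary_lift M \<phi>"
  shows "\<bar>increment \<phi> (\<i> * g' (\<phi> \<tau>)) \<tau> s\<bar> \<le> (H * M powr (1 + \<alpha>)) * \<bar>s\<bar> powr (1 + \<alpha>)"
proof -
  let ?b = "\<phi> (\<tau> + s)" and ?a = "\<phi> \<tau>"
  have "g' ?a \<bullet> (\<i> * g' ?a) = 0" by (simp add: inner_complex_def)
  then have "increment \<phi> (\<i> * g' (\<phi> \<tau>)) \<tau> s = (g ?b - g ?a - (?b - ?a) *\<^sub>R g' ?a) \<bullet> (\<i> * g' ?a)"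
    by (simp add: increment_def inner_diff_left)
  also have "\<bar>\<dots>\<bar> \<le> norm (g ?b - g ?a - (?b - ?a) *\<^sub>R g' ?a) * norm (\<i> * g' ?a)"
    by (rule Cauchy_Schwarz_ineq2)
  also have "\<dots> \<le> H * \<bar>?b - ?a\<bar> powr (1 + \<alpha>)" using g_taylor by (simp add: norm_mult unit)
  also have "\<dots> \<le> H * (M * \<bar>s\<bar>) powr (1 + \<alpha>)"
    using boundary_liftD(2)[OF \<phi>, of "\<tau> + s" \<tau>] \<alpha>_pos H_nonneg by (intro mult_left_mono powr_mono2) auto
  also have "\<dots> = (H * M powr (1 + \<alpha>)) * \<bar>s\<bar> powr (1 + \<alpha>)"
    using boundary_liftD(4)[OF \<phi>] by (simp add: powr_mult)
  finally show ?thesis .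
qed

lemma increment_tangential:
  assumes \<phi>: "boundary_lift M \<phi>"
  shows "\<bar>increment \<phi> (g' (\<phi> \<tau>)) \<tau> s - (\<phi> (\<tau> + s) - \<phi> \<tau>)\<bar> \<le> H * \<bar>\<phi> (\<tau> + s) - \<phi> \<tau>\<bar> powr (1 + \<alpha>)"
proof -
  let ?b = "\<phi> (\<tau> + s)" and ?a = "\<phi> \<tau>"
  have "g' ?a \<bullet> g' ?a = 1" using unit[of ?a] by (simp add: norm_eq_1)
  then have "increment \<phi> (g' (\<phi> \<tau>)) \<tau> s - (?b - ?a) = (g ?b - g ?a - (?b - ?a) *\<^sub>R g' ?a) \<bullet> g' ?a"
    by (simp add: increment_def inner_diff_left)
  also have "\<bar>\<dots>\<bar> \<le> norm (g ?b - g ?a - (?b - ?a) *\<^sub>R g' ?a) * norm (g' ?a)"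
    by (rule Cauchy_Schwarz_ineq2)
  also have "\<dots> \<le> H * \<bar>?b - ?a\<bar> powr (1 + \<alpha>)" using g_taylor by (simp add: unit)
  finally show ?thesis .
qed

text \<open>In the normal direction the increment is \<open>O(|s|\<^sup>1\<^sup>+\<^sup>\<alpha>)\<close>, so the limit exists, and it is real because
the limiting kernel is. The constant depends on the lift only through \<open>M\<close>; this is what later allows the lift
to be perturbed.\<close>

lemma normal_gradient_rate:
  "\<exists>C>0. \<forall>\<phi>. boundary_lift M \<phi> \<longrightarrow> (\<forall>r \<tau>. 1/4 \<le> r \<longrightarrow> r < 1 \<longrightarrow>
     norm (rcis r \<tau> * directional_gradient \<phi> (\<i> * g' (\<phi> \<tau>)) (rcis r \<tau>) + of_real (normal_deriv \<phi> \<tau>))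
       \<le> C * (1 - r) powr (\<alpha>/2))"
proof -
  have B0: "0 \<le> (1 + 2 * pi) * pi\<^sup>2" by simp
  obtain C where C: "kernel_limit_const \<alpha> ((1 + 2 * pi) * pi\<^sup>2) (\<lambda>s. of_real (-1 * normal_kernel s)) C"
    using kernel_limit_const_exists [OF \<alpha>_pos \<alpha>_le B0 normal_kernel_measurable[of "-1"]] by blast
  then have "C > 0" by (simp add: kernel_limit_const_def)
  have "norm (rcis r \<tau> * directional_gradient \<phi> (\<i> * g' (\<phi> \<tau>)) (rcis r \<tau>) + of_real (normal_deriv \<phi> \<tau>))
       \<le> (C * (H * M powr (1 + \<alpha>) + 1)) * (1 - r) powr (\<alpha>/2)"
    if \<phi>: "boundary_lift M \<phi>" and r: "1/4 \<le> r" "r < 1" for \<phi> r \<tau>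
  proof -
    let ?\<psi> = "increment \<phi> (\<i> * g' (\<phi> \<tau>)) \<tau>"
    let ?I = "integral {-pi..pi} (\<lambda>s. diff_kernel r s * of_real (?\<psi> s))"
    let ?J = "integral {-pi..pi} (\<lambda>s. of_real (-1 * normal_kernel s) * of_real (?\<psi> s)) :: complex"
    have near: "norm (diff_kernel r s - of_real (-1 * normal_kernel s)) \<le> ((1 + 2 * pi) * pi\<^sup>2) * (1 - r) / (norm (cis s - of_real r) * s\<^sup>2)"
      if "\<bar>s\<bar> \<le> pi" "s \<noteq> 0" for s
      using diff_kernel_near_normal_kernel[OF r that] by simp
    have *: "(\<lambda>s. of_real (-1 * normal_kernel s) * of_real (?\<psi> s) :: complex) integrable_on {-pi..pi}"
       "norm (?I - ?J) \<le> C * (H * M powr (1 + \<alpha>)) * (1 - r) powr (\<alpha>/2)"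
      by (rule kernel_limit_constD[OF C r continuous_diff_kernel continuous_increment[OF \<phi>] near abs_increment_normal_le[OF \<phi>]];
          use r in simp)+
    have ri: "(\<lambda>s. - (normal_kernel s * ?\<psi> s)) integrable_on {-pi..pi}"
      using integrable_linear[OF *(1) bounded_linear_Re] by (simp add: o_def)
    have "?J = of_real (integral {-pi..pi} (\<lambda>s. - (normal_kernel s * ?\<psi> s)))"
      using integral_linear[OF ri, of complex_of_real, OF bounded_linear_of_real] by (simp add: o_def)
    then have J: "?J = - of_real (2 * pi * normal_deriv \<phi> \<tau>)"
      by (simp add: normal_deriv_def)
    have "rcis r \<tau> * directional_gradient \<phi> (\<i> * g' (\<phi> \<tau>)) (rcis r \<tau>) + of_real (normal_deriv \<phi> \<tau>) = (?I - ?J) / (2 * pi)"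
      using directional_gradient_polar[OF \<phi>, of r \<tau> "\<i> * g' (\<phi> \<tau>)"] r unfolding J by (simp add: field_simps)
    then have "norm (rcis r \<tau> * directional_gradient \<phi> (\<i> * g' (\<phi> \<tau>)) (rcis r \<tau>) + of_real (normal_deriv \<phi> \<tau>)) = norm (?I - ?J) / (2 * pi)"
      by (simp add: norm_divide norm_mult)
    also have "\<dots> \<le> norm (?I - ?J) / 1" using pi_gt3 by (intro divide_left_mono) auto
    also have "\<dots> \<le> C * (H * M powr (1 + \<alpha>)) * (1 - r) powr (\<alpha>/2)" using *(2) by simp
    also have "\<dots> \<le> (C * (H * M powr (1 + \<alpha>) + 1)) * (1 - r) powr (\<alpha>/2)"
      using \<open>C > 0\<close> by (intro mult_right_mono mult_left_mono) auto
    finally show ?thesis .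
  qed
  moreover have "C * (H * M powr (1 + \<alpha>) + 1) > 0" using \<open>C > 0\<close> H_nonneg by (intro mult_pos_pos add_nonneg_pos) auto
  ultimately show ?thesis by blast
qed

text \<open>Any exponent below \<open>\<alpha>/2\<close> would do in place of \<open>\<alpha>/4\<close>: the growth must be slower than the decay of
the imaginary part of the normal gradient.\<close>

lemma tangential_gradient_growth:
  "\<exists>C>0. \<forall>\<phi>. boundary_lift M \<phi> \<longrightarrow> (\<forall>r \<tau>. 1/4 \<le> r \<longrightarrow> r < 1 \<longrightarrow>
     norm (rcis r \<tau> * directional_gradient \<phi> (g' (\<phi> \<tau>)) (rcis r \<tau>)) \<le> C * (1 - r) powr (-(\<alpha>/4)))"
proof -
  have a: "0 < \<alpha>/4" "\<alpha>/4 < 1" using \<alpha>_pos \<alpha>_le by auto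
  obtain C where C: "kernel_growth_const (\<alpha>/4) C" using kernel_growth_const_exists [OF a] by blast
  then have "C > 0" by (simp add: kernel_growth_const_def)
  have "norm (rcis r \<tau> * directional_gradient \<phi> (g' (\<phi> \<tau>)) (rcis r \<tau>)) \<le> (C * (\<bar>M\<bar> + 1)) * (1 - r) powr (-(\<alpha>/4))"
    if \<phi>: "boundary_lift M \<phi>" and r: "1/4 \<le> r" "r < 1" for \<phi> r \<tau>
  proof -
    let ?\<psi> = "increment \<phi> (g' (\<phi> \<tau>)) \<tau>"
    let ?I = "integral {-pi..pi} (\<lambda>s. diff_kernel r s * of_real (?\<psi> s))"
    have I: "norm ?I \<le> C * M * (1 - r) powr (-(\<alpha>/4))"
      by (rule kernel_growth_constD[OF C r continuous_diff_kernel continuous_increment[OF \<phi>] norm_diff_kernel_le abs_increment_le[OF \<phi> unit]])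
         (use r in auto)
    have "norm (rcis r \<tau> * directional_gradient \<phi> (g' (\<phi> \<tau>)) (rcis r \<tau>)) = norm ?I / (2 * pi)"
      using directional_gradient_polar[OF \<phi>, of r \<tau> "g' (\<phi> \<tau>)"] r by (simp add: norm_divide norm_mult)
    also have "\<dots> \<le> norm ?I / 1" using pi_gt3 by (intro divide_left_mono) auto
    also have "\<dots> \<le> C * M * (1 - r) powr (-(\<alpha>/4))" using I by simp
    also have "\<dots> \<le> (C * (\<bar>M\<bar> + 1)) * (1 - r) powr (-(\<alpha>/4))"
      using \<open>C > 0\<close> by (intro mult_right_mono mult_left_mono) auto
    finally show ?thesis .
  qed
  moreover have "C * (\<bar>M\<bar> + 1) > 0" using \<open>C > 0\<close> by (intro mult_pos_pos) auto
  ultimately show ?thesis by blast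
qed

text \<open>The increment \<open>\<psi>\<close> has derivative \<open>D\<close> at \<open>0\<close>, so near \<open>0\<close> it lies between \<open>\<kappa> sin\<close> for any \<open>\<kappa>\<close> slightly
below and any slightly above \<open>D\<close>. The comparison principle for the imaginary part of the kernel turns
this into bounds for the limit.\<close>

lemma tangential_gradient_limit:
  assumes \<phi>: "boundary_lift M \<phi>" and D: "(\<phi> has_real_derivative D) (at \<tau>)"
  shows "((\<lambda>r. Im (rcis r \<tau> * directional_gradient \<phi> (g' (\<phi> \<tau>)) (rcis r \<tau>))) \<longlongrightarrow> - D) (at_left 1)"
proof -
  let ?\<psi> = "increment \<phi> (g' (\<phi> \<tau>)) \<tau>"
  have gd: "((\<lambda>t. g (\<phi> t)) has_vector_derivative D *\<^sub>R g' (\<phi> \<tau>)) (at \<tau>)"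
    using vector_diff_chain_at[of \<phi> D \<tau> g "g' (\<phi> \<tau>)"] D der
    by (simp add: o_def has_real_derivative_iff_has_vector_derivative)
  have "((\<lambda>s. g (\<phi> (\<tau> + s))) has_vector_derivative D *\<^sub>R g' (\<phi> \<tau>)) (at 0)"
    using vector_derivative_affine[of "\<lambda>t. g (\<phi> t)" "D *\<^sub>R g' (\<phi> \<tau>)" \<tau> 0 1] gd by simp
  then have "((\<lambda>s. (g (\<phi> (\<tau> + s)) - g (\<phi> \<tau>)) \<bullet> g' (\<phi> \<tau>)) has_vector_derivative (D *\<^sub>R g' (\<phi> \<tau>)) \<bullet> g' (\<phi> \<tau>)) (at 0)"
    by (intro bounded_linear.has_vector_derivative[OF bounded_linear_inner_left]) (auto intro!: derivative_eq_intros)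
  moreover have "g' (\<phi> \<tau>) \<bullet> g' (\<phi> \<tau>) = 1" using unit by (simp add: norm_eq_1)
  ultimately have \<psi>': "(?\<psi> has_real_derivative D) (at 0)"
    by (simp add: increment_def[abs_def] has_real_derivative_iff_has_vector_derivative)
  have sgn: "\<exists>\<delta>>0. \<forall>s. \<bar>s\<bar> \<le> \<delta> \<longrightarrow> \<bar>s\<bar> \<le> pi \<longrightarrow> 0 \<le> f s * sin s"
    if f: "(f has_real_derivative \<epsilon>) (at 0)" "\<epsilon> > 0" "f 0 = 0" for f \<epsilon>
  proof -
    obtain d1 where d1: "d1 > 0" "\<And>h. 0 < h \<Longrightarrow> h < d1 \<Longrightarrow> f 0 < f (0 + h)"
      using has_real_derivative_pos_inc_right[of f \<epsilon> 0 UNIV] f by auto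
    obtain d2 where d2: "d2 > 0" "\<And>h. 0 < h \<Longrightarrow> h < d2 \<Longrightarrow> f (0 - h) < f 0"
      using has_real_derivative_pos_inc_left[of f \<epsilon> 0 UNIV] f by auto
    have "0 \<le> f s * sin s" if s: "\<bar>s\<bar> \<le> min d1 d2 / 2" "\<bar>s\<bar> \<le> pi" for s
    proof -
      consider "s = 0" | "0 < s" | "s < 0" by linarith
      then show ?thesis
      proof cases
        case 2
        then show ?thesis using d1(2)[of s] s d1(1) f(3) sin_ge_zero[of s] by auto
      next
        case 3
        then show ?thesis using d2(2)[of "-s"] s d2(1) f(3) sin_ge_zero[of "-s"] by (auto intro!: mult_nonpos_nonpos)
      qed simp
    qed
    then show ?thesis using d1 d2 by (intro exI[of _ "min d1 d2 / 2"]) auto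
  qed
  have bnd: "\<bar>?\<psi> s\<bar> \<le> M * pi" if "\<bar>s\<bar> \<le> pi" for s
    using abs_increment_le[OF \<phi>, of "g' (\<phi> \<tau>)" \<tau> s] unit mult_left_mono[OF that boundary_liftD(4)[OF \<phi>]] by simp
  have cont: "continuous_on {-pi..pi} ?\<psi>" by (rule continuous_increment[OF \<phi>])
  define X where "X r = - Im (rcis r \<tau> * directional_gradient \<phi> (g' (\<phi> \<tau>)) (rcis r \<tau>))" for r
  have X: "X r = - Im (integral {-pi..pi} (\<lambda>s. diff_kernel r s * of_real (?\<psi> s))) / (2 * pi)"
    if "0 \<le> r" "r < 1" for r
  proof -
    have "Im (x / (2 * complex_of_real pi)) = Im x / (2 * pi)" for x
      using Im_divide_of_real[of x "2 * pi"] by simp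
    then show ?thesis unfolding X_def directional_gradient_polar[OF \<phi> that] by simp
  qed
  have near: "\<forall>\<^sub>F r in at_left 1. 1/4 \<le> r \<and> r < (1::real)"
    unfolding eventually_at_left_field by (intro exI[of _ "1/4"]) auto
  have lin: "((\<lambda>r. a * r - b * (1 - r)) \<longlongrightarrow> a) (at_left 1)" for a b :: real
    by (auto intro!: tendsto_eq_intros)
  have "(X \<longlongrightarrow> D) (at_left 1)"
  proof (rule order_tendstoI)
    fix a assume "a < D"
    then obtain \<kappa> where \<kappa>: "a < \<kappa>" "\<kappa> < D" using dense by blast
    have "((\<lambda>s. ?\<psi> s - \<kappa> * sin s) has_real_derivative D - \<kappa>) (at 0)"
      by (auto intro!: derivative_eq_intros \<psi>')
    then obtain \<delta> where \<delta>: "\<delta> > 0" "\<And>s. \<bar>s\<bar> \<le> \<delta> \<Longrightarrow> \<bar>s\<bar> \<le> pi \<Longrightarrow> 0 \<le> (?\<psi> s - \<kappa> * sin s) * sin s"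
      using sgn[of "\<lambda>s. ?\<psi> s - \<kappa> * sin s" "D - \<kappa>"] \<kappa> by (auto simp: increment_def)
    have "\<forall>\<^sub>F r in at_left 1. \<kappa> * r - (4 * (pi / \<delta>)^4 * (M * pi + \<bar>\<kappa>\<bar>)) * (1 - r) \<le> X r"
      using near
    proof eventually_elim
      case (elim r)
      then show ?case using Im_diff_kernel_lower_bound[OF _ _ cont \<delta>(1) bnd \<delta>(2), of r] X[of r] by auto
    qed
    moreover have "\<forall>\<^sub>F r in at_left 1. a < \<kappa> * r - (4 * (pi / \<delta>)^4 * (M * pi + \<bar>\<kappa>\<bar>)) * (1 - r)"
      by (rule order_tendstoD(1)[OF lin \<kappa>(1)])
    ultimately show "\<forall>\<^sub>F r in at_left 1. a < X r" by eventually_elim linarith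
  next
    fix a assume "D < a"
    then obtain \<kappa> where \<kappa>: "D < \<kappa>" "\<kappa> < a" using dense by blast
    have "((\<lambda>s. \<kappa> * sin s - ?\<psi> s) has_real_derivative \<kappa> - D) (at 0)"
      by (auto intro!: derivative_eq_intros \<psi>')
    then obtain \<delta> where \<delta>: "\<delta> > 0" "\<And>s. \<bar>s\<bar> \<le> \<delta> \<Longrightarrow> \<bar>s\<bar> \<le> pi \<Longrightarrow> 0 \<le> (- ?\<psi> s - (-\<kappa>) * sin s) * sin s"
      using sgn[of "\<lambda>s. \<kappa> * sin s - ?\<psi> s" "\<kappa> - D"] \<kappa> by (auto simp: increment_def)
    have cont': "continuous_on {-pi..pi} (\<lambda>s. - ?\<psi> s)" by (intro continuous_intros cont)
    have bnd': "\<bar>- ?\<psi> s\<bar> \<le> M * pi" if "\<bar>s\<bar> \<le> pi" for s using bnd[OF that] by simp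
    have "\<forall>\<^sub>F r in at_left 1. X r \<le> - ((-\<kappa>) * r - (4 * (pi / \<delta>)^4 * (M * pi + \<bar>-\<kappa>\<bar>)) * (1 - r))"
      using near
    proof eventually_elim
      case (elim r)
      have "integral {-pi..pi} (\<lambda>s. diff_kernel r s * of_real (- ?\<psi> s)) = - integral {-pi..pi} (\<lambda>s. diff_kernel r s * of_real (?\<psi> s))"
        by simp
      then show ?case using Im_diff_kernel_lower_bound[OF _ _ cont' \<delta>(1) bnd' \<delta>(2), of r] X[of r] elim by auto
    qed
    moreover have "\<forall>\<^sub>F r in at_left 1. - a < (-\<kappa>) * r - (4 * (pi / \<delta>)^4 * (M * pi + \<bar>-\<kappa>\<bar>)) * (1 - r)"
      by (rule order_tendstoD(1)[OF lin]) (use \<kappa> in simp)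
    ultimately show "\<forall>\<^sub>F r in at_left 1. X r < a" by eventually_elim linarith
  qed
  then have "((\<lambda>r. - X r) \<longlongrightarrow> - D) (at_left 1)" by (rule tendsto_minus)
  then show ?thesis unfolding X_def minus_minus .
qed

text \<open>If \<open>\<phi>\<close> grows at least linearly, the comparison with \<open>(c/2) sin\<close> works on an interval whose length
does not depend on \<open>\<tau>\<close>, so the resulting bound is uniform.\<close>

lemma tangential_gradient_lower:
  assumes \<phi>: "boundary_lift M \<phi>" and c: "0 < c" "\<And>s t. s \<le> t \<Longrightarrow> c * (t - s) \<le> \<phi> t - \<phi> s"
  shows "\<exists>r0<1. \<forall>r \<tau>. r0 < r \<longrightarrow> r < 1 \<longrightarrow>
            Im (rcis r \<tau> * directional_gradient \<phi> (g' (\<phi> \<tau>)) (rcis r \<tau>)) \<le> - c/4"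
proof -
  have M: "M \<ge> 0" using boundary_liftD(4)[OF \<phi>] .
  obtain \<delta> where \<delta>0: "\<delta> > 0" "(H * M powr \<alpha>) * \<delta> powr \<alpha> < 1/2"
    by (rule powr_eventually_small[OF \<alpha>_pos, of "1/2" "H * M powr \<alpha>"]) auto
  then have \<delta>: "\<delta> > 0" "H * (M * \<delta>) powr \<alpha> \<le> 1/2" using M by (simp_all add: powr_mult)
  have sgn: "0 \<le> (increment \<phi> (g' (\<phi> \<tau>)) \<tau> s - (c/2) * sin s) * sin s" if s: "\<bar>s\<bar> \<le> \<delta>" "\<bar>s\<bar> \<le> pi" for \<tau> s
  proof -
    define h where "h = \<phi> (\<tau> + s) - \<phi> \<tau>"
    have hM: "\<bar>h\<bar> \<le> M * \<delta>" using boundary_liftD(2)[OF \<phi>, of "\<tau> + s" \<tau>] mult_left_mono[OF s(1) M] by (simp add: h_def)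
    have "H * \<bar>h\<bar> powr (1 + \<alpha>) = (H * \<bar>h\<bar> powr \<alpha>) * \<bar>h\<bar>" by (cases "h = 0") (simp_all add: powr_add)
    also have "\<dots> \<le> 1/2 * \<bar>h\<bar>"
    proof (rule mult_right_mono)
      have "H * \<bar>h\<bar> powr \<alpha> \<le> H * (M * \<delta>) powr \<alpha>" using hM H_nonneg \<alpha>_pos by (intro mult_left_mono powr_mono2) auto
      then show "H * \<bar>h\<bar> powr \<alpha> \<le> 1/2" using \<delta>(2) by linarith
    qed simp
    finally have inc: "\<bar>increment \<phi> (g' (\<phi> \<tau>)) \<tau> s - h\<bar> \<le> \<bar>h\<bar> / 2"
      using increment_tangential[OF \<phi>, of \<tau> s] by (simp add: h_def)
    show ?thesis
    proof (cases "0 \<le> s")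
      case True
      have h: "c * s \<le> h" using c(2)[of \<tau> "\<tau> + s"] True by (simp add: h_def)
      have "0 \<le> c * s" using True c by simp
      moreover have "c * sin s \<le> c * s" using True c by (intro mult_left_mono sin_x_le_x) auto
      ultimately have "0 \<le> increment \<phi> (g' (\<phi> \<tau>)) \<tau> s - (c/2) * sin s" using inc h by arith
      then show ?thesis using sin_ge_zero[of s] s True by (intro mult_nonneg_nonneg) auto
    next
      case False
      have h: "h \<le> c * s" using c(2)[of "\<tau> + s" \<tau>] False by (simp add: h_def)
      have "c * s \<le> 0" using False c by (simp add: mult_le_0_iff)
      moreover have "c * sin (-s) \<le> c * (-s)" using False c by (intro mult_left_mono sin_x_le_x) auto
      ultimately have "increment \<phi> (g' (\<phi> \<tau>)) \<tau> s - (c/2) * sin s \<le> 0" using inc h unfolding sin_minus by arith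
      then show ?thesis using sin_ge_zero[of "-s"] s False by (intro mult_nonpos_nonpos) auto
    qed
  qed
  define E where "E = 4 * (pi / \<delta>)^4 * (M * pi + \<bar>c/2\<bar>)"
  have E: "E \<ge> 0" using M by (simp add: E_def)
  \<comment> \<open>Chosen so that \<open>(E + c) * (1 - r) \<le> c/4\<close>, hence \<open>(c/2) * r - E * (1 - r) \<ge> c/4\<close>, for \<open>r > r0\<close>.\<close>
  define r0 where "r0 = 1 - min (3/4) (c / (4 * (E + c)))"
  have "r0 < 1" using c E by (simp add: r0_def)
  moreover have "Im (rcis r \<tau> * directional_gradient \<phi> (g' (\<phi> \<tau>)) (rcis r \<tau>)) \<le> - c/4" if r: "r0 < r" "r < 1" for r \<tau>
  proof -
    have "1 - r < min (3/4) (c / (4 * (E + c)))" using r unfolding r0_def by linarith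
    then have r1: "1/4 \<le> r" and "1 - r \<le> c / (4 * (E + c))" by auto
    then have small: "(E + c) * (1 - r) \<le> c / 4" using E c by (simp add: field_simps)
    have "\<bar>increment \<phi> (g' (\<phi> \<tau>)) \<tau> s\<bar> \<le> M * pi" if "\<bar>s\<bar> \<le> pi" for s
      using abs_increment_le[OF \<phi>, of "g' (\<phi> \<tau>)" \<tau> s] unit mult_left_mono[OF that M] by simp
    then have "(c/2) * r - E * (1 - r) \<le> - Im (integral {-pi..pi} (\<lambda>s. diff_kernel r s * of_real (increment \<phi> (g' (\<phi> \<tau>)) \<tau> s))) / (2 * pi)"
      unfolding E_def by (intro Im_diff_kernel_lower_bound r1 r continuous_increment[OF \<phi>] \<delta>(1) sgn)
    also have "\<dots> = - Im (rcis r \<tau> * directional_gradient \<phi> (g' (\<phi> \<tau>)) (rcis r \<tau>))"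
    proof -
      have "Im (x / (2 * complex_of_real pi)) = Im x / (2 * pi)" for x
        using Im_divide_of_real[of x "2 * pi"] by simp
      then show ?thesis using directional_gradient_polar[OF \<phi>, of r \<tau> "g' (\<phi> \<tau>)"] r r1 by simp
    qed
    moreover have "c/4 \<le> (c/2) * r - E * (1 - r)"
    proof -
      have "0 \<le> c * (1 - r)" using c r by simp
      then show ?thesis using small by (simp add: algebra_simps)
    qed
    ultimately show ?thesis by simp
  qed
  ultimately show ?thesis by blast
qed

end

section \<open>The Jacobian near the circle\<close>

text \<open>The Jacobian is the determinant of the gradients of the components of \<open>w\<close> in any orthonormal frame.
Here the frame consists of \<open>t\<close> and \<open>\<i> t\<close>, and \<open>A\<close>, \<open>B\<close> are \<open>z\<close> times the directional gradients.\<close>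

lemma jacobian_frame_identity:
  fixes t z p q :: complex
  assumes t: "norm t = 1"
  defines "A \<equiv> z * (cnj (\<i> * t) * p + (\<i> * t) * q)" and "B \<equiv> z * (cnj t * p + t * q)"
  shows "(norm z)\<^sup>2 * ((norm p)\<^sup>2 - (norm q)\<^sup>2) = Re A * Im B - Im A * Re B"
proof -
  define u where "u = z * cnj t * p"
  define v where "v = z * t * q"
  have A: "A = - \<i> * u + \<i> * v" and B: "B = u + v"
    by (simp_all add: A_def B_def u_def v_def algebra_simps)
  have "(norm z)\<^sup>2 * ((norm p)\<^sup>2 - (norm q)\<^sup>2) = (norm u)\<^sup>2 - (norm v)\<^sup>2"
    using t by (simp add: u_def v_def norm_mult power_mult_distrib algebra_simps)
  also have "\<dots> = Re A * Im B - Im A * Re B"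
    unfolding A B by (simp add: cmod_power2) (simp add: power2_eq_square algebra_simps)
  finally show ?thesis .
qed

context smooth_jordan_curve
begin

text \<open>In the decomposition \<open>w = h + cnj k\<close> of the Poisson extension these are \<open>h'\<close> and \<open>k'\<close>.\<close>

abbreviation "w_z \<phi> \<equiv> cauchy_transform_deriv (\<lambda>t. g (\<phi> t))"
abbreviation "w_zbar_cnj \<phi> \<equiv> cauchy_transform_deriv (\<lambda>t. cnj (g (\<phi> t)))"

lemma w_z_holomorphic:
  assumes "boundary_lift M \<phi>"
  shows "w_z \<phi> holomorphic_on ball 0 1" "w_zbar_cnj \<phi> holomorphic_on ball 0 1"
  by (intro cauchy_transform_deriv_holomorphic continuous_boundary_values[OF assms] continuous_intros)+

lemma jacobian_polar:
  "r\<^sup>2 * ((norm (w_z \<phi> (rcis r \<tau>)))\<^sup>2 - (norm (w_zbar_cnj \<phi> (rcis r \<tau>)))\<^sup>2) =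
    Re (rcis r \<tau> * directional_gradient \<phi> (\<i> * g' (\<phi> \<tau>)) (rcis r \<tau>)) * Im (rcis r \<tau> * directional_gradient \<phi> (g' (\<phi> \<tau>)) (rcis r \<tau>))
  - Im (rcis r \<tau> * directional_gradient \<phi> (\<i> * g' (\<phi> \<tau>)) (rcis r \<tau>)) * Re (rcis r \<tau> * directional_gradient \<phi> (g' (\<phi> \<tau>)) (rcis r \<tau>))"
  using jacobian_frame_identity[where t = "g' (\<phi> \<tau>)" and z = "rcis r \<tau>" and p = "w_z \<phi> (rcis r \<tau>)"
      and q = "w_zbar_cnj \<phi> (rcis r \<tau>)", OF unit]
  unfolding directional_gradient_def by simp

lemma normal_deriv_periodic:
  assumes \<phi>: "boundary_lift M \<phi>" shows "normal_deriv \<phi> (\<tau> + 2 * pi) = normal_deriv \<phi> \<tau>"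
proof -
  have "\<phi> (\<tau> + 2 * pi + s) = \<phi> (\<tau> + s) + l" for s
    using boundary_liftD(3)[OF \<phi>, of "\<tau> + s"] by (simp add: add_ac)
  then show ?thesis
    using boundary_liftD(3)[OF \<phi>] per per' by (simp add: normal_deriv_def increment_def)
qed

text \<open>A uniform limit of the continuous functions \<open>\<tau> \<mapsto> - Re A(r, \<tau>)\<close>, by the rate of convergence of the
normal gradient.\<close>

lemma continuous_normal_deriv:
  assumes \<phi>: "boundary_lift M \<phi>" shows "continuous_on UNIV (normal_deriv \<phi>)"
proof -
  obtain C where C: "C > 0" "\<And>r \<tau>. 1/4 \<le> r \<Longrightarrow> r < 1 \<Longrightarrow>
     norm (rcis r \<tau> * directional_gradient \<phi> (\<i> * g' (\<phi> \<tau>)) (rcis r \<tau>) + of_real (normal_deriv \<phi> \<tau>)) \<le> C * (1 - r) powr (\<alpha>/2)"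
    using normal_gradient_rate[of M] \<phi> by blast
  define X where "X r \<tau> = - Re (rcis r \<tau> * directional_gradient \<phi> (\<i> * g' (\<phi> \<tau>)) (rcis r \<tau>))" for r \<tau>
  have XC: "\<bar>X r \<tau> - normal_deriv \<phi> \<tau>\<bar> \<le> C * (1 - r) powr (\<alpha>/2)" if "1/4 \<le> r" "r < 1" for r \<tau>
    using order_trans[OF abs_Re_le_cmod C(2)[OF that, of \<tau>]] by (simp add: X_def)
  have cw: "continuous_on (ball 0 1) (w_z \<phi>)" "continuous_on (ball 0 1) (w_zbar_cnj \<phi>)"
    using w_z_holomorphic[OF \<phi>] by (auto intro: holomorphic_on_imp_continuous_on)
  have cr: "continuous_on UNIV (\<lambda>\<tau>. rcis r \<tau>)" for r unfolding rcis_def by (intro continuous_intros)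
  have cX: "continuous_on UNIV (X r)" if r: "1/4 \<le> r" "r < 1" for r
    unfolding X_def directional_gradient_def
    using r by (intro continuous_intros cr continuous_on_compose2[OF continuous_g' boundary_liftD(5)[OF \<phi>]]
        continuous_on_compose2[OF cw(1) cr] continuous_on_compose2[OF cw(2) cr]) auto
  have lim: "((\<lambda>r. C * (1 - r) powr (\<alpha>/2)) \<longlongrightarrow> 0) (at_left 1)"
    using \<alpha>_pos by (intro gap_powr_tendsto_0) simp
  have "uniform_limit UNIV X (normal_deriv \<phi>) (at_left 1)"
  proof (rule uniform_limitI)
    fix e :: real assume "e > 0"
    have near: "\<forall>\<^sub>F r in at_left 1. 1/4 \<le> r \<and> r < (1::real)"
      unfolding eventually_at_left_field by (intro exI[of _ "1/4"]) auto
    from order_tendstoD(2)[OF lim \<open>e > 0\<close>] near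
    show "\<forall>\<^sub>F r in at_left 1. \<forall>\<tau>\<in>UNIV. dist (X r \<tau>) (normal_deriv \<phi> \<tau>) < e"
      by eventually_elim (use XC in \<open>auto simp: dist_real_def intro: le_less_trans\<close>)
  qed
  moreover have "\<forall>\<^sub>F r in at_left 1. continuous_on UNIV (X r)"
    using cX unfolding eventually_at_left_field by (intro exI[of _ "1/4"]) auto
  ultimately show ?thesis by (intro uniform_limit_theorem) auto
qed

lemma normal_deriv_lower_bound:
  assumes \<phi>: "boundary_lift M \<phi>" and pos: "\<And>\<tau>. normal_deriv \<phi> \<tau> > 0"
  shows "\<exists>c>0. \<forall>\<tau>. c \<le> normal_deriv \<phi> \<tau>"
proof -
  have "\<exists>x\<in>{0..2*pi}. \<forall>y\<in>{0..2*pi}. normal_deriv \<phi> x \<le> normal_deriv \<phi> y"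
    by (intro continuous_attains_inf continuous_on_subset[OF continuous_normal_deriv[OF \<phi>]]) auto
  then obtain x where x: "\<And>y. y \<in> {0..2*pi} \<Longrightarrow> normal_deriv \<phi> x \<le> normal_deriv \<phi> y" by blast
  have "normal_deriv \<phi> x \<le> normal_deriv \<phi> \<tau>" for \<tau>
  proof -
    obtain n :: int where "\<tau> + of_int n * (2 * pi) \<in> {0..<2*pi}" by (rule translate_into_period[of "2 * pi"]) auto
    then have "normal_deriv \<phi> x \<le> normal_deriv \<phi> (\<tau> + of_int n * (2 * pi))" by (intro x) auto
    also have "\<dots> = normal_deriv \<phi> \<tau>" by (rule periodic_of_int[where f = "normal_deriv \<phi>", OF normal_deriv_periodic[OF \<phi>]])
    finally show ?thesis .
  qed
  then show ?thesis using pos[of x] by blast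
qed

text \<open>In \<open>Re A * Im B - Im A * Re B\<close> the first product is bounded below by \<open>(d/2) (c/4)\<close>, while the second
is \<open>O((1 - r)\<^sup>\<alpha>\<^sup>/\<^sup>2 (1 - r)\<^sup>-\<^sup>\<alpha>\<^sup>/\<^sup>4)\<close>.\<close>

lemma jacobian_positive_near_circle:
  assumes \<phi>: "boundary_lift M \<phi>" and c: "0 < c" "\<And>s t. s \<le> t \<Longrightarrow> c * (t - s) \<le> \<phi> t - \<phi> s"
    and d: "0 < d" "\<And>\<tau>. d \<le> normal_deriv \<phi> \<tau>"
  shows "\<exists>r0<1. \<forall>r \<tau>. r0 < r \<longrightarrow> r < 1 \<longrightarrow>
     norm (w_zbar_cnj \<phi> (rcis r \<tau>)) < norm (w_z \<phi> (rcis r \<tau>)) \<and>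
     Im (rcis r \<tau> * directional_gradient \<phi> (g' (\<phi> \<tau>)) (rcis r \<tau>)) < 0"
proof -
  obtain C1 where C1: "C1 > 0" "\<And>r \<tau>. 1/4 \<le> r \<Longrightarrow> r < 1 \<Longrightarrow>
     norm (rcis r \<tau> * directional_gradient \<phi> (\<i> * g' (\<phi> \<tau>)) (rcis r \<tau>) + of_real (normal_deriv \<phi> \<tau>)) \<le> C1 * (1 - r) powr (\<alpha>/2)"
    using normal_gradient_rate[of M] \<phi> by blast
  obtain C2 where C2: "C2 > 0" "\<And>r \<tau>. 1/4 \<le> r \<Longrightarrow> r < 1 \<Longrightarrow>
     norm (rcis r \<tau> * directional_gradient \<phi> (g' (\<phi> \<tau>)) (rcis r \<tau>)) \<le> C2 * (1 - r) powr (-(\<alpha>/4))"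
    using tangential_gradient_growth[of M] \<phi> by blast
  obtain r1 where r1: "r1 < 1" "\<And>r \<tau>. r1 < r \<Longrightarrow> r < 1 \<Longrightarrow> Im (rcis r \<tau> * directional_gradient \<phi> (g' (\<phi> \<tau>)) (rcis r \<tau>)) \<le> - c/4"
    using tangential_gradient_lower[OF \<phi> c] by blast
  have "\<forall>\<^sub>F r in at_left 1. C1 * (1 - r) powr (\<alpha>/2) < d/2"
    by (rule order_tendstoD(2)[OF gap_powr_tendsto_0]) (use \<alpha>_pos d in auto)
  moreover have "\<forall>\<^sub>F r in at_left 1. C1 * C2 * (1 - r) powr (\<alpha>/4) < (d/2) * (c/4)"
    by (rule order_tendstoD(2)[OF gap_powr_tendsto_0]) (use \<alpha>_pos d c in auto)
  moreover have "\<forall>\<^sub>F r in at_left 1. max r1 (1/4) < r \<and> r < (1::real)"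
    using r1 by (intro eventually_mono[OF eventually_at_left_real[of "max r1 (1/4)" 1]]) auto
  ultimately have "\<forall>\<^sub>F r in at_left 1. C1 * (1 - r) powr (\<alpha>/2) < d/2 \<and> C1 * C2 * (1 - r) powr (\<alpha>/4) < (d/2) * (c/4)
      \<and> max r1 (1/4) < r \<and> r < (1::real)"
    by eventually_elim simp
  then obtain b where b: "b < 1" "\<And>r. b < r \<Longrightarrow> r < 1 \<Longrightarrow> C1 * (1 - r) powr (\<alpha>/2) < d/2 \<and> C1 * C2 * (1 - r) powr (\<alpha>/4) < (d/2) * (c/4)
      \<and> max r1 (1/4) < r"
    unfolding eventually_at_left_field by blast
  have "norm (w_zbar_cnj \<phi> (rcis r \<tau>)) < norm (w_z \<phi> (rcis r \<tau>)) \<and>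
     Im (rcis r \<tau> * directional_gradient \<phi> (g' (\<phi> \<tau>)) (rcis r \<tau>)) < 0" if r: "b < r" "r < 1" for r \<tau>
  proof -
    note br = b(2)[OF r]
    define A where "A = rcis r \<tau> * directional_gradient \<phi> (\<i> * g' (\<phi> \<tau>)) (rcis r \<tau>)"
    define B where "B = rcis r \<tau> * directional_gradient \<phi> (g' (\<phi> \<tau>)) (rcis r \<tau>)"
    have q: "1/4 \<le> r" using br by simp
    have A: "norm (A + of_real (normal_deriv \<phi> \<tau>)) \<le> C1 * (1 - r) powr (\<alpha>/2)"
      unfolding A_def by (rule C1(2)[OF q r(2)])
    have ReA: "Re A \<le> - (d/2)"
      using order_trans[OF abs_Re_le_cmod A] d(2)[of \<tau>] br by (simp add: abs_le_iff)
    have ImA: "\<bar>Im A\<bar> \<le> C1 * (1 - r) powr (\<alpha>/2)" using order_trans[OF abs_Im_le_cmod A] by simp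
    have ReB: "\<bar>Re B\<bar> \<le> C2 * (1 - r) powr (-(\<alpha>/4))"
      unfolding B_def by (rule order_trans[OF abs_Re_le_cmod C2(2)[OF q r(2)]])
    have ImB: "Im B \<le> - c/4" unfolding B_def using r1(2)[of r \<tau>] br r by simp
    have "\<bar>Im A * Re B\<bar> \<le> (C1 * (1 - r) powr (\<alpha>/2)) * (C2 * (1 - r) powr (-(\<alpha>/4)))"
      unfolding abs_mult using ImA ReB C1(1) by (intro mult_mono) auto
    also have "\<dots> = C1 * C2 * ((1 - r) powr (\<alpha>/2) * (1 - r) powr (-(\<alpha>/4)))" by simp
    also have "(1 - r) powr (\<alpha>/2) * (1 - r) powr (-(\<alpha>/4)) = (1 - r) powr (\<alpha>/4)"
      unfolding powr_add[symmetric] by simp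
    also have "C1 * C2 * (1 - r) powr (\<alpha>/4) < (d/2) * (c/4)" using br by simp
    also have "(d/2) * (c/4) \<le> (- Re A) * (- Im B)" using ReA ImB d c by (intro mult_mono) auto
    finally have "0 < Re A * Im B - Im A * Re B" by (simp add: abs_less_iff)
    also have "\<dots> = r\<^sup>2 * ((norm (w_z \<phi> (rcis r \<tau>)))\<^sup>2 - (norm (w_zbar_cnj \<phi> (rcis r \<tau>)))\<^sup>2)"
      unfolding A_def B_def by (rule jacobian_polar [symmetric])
    finally have "0 < (norm (w_z \<phi> (rcis r \<tau>)))\<^sup>2 - (norm (w_zbar_cnj \<phi> (rcis r \<tau>)))\<^sup>2"
      using q by (simp add: zero_less_mult_iff)
    then have "(norm (w_zbar_cnj \<phi> (rcis r \<tau>)))\<^sup>2 < (norm (w_z \<phi> (rcis r \<tau>)))\<^sup>2" by simp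
    then have "norm (w_zbar_cnj \<phi> (rcis r \<tau>)) < norm (w_z \<phi> (rcis r \<tau>))" by (rule power2_less_imp_less) simp
    then show ?thesis using ImB c unfolding B_def by simp
  qed
  then show ?thesis using b(1) by blast
qed

text \<open>The convex combination with the lift of constant speed. For \<open>\<epsilon> > 0\<close> it increases at least linearly, and it keeps the
Lipschitz constant \<open>M\<close>, so that the estimates above hold for it with the same constants.\<close>

definition perturbed_lift :: "(real \<Rightarrow> real) \<Rightarrow> real \<Rightarrow> real \<Rightarrow> real" where
  "perturbed_lift \<phi> \<epsilon> t = (1 - \<epsilon>) * \<phi> t + \<epsilon> * (l / (2 * pi) * t)"

lemma speed_le_lipschitz:
  assumes \<phi>: "boundary_lift M \<phi>" shows "l / (2 * pi) \<le> M"
proof -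
  have "l \<le> M * (2 * pi)" using boundary_liftD(2)[OF \<phi>, of "0 + 2 * pi" 0] boundary_liftD(3)[OF \<phi>, of 0] l_pos by simp
  then show ?thesis by (simp add: field_simps)
qed

lemma perturbed_lift_boundary_lift:
  assumes \<phi>: "boundary_lift M \<phi>" and \<epsilon>: "0 \<le> \<epsilon>" "\<epsilon> \<le> 1"
  shows "boundary_lift M (perturbed_lift \<phi> \<epsilon>)"
  unfolding boundary_lift_def
proof (intro conjI allI)
  show "mono (perturbed_lift \<phi> \<epsilon>)"
    unfolding perturbed_lift_def using boundary_liftD(1)[OF \<phi>] \<epsilon> l_pos
    by (intro monoI add_mono mult_left_mono) (auto dest: monoD)
  show "perturbed_lift \<phi> \<epsilon> (t + 2 * pi) = perturbed_lift \<phi> \<epsilon> t + l" for t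
    using boundary_liftD(3)[OF \<phi>, of t] by (simp add: perturbed_lift_def field_simps)
  show "\<bar>perturbed_lift \<phi> \<epsilon> t - perturbed_lift \<phi> \<epsilon> s\<bar> \<le> M * \<bar>t - s\<bar>" for s t
  proof -
    have "perturbed_lift \<phi> \<epsilon> t - perturbed_lift \<phi> \<epsilon> s = (1 - \<epsilon>) * (\<phi> t - \<phi> s) + \<epsilon> * (l / (2 * pi) * (t - s))"
      by (simp add: perturbed_lift_def algebra_simps diff_divide_distrib)
    also have "\<bar>\<dots>\<bar> \<le> (1 - \<epsilon>) * \<bar>\<phi> t - \<phi> s\<bar> + \<epsilon> * (l / (2 * pi) * \<bar>t - s\<bar>)"
      using \<epsilon> l_pos by (intro order_trans[OF abs_triangle_ineq]) (simp add: abs_mult)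
    also have "\<dots> \<le> (1 - \<epsilon>) * (M * \<bar>t - s\<bar>) + \<epsilon> * (M * \<bar>t - s\<bar>)"
      using \<epsilon> boundary_liftD(2)[OF \<phi>] speed_le_lipschitz[OF \<phi>]
      by (intro add_mono mult_left_mono mult_right_mono) auto
    finally show ?thesis by (simp add: algebra_simps)
  qed
qed

lemma perturbed_lift_slope:
  assumes \<phi>: "boundary_lift M \<phi>" and \<epsilon>: "0 \<le> \<epsilon>" "\<epsilon> \<le> 1" and "s \<le> t"
  shows "(\<epsilon> * (l / (2 * pi))) * (t - s) \<le> perturbed_lift \<phi> \<epsilon> t - perturbed_lift \<phi> \<epsilon> s"
proof -
  have "0 \<le> (1 - \<epsilon>) * (\<phi> t - \<phi> s)" using monoD[OF boundary_liftD(1)[OF \<phi>] \<open>s \<le> t\<close>] \<epsilon> by simp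
  then show ?thesis by (simp add: perturbed_lift_def algebra_simps diff_divide_distrib)
qed

text \<open>The two lifts differ by a periodic, hence bounded, function.\<close>

lemma perturbed_lift_close:
  assumes \<phi>: "boundary_lift M \<phi>"
  shows "\<exists>K>0. \<forall>\<epsilon> t. 0 \<le> \<epsilon> \<longrightarrow> \<bar>perturbed_lift \<phi> \<epsilon> t - \<phi> t\<bar> \<le> K * \<epsilon>"
proof -
  define d where "d t = l / (2 * pi) * t - \<phi> t" for t
  have dper: "d (t + 2 * pi) = d t" for t
    using boundary_liftD(3)[OF \<phi>, of t] by (simp add: d_def field_simps)
  have "compact (d ` {0..2*pi})"
    unfolding d_def by (intro compact_continuous_image continuous_intros boundary_liftD(5)[OF \<phi>]) auto
  then obtain K where K: "K > 0" "\<And>t. t \<in> {0..2*pi} \<Longrightarrow> \<bar>d t\<bar> \<le> K"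
    using compact_imp_bounded bounded_pos by (metis image_eqI real_norm_def)
  have "\<bar>d t\<bar> \<le> K" for t
  proof -
    obtain n :: int where "t + of_int n * (2 * pi) \<in> {0..<2*pi}" by (rule translate_into_period[of "2 * pi"]) auto
    then have "\<bar>d (t + of_int n * (2 * pi))\<bar> \<le> K" by (intro K(2)) auto
    then show ?thesis unfolding periodic_of_int[where f = d, OF dper] .
  qed
  moreover have "perturbed_lift \<phi> \<epsilon> t - \<phi> t = \<epsilon> * d t" for \<epsilon> t
    by (simp add: perturbed_lift_def d_def algebra_simps)
  ultimately show ?thesis using K(1)
    by (intro exI[of _ K]) (auto simp: abs_mult mult.commute intro!: mult_left_mono)
qed

text \<open>The normal derivative is within \<open>e/4\<close> of the normal gradient at one fixed radius \<open>r\<close>, by a rate that all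
lifts with the same \<open>M\<close> share. At that radius the kernel is bounded by \<open>2 / (1 - r)\<^sup>2\<close>, so the
gradient depends continuously on the lift, uniformly in \<open>\<tau>\<close>.\<close>

lemma normal_deriv_perturbed:
  assumes \<phi>: "boundary_lift M \<phi>" and e: "0 < e"
  shows "\<forall>\<^sub>F \<epsilon> in at_right 0. \<forall>\<tau>. \<bar>normal_deriv (perturbed_lift \<phi> \<epsilon>) \<tau> - normal_deriv \<phi> \<tau>\<bar> < e"
proof -
  obtain K where K: "K > 0" "\<And>\<epsilon> t. 0 \<le> \<epsilon> \<Longrightarrow> \<bar>perturbed_lift \<phi> \<epsilon> t - \<phi> t\<bar> \<le> K * \<epsilon>"
    using perturbed_lift_close[OF \<phi>] by blast
  obtain C where C: "C > 0" "\<And>\<phi> r \<tau>. boundary_lift M \<phi> \<Longrightarrow> 1/4 \<le> r \<Longrightarrow> r < 1 \<Longrightarrow>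
     norm (rcis r \<tau> * directional_gradient \<phi> (\<i> * g' (\<phi> \<tau>)) (rcis r \<tau>) + of_real (normal_deriv \<phi> \<tau>)) \<le> C * (1 - r) powr (\<alpha>/2)"
    using normal_gradient_rate[of M] by blast
  have "\<forall>\<^sub>F r in at_left 1. C * (1 - r) powr (\<alpha>/2) < e/4"
    by (rule order_tendstoD(2)[OF gap_powr_tendsto_0]) (use e \<alpha>_pos in auto)
  moreover have "\<forall>\<^sub>F r in at_left 1. 1/4 < r \<and> r < (1::real)"
    by (intro eventually_mono[OF eventually_at_left_real[of "1/4" 1]]) auto
  ultimately have "\<forall>\<^sub>F r in at_left 1. C * (1 - r) powr (\<alpha>/2) < e/4 \<and> 1/4 < r \<and> r < 1"
    by eventually_elim simp
  then obtain r where r: "C * (1 - r) powr (\<alpha>/2) < e/4" "1/4 \<le> r" "r < 1"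
    using eventually_happens'[of "at_left (1::real)"] by force
  define A where "A \<psi> \<tau> = rcis r \<tau> * directional_gradient \<psi> (\<i> * g' (\<psi> \<tau>)) (rcis r \<tau>)" for \<psi> \<tau>
  define E where "E \<epsilon> = 2 / (1 - r)\<^sup>2 * (2 * (K * \<epsilon>) + M * pi * (H * (K * \<epsilon>) powr \<alpha>))" for \<epsilon>
  have AE: "norm (A (perturbed_lift \<phi> \<epsilon>) \<tau> - A \<phi> \<tau>) \<le> E \<epsilon>" if \<epsilon>: "0 \<le> \<epsilon>" "\<epsilon> \<le> 1" for \<epsilon> \<tau>
  proof -
    let ?\<psi> = "perturbed_lift \<phi> \<epsilon>"
    have \<psi>: "boundary_lift M ?\<psi>" by (rule perturbed_lift_boundary_lift[OF \<phi> \<epsilon>])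
    let ?n = "\<i> * g' (\<phi> \<tau>)" and ?m = "\<i> * g' (?\<psi> \<tau>)"
    have gd: "norm (g (?\<psi> t) - g (\<phi> t)) \<le> K * \<epsilon>" for t
      using order_trans[OF g_lipschitz K(2)[OF \<epsilon>(1)]] .
    have nd: "norm (?m - ?n) \<le> H * (K * \<epsilon>) powr \<alpha>"
    proof -
      have "norm (?m - ?n) = norm (g' (?\<psi> \<tau>) - g' (\<phi> \<tau>))"
        by (simp add: right_diff_distrib[symmetric] norm_mult)
      also have "\<dots> \<le> H * \<bar>?\<psi> \<tau> - \<phi> \<tau>\<bar> powr \<alpha>" by (rule holder)
      also have "\<dots> \<le> H * (K * \<epsilon>) powr \<alpha>" using K(2)[OF \<epsilon>(1)] \<alpha>_pos H_nonneg by (intro mult_left_mono powr_mono2) auto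
      finally show ?thesis .
    qed
    have inc: "\<bar>increment ?\<psi> ?m \<tau> s - increment \<phi> ?n \<tau> s\<bar> \<le> 2 * (K * \<epsilon>) + M * pi * (H * (K * \<epsilon>) powr \<alpha>)"
      if s: "\<bar>s\<bar> \<le> pi" for s
    proof -
      have "increment ?\<psi> ?m \<tau> s - increment \<phi> ?n \<tau> s =
          ((g (?\<psi> (\<tau> + s)) - g (\<phi> (\<tau> + s))) - (g (?\<psi> \<tau>) - g (\<phi> \<tau>))) \<bullet> ?m + (g (\<phi> (\<tau> + s)) - g (\<phi> \<tau>)) \<bullet> (?m - ?n)"
        by (simp add: increment_def inner_diff_left inner_diff_right)
      also have "\<bar>\<dots>\<bar> \<le> \<bar>((g (?\<psi> (\<tau> + s)) - g (\<phi> (\<tau> + s))) - (g (?\<psi> \<tau>) - g (\<phi> \<tau>))) \<bullet> ?m\<bar> + \<bar>(g (\<phi> (\<tau> + s)) - g (\<phi> \<tau>)) \<bullet> (?m - ?n)\<bar>"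
        by (rule abs_triangle_ineq)
      also have "\<dots> \<le> norm ((g (?\<psi> (\<tau> + s)) - g (\<phi> (\<tau> + s))) - (g (?\<psi> \<tau>) - g (\<phi> \<tau>))) * norm ?m
          + norm (g (\<phi> (\<tau> + s)) - g (\<phi> \<tau>)) * norm (?m - ?n)"
        by (intro add_mono Cauchy_Schwarz_ineq2)
      also have "\<dots> \<le> (K * \<epsilon> + K * \<epsilon>) * 1 + (M * pi) * (H * (K * \<epsilon>) powr \<alpha>)"
      proof (intro add_mono mult_mono nd)
        show "norm ((g (?\<psi> (\<tau> + s)) - g (\<phi> (\<tau> + s))) - (g (?\<psi> \<tau>) - g (\<phi> \<tau>))) \<le> K * \<epsilon> + K * \<epsilon>"
          by (rule order_trans[OF norm_triangle_ineq4 add_mono[OF gd gd]])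
        show "norm ?m \<le> 1" by (simp add: norm_mult unit)
        have "norm (g (\<phi> (\<tau> + s)) - g (\<phi> \<tau>)) \<le> \<bar>\<phi> (\<tau> + s) - \<phi> \<tau>\<bar>" by (rule g_lipschitz)
        also have "\<dots> \<le> M * \<bar>s\<bar>" using boundary_liftD(2)[OF \<phi>, of "\<tau> + s" \<tau>] by simp
        also have "\<dots> \<le> M * pi" using s boundary_liftD(4)[OF \<phi>] by (intro mult_left_mono)
        finally show "norm (g (\<phi> (\<tau> + s)) - g (\<phi> \<tau>)) \<le> M * pi" .
      qed (use K \<epsilon> boundary_liftD(4)[OF \<phi>] in auto)
      finally show ?thesis by simp
    qed
    have cK: "continuous_on {-pi..pi} (diff_kernel r)" using r by (intro continuous_diff_kernel) auto
    have i: "(\<lambda>s. diff_kernel r s * of_real (increment \<psi> v \<tau> s)) integrable_on {-pi..pi}" if "boundary_lift M \<psi>" for \<psi> v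
      by (intro integrable_continuous_real continuous_intros cK continuous_increment[OF that])
    have "A ?\<psi> \<tau> - A \<phi> \<tau> = (integral {-pi..pi} (\<lambda>s. diff_kernel r s * of_real (increment ?\<psi> ?m \<tau> s))
        - integral {-pi..pi} (\<lambda>s. diff_kernel r s * of_real (increment \<phi> ?n \<tau> s))) / (2 * pi)"
      unfolding A_def using r directional_gradient_polar[OF \<psi>, of r \<tau> ?m] directional_gradient_polar[OF \<phi>, of r \<tau> ?n]
      by (simp add: diff_divide_distrib)
    also have "\<dots> = integral {-pi..pi} (\<lambda>s. diff_kernel r s * of_real (increment ?\<psi> ?m \<tau> s - increment \<phi> ?n \<tau> s)) / (2 * pi)"
      by (subst integral_diff[symmetric]) (auto simp: i \<phi> \<psi> right_diff_distrib)
    finally have "norm (A ?\<psi> \<tau> - A \<phi> \<tau>) = norm (integral {-pi..pi} (\<lambda>s. diff_kernel r s * of_real (increment ?\<psi> ?m \<tau> s - increment \<phi> ?n \<tau> s))) / (2 * pi)"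
      by (simp add: norm_divide norm_mult)
    also have "\<dots> \<le> (E \<epsilon> * (pi - (-pi))) / (2 * pi)"
    proof (intro divide_right_mono integral_bound)
      show "continuous_on {-pi..pi} (\<lambda>s. diff_kernel r s * of_real (increment ?\<psi> ?m \<tau> s - increment \<phi> ?n \<tau> s))"
        by (intro continuous_intros cK continuous_increment[OF \<phi>] continuous_increment[OF \<psi>])
      fix s assume s: "s \<in> {-pi..pi}"
      have "norm (diff_kernel r s) \<le> 2 / (norm (cis s - of_real r))\<^sup>2" using r by (intro norm_diff_kernel_le) auto
      also have "\<dots> \<le> 2 / (1 - r)\<^sup>2"
        using r cis_minus_real_ge_gap[of r s] by (intro divide_left_mono power_mono mult_pos_pos) (auto simp: zero_less_power2)
      finally have "norm (diff_kernel r s) \<le> 2 / (1 - r)\<^sup>2" .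
      then show "norm (diff_kernel r s * of_real (increment ?\<psi> ?m \<tau> s - increment \<phi> ?n \<tau> s)) \<le> E \<epsilon>"
        using inc[of s] s unfolding norm_mult E_def norm_of_real by (intro mult_mono) auto
    qed auto
    also have "\<dots> = E \<epsilon>" by simp
    finally show ?thesis .
  qed
  have "(E \<longlongrightarrow> 2 / (1 - r)\<^sup>2 * (2 * (K * 0) + M * pi * (H * (K * 0) powr \<alpha>))) (at_right 0)"
    unfolding E_def using \<alpha>_pos K(1)
    by (intro tendsto_intros) (auto intro!: eventually_mono[OF eventually_at_right_real[of 0 1]])
  then have "\<forall>\<^sub>F \<epsilon> in at_right 0. E \<epsilon> < e/4" using e by (intro order_tendstoD(2)) auto
  moreover have "\<forall>\<^sub>F \<epsilon>::real in at_right 0. 0 < \<epsilon> \<and> \<epsilon> < 1"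
    by (intro eventually_mono[OF eventually_at_right_real[of 0 1]]) auto
  ultimately show ?thesis
  proof eventually_elim
    case (elim \<epsilon>)
    let ?\<psi> = "perturbed_lift \<phi> \<epsilon>"
    have \<psi>: "boundary_lift M ?\<psi>" using elim by (intro perturbed_lift_boundary_lift[OF \<phi>]) auto
    show ?case
    proof
      fix \<tau>
      have n1: "norm (A ?\<psi> \<tau> + of_real (normal_deriv ?\<psi> \<tau>)) < e/4"
        using C(2)[OF \<psi> r(2,3), of \<tau>] r(1) by (simp add: A_def)
      have n2: "norm (A \<phi> \<tau> + of_real (normal_deriv \<phi> \<tau>)) < e/4"
        using C(2)[OF \<phi> r(2,3), of \<tau>] r(1) by (simp add: A_def)
      have n3: "norm (A ?\<psi> \<tau> - A \<phi> \<tau>) < e/4" using AE[of \<epsilon> \<tau>] elim by simp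
      define a where "a = A ?\<psi> \<tau> + of_real (normal_deriv ?\<psi> \<tau>)"
      define b where "b = A \<phi> \<tau> + of_real (normal_deriv \<phi> \<tau>)"
      define c where "c = A ?\<psi> \<tau> - A \<phi> \<tau>"
      have "complex_of_real (normal_deriv ?\<psi> \<tau> - normal_deriv \<phi> \<tau>) = a - b - c"
        by (simp add: a_def b_def c_def)
      then have "\<bar>normal_deriv ?\<psi> \<tau> - normal_deriv \<phi> \<tau>\<bar> = norm (a - b - c)"
        by (metis norm_of_real)
      moreover have "norm (a - b - c) \<le> norm (a - b) + norm c" by (rule norm_triangle_ineq4)
      moreover have "norm (a - b) \<le> norm a + norm b" by (rule norm_triangle_ineq4)
      moreover have "norm a < e/4" "norm b < e/4" "norm c < e/4" using n1 n2 n3 by (simp_all add: a_def b_def c_def)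
      ultimately show "\<bar>normal_deriv ?\<psi> \<tau> - normal_deriv \<phi> \<tau>\<bar> < e" using e by linarith
    qed
  qed
qed

end

section \<open>Nonvanishing of the Jacobian\<close>

text \<open>The index about \<open>0\<close> of a loop parametrized by \<open>{0..2*pi}\<close>, in terms of a continuous logarithm. As a relation
it composes well with products and perturbations; the link with winding numbers comes below.\<close>

definition has_index :: "(real \<Rightarrow> complex) \<Rightarrow> int \<Rightarrow> bool" where
  "has_index p k \<longleftrightarrow> (\<exists>A. continuous_on {0..2*pi} A \<and> (\<forall>t\<in>{0..2*pi}. p t = exp (A t)) \<and>
      A (2 * pi) = A 0 + 2 * pi * of_int k * \<i>)"

lemma has_index_mult:
  assumes "has_index p k" "has_index q m" shows "has_index (\<lambda>t. p t * q t) (k + m)"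
proof -
  from assms obtain A B where A: "continuous_on {0..2*pi} A" "\<forall>t\<in>{0..2*pi}. p t = exp (A t)" "A (2*pi) = A 0 + 2 * pi * of_int k * \<i>"
    and B: "continuous_on {0..2*pi} B" "\<forall>t\<in>{0..2*pi}. q t = exp (B t)" "B (2*pi) = B 0 + 2 * pi * of_int m * \<i>"
    unfolding has_index_def by blast
  show ?thesis unfolding has_index_def
    using A B by (intro exI[of _ "\<lambda>t. A t + B t"]) (auto intro!: continuous_intros simp: exp_add algebra_simps)
qed

lemma has_index_const: "c \<noteq> 0 \<Longrightarrow> has_index (\<lambda>t. c) 0"
  unfolding has_index_def by (intro exI[of _ "\<lambda>t. Ln c"]) auto

lemma has_index_cis: "has_index (\<lambda>t. cis (of_int m * t)) m"
  unfolding has_index_def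
  by (intro exI[of _ "\<lambda>t. \<i> * of_real (of_int m * t)"]) (auto intro!: continuous_intros simp: cis_conv_exp)

text \<open>Two loops whose values never differ in direction by a right angle or more have the same index:
the quotient stays in the right half plane, where \<open>Ln\<close> provides a continuous
logarithm that takes equal values at the ends.\<close>

lemma has_index_homotopic:
  assumes p: "has_index p k" "continuous_on {0..2*pi} p" "p (2*pi) = p 0"
    and q: "continuous_on {0..2*pi} q" "q (2*pi) = q 0"
    and pos: "\<And>t. t \<in> {0..2*pi} \<Longrightarrow> 0 < Re (q t * cnj (p t))"
  shows "has_index q k"
proof -
  from p(1) obtain A where A: "continuous_on {0..2*pi} A" "\<And>t. t \<in> {0..2*pi} \<Longrightarrow> p t = exp (A t)" "A (2*pi) = A 0 + 2 * pi * of_int k * \<i>"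
    unfolding has_index_def by blast
  define B where "B t = A t + Ln (q t * cnj (p t)) - Ln (p t * cnj (p t))" for t
  have nz: "q t * cnj (p t) \<noteq> 0" "p t \<noteq> 0" "q t * cnj (p t) \<notin> \<real>\<^sub>\<le>\<^sub>0" "p t * cnj (p t) \<notin> \<real>\<^sub>\<le>\<^sub>0" if t: "t \<in> {0..2*pi}" for t
  proof -
    show "p t \<noteq> 0" using A(2)[OF t] by simp
    have "p t * cnj (p t) = of_real ((norm (p t))\<^sup>2)" by (rule complex_norm_square [symmetric])
    then show "p t * cnj (p t) \<notin> \<real>\<^sub>\<le>\<^sub>0" using \<open>p t \<noteq> 0\<close> by (simp add: complex_nonpos_Reals_iff)
    show "q t * cnj (p t) \<noteq> 0" "q t * cnj (p t) \<notin> \<real>\<^sub>\<le>\<^sub>0"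
      using pos[OF t] by (auto simp: complex_nonpos_Reals_iff simp del: mult_eq_0_iff)
  qed
  have "continuous_on {0..2*pi} B" unfolding B_def
    by (intro continuous_intros A(1) p(2) q(1) continuous_on_Ln') (use nz in auto)
  moreover have "q t = exp (B t)" if t: "t \<in> {0..2*pi}" for t
  proof -
    have "exp (B t) = p t * (q t * cnj (p t)) / (p t * cnj (p t))"
      unfolding B_def exp_diff exp_add using A(2)[OF t] nz[OF t] by simp
    then show ?thesis using nz[OF t] by simp
  qed
  moreover have "B (2*pi) = B 0 + 2 * pi * of_int k * \<i>" unfolding B_def using A(3) p(3) q(2) by simp
  ultimately show ?thesis unfolding has_index_def by blast
qed

lemma winding_number_eq_index:
  assumes p: "has_index p k"
  shows "winding_number (\<lambda>x. p (2 * pi * x)) 0 = of_int k"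
    and "path (\<lambda>x. p (2 * pi * x))" "0 \<notin> path_image (\<lambda>x. p (2 * pi * x))"
proof -
  from p obtain A where A: "continuous_on {0..2*pi} A" "\<And>t. t \<in> {0..2*pi} \<Longrightarrow> p t = exp (A t)" "A (2*pi) = A 0 + 2 * pi * of_int k * \<i>"
    unfolding has_index_def by blast
  let ?P = "\<lambda>x. p (2 * pi * x)"
  have r: "2 * pi * x \<in> {0..2*pi}" if "x \<in> {0..1}" for x
    using that by (auto intro: mult_left_le)
  have cA: "continuous_on {0..1} (\<lambda>x. A (2 * pi * x))"
    by (rule continuous_on_compose2 [OF A(1)]) (use r in \<open>auto intro!: continuous_intros\<close>)
  then have "continuous_on {0..1} (\<lambda>x. exp (A (2 * pi * x)))" by (intro continuous_intros)
  then have "continuous_on {0..1} ?P" by (rule continuous_on_eq) (use A(2)[OF r] in simp)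
  then show path: "path ?P" by (simp add: path_def)
  show nz: "0 \<notin> path_image ?P" using A(2) r by (auto simp: path_image_def)
  obtain q where q: "path q" "pathfinish q - pathstart q = 2 * of_real pi * \<i> * winding_number ?P 0"
    "\<And>t. t \<in> {0..1} \<Longrightarrow> ?P t = 0 + exp (q t)"
    using winding_number_as_continuous_log[OF path nz] by blast
  have "\<exists>n::int. \<forall>x\<in>{0..1}. A (2 * pi * x) - q x = 0 + 2 * pi * n * \<i>"
  proof (rule continuous_constant_exp)
    show "continuous_on {0..1} (\<lambda>x. A (2 * pi * x) - q x)"
      using cA q(1) by (intro continuous_intros) (auto simp: path_def)
    show "exp (A (2 * pi * x) - q x) = exp 0" if "x \<in> {0..1}" for x
      using A(2)[OF r[OF that]] q(3)[OF that] by (simp add: exp_diff)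
  qed simp
  then obtain n :: int where n: "\<And>x. x \<in> {0..1} \<Longrightarrow> A (2 * pi * x) - q x = 2 * pi * n * \<i>" by auto
  have "q 1 - q 0 = A (2 * pi) - A 0" using n[of 0] n[of 1] by (simp add: algebra_simps)
  then have "2 * of_real pi * \<i> * winding_number ?P 0 = 2 * pi * of_int k * \<i>"
    using q(2) A(3) by (simp add: pathfinish_def pathstart_def)
  then show "winding_number ?P 0 = of_int k" by simp
qed

lemma circlepath_rcis: "circlepath 0 r x = rcis r (2 * pi * x)"
  by (simp add: circlepath_def part_circlepath_def rcis_def cis_conv_exp linepath_def scaleR_conv_of_real mult_ac)

text \<open>The argument principle: the index is the number of zeros of \<open>f\<close> in the disk of radius \<open>r\<close>.\<close>

lemma holomorphic_index_counts_zeros: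
  assumes f: "f holomorphic_on ball 0 1" and r: "0 < r" "r < 1"
    and idx: "has_index (\<lambda>t. f (rcis r t)) k"
  shows "0 \<le> k" and "k = 0 \<Longrightarrow> z \<in> ball 0 r \<Longrightarrow> f z \<noteq> 0"
proof -
  obtain \<rho> where \<rho>: "r < \<rho>" "\<rho> < 1" using dense r by blast
  have sub: "ball 0 \<rho> \<subseteq> ball (0::complex) 1" "cball 0 \<rho> \<subseteq> ball (0::complex) 1" using \<rho> by auto
  have nz: "f w \<noteq> 0" if "norm w = r" for w
  proof -
    have "w = circlepath 0 r x" if "x \<in> {0..1}" "w = circlepath 0 r x" for x using that by simp
    moreover have "w \<in> path_image (circlepath 0 r)" using that r by simp
    ultimately obtain x where x: "x \<in> {0..1}" "w = rcis r (2 * pi * x)" by (auto simp: path_image_def circlepath_rcis)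
    then have "f w \<in> path_image (\<lambda>x. f (rcis r (2 * pi * x)))" by (auto simp: path_image_def)
    then show ?thesis using winding_number_eq_index(3)[OF idx] by auto
  qed
  define pz where "pz = {w \<in> ball 0 \<rho>. f w = 0 \<or> w \<in> {}}"
  have nonconst: "\<not> f constant_on ball 0 1 \<or> (\<forall>w\<in>ball 0 1. f w \<noteq> 0)"
  proof (cases "f constant_on ball 0 1")
    case True
    then obtain c where c: "\<And>w. w \<in> ball 0 1 \<Longrightarrow> f w = c" by (auto simp: constant_on_def)
    then show ?thesis using nz[of "of_real r"] c[of "of_real r"] r by auto
  qed simp
  have fin: "finite pz"
  proof (cases "f constant_on ball 0 1")
    case True
    then have "pz = {}" using nonconst sub(1) unfolding pz_def by blast
    then show ?thesis by simp
  next
    case False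
    have "finite {z \<in> cball 0 \<rho>. f z = 0}"
      by (rule holomorphic_compact_finite_zeros[OF f _ _ _ _ False]) (use sub in auto)
    then show ?thesis by (rule rev_finite_subset) (auto simp: pz_def)
  qed
  have "contour_integral (circlepath 0 r) (\<lambda>x. deriv f x * 1 / f x) =
      2 * pi * \<i> * (\<Sum>p\<in>pz. winding_number (circlepath 0 r) p * 1 * zorder f p)"
    unfolding pz_def
  proof (rule argument_principle)
    show "path_image (circlepath 0 r) \<subseteq> ball 0 \<rho> - {w \<in> ball 0 \<rho>. f w = 0 \<or> w \<in> {}}"
      using r \<rho> nz by (auto simp: dist_norm)
    show "\<forall>z. z \<notin> ball 0 \<rho> \<longrightarrow> winding_number (circlepath 0 r) z = 0"
    proof (intro allI impI)
      fix z :: complex assume "z \<notin> ball 0 \<rho>"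
      then show "winding_number (circlepath 0 r) z = 0"
        using r \<rho> by (intro winding_number_zero_outside[of _ "cball 0 r"]) auto
    qed
    show "finite {w \<in> ball 0 \<rho>. f w = 0 \<or> w \<in> {}}" using fin by (simp add: pz_def)
  qed (use f sub in \<open>auto intro: holomorphic_on_subset\<close>)
  moreover have "contour_integral (circlepath 0 r) (\<lambda>x. deriv f x * 1 / f x) = 2 * pi * \<i> * of_int k"
  proof -
    have fc: "f \<circ> circlepath 0 r = (\<lambda>x. f (rcis r (2 * pi * x)))" by (simp add: o_def circlepath_rcis)
    have an: "f analytic_on ball 0 1" using f by (simp add: analytic_on_open)
    have im: "path_image (circlepath 0 r) \<subseteq> ball 0 1" using r by auto
    have v: "valid_path (f \<circ> circlepath 0 r)"
      using valid_path_compose_analytic[OF valid_path_circlepath an im] .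
    have "contour_integral (circlepath 0 r) (\<lambda>x. deriv f x * (1 / f x)) = contour_integral (f \<circ> circlepath 0 r) (\<lambda>w. 1 / w)"
      by (rule contour_integral_comp_analyticW[OF an valid_path_circlepath im, symmetric])
    also have "\<dots> = 2 * pi * \<i> * winding_number (f \<circ> circlepath 0 r) 0"
      using winding_number_valid_path[OF v, of 0] winding_number_eq_index(3)[OF idx] unfolding fc by simp
    also have "\<dots> = 2 * pi * \<i> * of_int k" unfolding fc winding_number_eq_index(1)[OF idx] ..
    finally show ?thesis by simp
  qed
  ultimately have "2 * pi * \<i> * of_int k = 2 * pi * \<i> * (\<Sum>p\<in>pz. winding_number (circlepath 0 r) p * 1 * zorder f p)"
    by simp
  then have k: "of_int k = (\<Sum>p\<in>pz. winding_number (circlepath 0 r) p * of_int (zorder f p))" by simp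
  have zo: "0 < zorder f p" if "p \<in> pz" for p
  proof -
    have p: "p \<in> ball 0 1" "f p = 0" using that sub by (auto simp: pz_def)
    have "\<exists>w\<in>ball 0 1. f w \<noteq> 0" using nz[of "of_real r"] r by (intro bexI[of _ "of_real r"]) auto
    then show ?thesis using zorder_exist_zero[OF f open_ball _ p(1)] p(2) by auto
  qed
  have wn: "winding_number (circlepath 0 r) p = (if norm p < r then 1 else 0)" if "p \<in> pz" for p
  proof -
    have "f p = 0" using that by (simp add: pz_def)
    then have "norm p \<noteq> r" using nz by blast
    then consider "norm p < r" | "norm p > r" by linarith
    then show ?thesis
    proof cases
      case 1
      then show ?thesis using winding_number_circlepath[of p 0 r] by simp
    next
      case 2
      then show ?thesis using r winding_number_zero_outside[of "circlepath 0 r" "cball 0 r" p] by auto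
    qed
  qed
  have "complex_of_int k = (\<Sum>p\<in>pz. of_int (if norm p < r then zorder f p else 0))"
    unfolding k by (intro sum.cong) (auto simp: wn)
  then have "complex_of_int k = of_int (\<Sum>p\<in>pz. (if norm p < r then zorder f p else 0))" by simp
  then have k': "k = (\<Sum>p\<in>pz. (if norm p < r then zorder f p else 0))" by (simp only: of_int_eq_iff)
  show "0 \<le> k" unfolding k' using zo by (intro sum_nonneg) (auto intro: less_imp_le)
  show "f z \<noteq> 0" if "k = 0" "z \<in> ball 0 r"
  proof
    assume "f z = 0"
    then have z: "z \<in> pz" using that \<rho> by (auto simp: pz_def)
    have "(\<Sum>p\<in>pz. (if norm p < r then zorder f p else 0)) = 0" using k' that by simp
    then have "(if norm z < r then zorder f z else 0) = 0"
      using z fin zo by (subst (asm) sum_nonneg_eq_0_iff) (auto intro: less_imp_le)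
    then show False using zo[OF z] that by simp
  qed
qed

lemma cauchy_transform_deriv_diff_bound:
  assumes c: "continuous_on {0..2*pi} \<Phi>" "continuous_on {0..2*pi} \<Psi>" and \<rho>: "\<rho> < 1" "norm z \<le> \<rho>"
    and b: "\<And>t. norm (\<Phi> t - \<Psi> t) \<le> b"
  shows "norm (cauchy_transform_deriv \<Phi> z - cauchy_transform_deriv \<Psi> z) \<le> b / (1 - \<rho>)\<^sup>2"
proof -
  have z: "norm z < 1" using \<rho> by simp
  have nz: "cis t - z \<noteq> 0" for t by (rule cis_minus_nonzero[OF z])
  have i: "(\<lambda>t. cis t * \<Phi> t / (cis t - z)\<^sup>2) integrable_on {0..2*pi}" "(\<lambda>t. cis t * \<Psi> t / (cis t - z)\<^sup>2) integrable_on {0..2*pi}"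
    using nz by (auto intro!: integrable_continuous_real continuous_intros c)
  have "cauchy_transform_deriv \<Phi> z - cauchy_transform_deriv \<Psi> z = integral {0..2*pi} (\<lambda>t. cis t * (\<Phi> t - \<Psi> t) / (cis t - z)\<^sup>2) / (2 * pi)"
    unfolding cauchy_transform_deriv_def diff_divide_distrib[symmetric]
    by (subst integral_diff[symmetric, OF i]) (simp add: diff_divide_distrib right_diff_distrib)
  then have "norm (cauchy_transform_deriv \<Phi> z - cauchy_transform_deriv \<Psi> z) = norm (integral {0..2*pi} (\<lambda>t. cis t * (\<Phi> t - \<Psi> t) / (cis t - z)\<^sup>2)) / (2 * pi)"
    by (simp add: norm_divide norm_mult)
  also have "\<dots> \<le> (b / (1 - \<rho>)\<^sup>2 * (2 * pi - 0)) / (2 * pi)"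
  proof (intro divide_right_mono integral_bound)
    show "continuous_on {0..2*pi} (\<lambda>t. cis t * (\<Phi> t - \<Psi> t) / (cis t - z)\<^sup>2)" using nz by (intro continuous_intros c) auto
    fix t
    have "1 - \<rho> \<le> norm (cis t - z)" using norm_triangle_ineq2[of "cis t" z] \<rho> by simp
    then have "(1 - \<rho>)\<^sup>2 \<le> (norm (cis t - z))\<^sup>2" using \<rho> by (intro power_mono) auto
    moreover have "0 \<le> b" using b[of 0] norm_ge_zero order_trans by blast
    ultimately show "norm (cis t * (\<Phi> t - \<Psi> t) / (cis t - z)\<^sup>2) \<le> b / (1 - \<rho>)\<^sup>2"
      using b[of t] \<rho> by (simp add: norm_divide norm_mult norm_power) (intro frac_le, auto)
  qed auto
  also have "\<dots> = b / (1 - \<rho>)\<^sup>2" by simp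
  finally show ?thesis .
qed

context smooth_jordan_curve
begin

lemma directional_gradient_holomorphic:
  assumes "boundary_lift M \<phi>" shows "directional_gradient \<phi> e holomorphic_on ball 0 1"
  unfolding directional_gradient_def[abs_def] by (intro holomorphic_intros w_z_holomorphic[OF assms])

text \<open>Put \<open>u = z h'\<close> and \<open>v = z k'\<close> on a circle \<open>|z| = r\<close> on which \<open>|v| < |u|\<close> and \<open>Im B < 0\<close>, where
\<open>B = cnj t u + t v\<close> and \<open>t\<close> is the tangent. The latter says that \<open>\<i> (u - cnj v)\<close> stays within a right angle
of \<open>t\<close>, so it has the index \<open>k\<close> of the tangent. As \<open>|v| < |u|\<close>, the functions \<open>u\<close> and
\<open>cnj e u + e v = z f\<^sub>e\<close> have index \<open>k\<close> too. Hence \<open>f\<^sub>e\<close> has index \<open>k - 1\<close>, which is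
nonnegative as a number of zeros; as \<open>k = 1\<close> or \<open>k = -1\<close>, it is \<open>0\<close>.\<close>

lemma directional_gradient_nonzero_strict:
  assumes \<phi>: "boundary_lift M \<phi>" and c: "0 < c" "\<And>s t. s \<le> t \<Longrightarrow> c * (t - s) \<le> \<phi> t - \<phi> s"
    and d: "0 < d" "\<And>\<tau>. d \<le> normal_deriv \<phi> \<tau>"
    and e: "norm e = 1" and z: "z \<in> ball 0 1"
  shows "directional_gradient \<phi> e z \<noteq> 0"
proof -
  obtain r0 where r0: "r0 < 1" "\<And>r \<tau>. r0 < r \<Longrightarrow> r < 1 \<Longrightarrow> norm (w_zbar_cnj \<phi> (rcis r \<tau>)) < norm (w_z \<phi> (rcis r \<tau>)) \<and>
     Im (rcis r \<tau> * directional_gradient \<phi> (g' (\<phi> \<tau>)) (rcis r \<tau>)) < 0"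
    using jacobian_positive_near_circle[OF \<phi> c d] by blast
  obtain r where r: "max r0 (norm z) < r" "r < 1" using dense[of "max r0 (norm z)" 1] r0 z by auto
  have rpos: "0 < r" using r norm_ge_zero[of z] by linarith
  obtain A :: "real \<Rightarrow> complex" and k :: int where A: "continuous_on UNIV A" "\<And>s. g' s = exp (A s)"
    "\<And>s. A (s + l) = A s + 2 * pi * k * \<i>" and k: "k = 1 \<or> k = -1"
    by (rule umlaufsatz) blast
  define u where "u \<tau> = rcis r \<tau> * w_z \<phi> (rcis r \<tau>)" for \<tau>
  define v where "v \<tau> = rcis r \<tau> * w_zbar_cnj \<phi> (rcis r \<tau>)" for \<tau>
  have vu: "norm (v \<tau>) < norm (u \<tau>)" for \<tau>
    using r0(2)[of r \<tau>] r rpos by (simp add: u_def v_def norm_mult)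
  have cr: "continuous_on X (\<lambda>\<tau>. rcis r \<tau>)" for X unfolding rcis_def by (intro continuous_intros)
  have cw: "continuous_on (ball 0 1) (w_z \<phi>)" "continuous_on (ball 0 1) (w_zbar_cnj \<phi>)"
    using w_z_holomorphic[OF \<phi>] by (auto intro: holomorphic_on_imp_continuous_on)
  have cu: "continuous_on X u" and cv: "continuous_on X v" for X
    unfolding u_def v_def using r rpos
    by (intro continuous_intros cr continuous_on_compose2[OF cw(1) cr] continuous_on_compose2[OF cw(2) cr]; force)+
  have rp: "rcis r (2 * pi) = rcis r 0" by (simp add: rcis_def cis_2pi)
  have pu: "u (2*pi) = u 0" "v (2*pi) = v 0" by (simp_all add: u_def v_def rp)
  have \<phi>2: "\<phi> (2*pi) = \<phi> 0 + l" using boundary_liftD(3)[OF \<phi>, of 0] by simp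
  have i0: "has_index (\<lambda>\<tau>. g' (\<phi> \<tau>)) k"
    unfolding has_index_def
    by (intro exI[of _ "\<lambda>\<tau>. A (\<phi> \<tau>)"] conjI continuous_on_compose2[OF A(1) boundary_liftD(5)[OF \<phi>]])
       (auto simp: A(2) A(3) \<phi>2)
  have i1: "has_index (\<lambda>\<tau>. \<i> * (u \<tau> - cnj (v \<tau>))) k"
  proof (rule has_index_homotopic[OF i0])
    show "continuous_on {0..2*pi} (\<lambda>\<tau>. g' (\<phi> \<tau>))"
      by (rule continuous_on_compose2[OF continuous_g' boundary_liftD(5)[OF \<phi>]]) auto
    show "g' (\<phi> (2*pi)) = g' (\<phi> 0)" by (simp add: \<phi>2 per')
    show "continuous_on {0..2*pi} (\<lambda>\<tau>. \<i> * (u \<tau> - cnj (v \<tau>)))" by (intro continuous_intros cu cv)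
    fix \<tau>
    have "Re (\<i> * (u \<tau> - cnj (v \<tau>)) * cnj (g' (\<phi> \<tau>))) = - Im (cnj (g' (\<phi> \<tau>)) * u \<tau> + g' (\<phi> \<tau>) * v \<tau>)"
      by (simp add: algebra_simps)
    also have "cnj (g' (\<phi> \<tau>)) * u \<tau> + g' (\<phi> \<tau>) * v \<tau> = rcis r \<tau> * directional_gradient \<phi> (g' (\<phi> \<tau>)) (rcis r \<tau>)"
      by (simp add: directional_gradient_def u_def v_def algebra_simps)
    finally show "0 < Re (\<i> * (u \<tau> - cnj (v \<tau>)) * cnj (g' (\<phi> \<tau>)))" using r0(2)[of r \<tau>] r by simp
  qed (simp add: pu)
  have bound: "\<bar>Re (x * v \<tau>)\<bar> < (norm (u \<tau>))\<^sup>2" if "norm x = norm (u \<tau>)" for x \<tau>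
  proof -
    have "\<bar>Re (x * v \<tau>)\<bar> \<le> norm (u \<tau>) * norm (v \<tau>)" using abs_Re_le_cmod[of "x * v \<tau>"] that by (simp add: norm_mult)
    also have "\<dots> < norm (u \<tau>) * norm (u \<tau>)" using vu[of \<tau>] by (intro mult_strict_left_mono) (auto intro: le_less_trans[OF norm_ge_zero])
    finally show ?thesis by (simp add: power2_eq_square)
  qed
  have i2: "has_index (\<lambda>\<tau>. \<i> * u \<tau>) k"
  proof (rule has_index_homotopic[OF i1])
    fix \<tau>
    have "\<i> * u \<tau> * cnj (\<i> * (u \<tau> - cnj (v \<tau>))) = u \<tau> * cnj (u \<tau>) - u \<tau> * v \<tau>" by (simp add: algebra_simps)
    also have "u \<tau> * cnj (u \<tau>) = of_real ((norm (u \<tau>))\<^sup>2)" by (rule complex_norm_square[symmetric])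
    finally have "Re (\<i> * u \<tau> * cnj (\<i> * (u \<tau> - cnj (v \<tau>)))) = (norm (u \<tau>))\<^sup>2 - Re (u \<tau> * v \<tau>)" by simp
    then show "0 < Re (\<i> * u \<tau> * cnj (\<i> * (u \<tau> - cnj (v \<tau>))))" using bound[of "u \<tau>" \<tau>] by simp
  qed (auto intro!: continuous_intros cu cv simp: pu)
  have "has_index (\<lambda>\<tau>. (\<i> * u \<tau>) * (- \<i> * cnj e)) (k + 0)"
    using e by (intro has_index_mult[OF i2] has_index_const) auto
  then have i3: "has_index (\<lambda>\<tau>. cnj e * u \<tau>) k" by (simp add: mult_ac)
  have i4: "has_index (\<lambda>\<tau>. cnj e * u \<tau> + e * v \<tau>) k"
  proof (rule has_index_homotopic[OF i3])
    fix \<tau>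
    have ee: "cnj e * e = 1" using e complex_norm_square[of e] by (simp add: mult.commute)
    have "(cnj e * u \<tau> + e * v \<tau>) * cnj (cnj e * u \<tau>) = (cnj e * e) * (u \<tau> * cnj (u \<tau>)) + (e * e * cnj (u \<tau>)) * v \<tau>"
      by (simp add: algebra_simps)
    also have "u \<tau> * cnj (u \<tau>) = of_real ((norm (u \<tau>))\<^sup>2)" by (rule complex_norm_square[symmetric])
    finally have "Re ((cnj e * u \<tau> + e * v \<tau>) * cnj (cnj e * u \<tau>)) = (norm (u \<tau>))\<^sup>2 + Re ((e * e * cnj (u \<tau>)) * v \<tau>)"
      unfolding ee by simp
    then show "0 < Re ((cnj e * u \<tau> + e * v \<tau>) * cnj (cnj e * u \<tau>))"
      using bound[of "e * e * cnj (u \<tau>)" \<tau>] e by (simp add: norm_mult)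
  qed (auto intro!: continuous_intros cu cv simp: pu)
  have "has_index (\<lambda>\<tau>. (cnj e * u \<tau> + e * v \<tau>) * (cis (of_int (-1) * \<tau>) * (1 / of_real r))) (k + (-1 + 0))"
    using rpos by (intro has_index_mult[OF i4] has_index_mult has_index_cis has_index_const) auto
  moreover have "(cnj e * u \<tau> + e * v \<tau>) * (cis (of_int (-1) * \<tau>) * (1 / of_real r)) = directional_gradient \<phi> e (rcis r \<tau>)" for \<tau>
  proof -
    have "cnj e * u \<tau> + e * v \<tau> = of_real r * cis \<tau> * directional_gradient \<phi> e (rcis r \<tau>)"
      by (simp add: u_def v_def directional_gradient_def rcis_def algebra_simps)
    moreover have "cis \<tau> * cis (- \<tau>) = 1" by (simp add: cis_mult)
    ultimately show ?thesis using rpos by (simp add: field_simps)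
  qed
  ultimately have idx: "has_index (\<lambda>\<tau>. directional_gradient \<phi> e (rcis r \<tau>)) (k - 1)" by simp
  note cnt = holomorphic_index_counts_zeros[OF directional_gradient_holomorphic[OF \<phi>] rpos r(2) idx]
  have "k - 1 = 0" using cnt(1) k by auto
  then show ?thesis using cnt(2)[of z] r by auto
qed

text \<open>By Rolle's theorem applied to \<open>g \<bullet> e\<close>, some tangent of the curve is orthogonal to \<open>e\<close>, so at some
boundary point \<open>e\<close> is the normal up to sign. There the limit of the gradient in the direction \<open>e\<close> is plus
or minus the normal derivative, which is not zero.\<close>

lemma directional_gradient_not_identically_zero:
  assumes \<phi>: "boundary_lift M \<phi>" and pos: "\<And>\<tau>. normal_deriv \<phi> \<tau> > 0" and e: "norm e = 1"
  shows "\<exists>z\<in>ball 0 1. directional_gradient \<phi> e z \<noteq> 0"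
proof (rule ccontr)
  assume "\<not> ?thesis"
  then have zero: "\<And>z. z \<in> ball 0 1 \<Longrightarrow> directional_gradient \<phi> e z = 0" by blast
  let ?h = "\<lambda>s. g s \<bullet> e"
  have hd: "(?h has_real_derivative g' s \<bullet> e) (at s)" for s
    using bounded_linear.has_vector_derivative[OF bounded_linear_inner_left der]
    by (simp add: has_real_derivative_iff_has_vector_derivative)
  have "\<exists>s. \<phi> 0 < s \<and> s < \<phi> 0 + l \<and> (?h has_real_derivative 0) (at s)"
  proof (rule Rolle)
    show "continuous_on {\<phi> 0..\<phi> 0 + l} ?h" by (intro continuous_intros continuous_g)
    show "?h differentiable (at x)" for x using hd real_differentiable_def by blast
  qed (use l_pos per in auto)
  then obtain s where s: "\<phi> 0 < s" "s < \<phi> 0 + l" "(?h has_real_derivative 0) (at s)" by blast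
  then have orth: "g' s \<bullet> e = 0" using hd DERIV_unique by blast
  have "\<phi> (2 * pi) = \<phi> 0 + l" using boundary_liftD(3)[OF \<phi>, of 0] by simp
  then obtain \<tau> where \<tau>: "\<phi> \<tau> = s"
    using IVT'[of \<phi> 0 s "2*pi"] s boundary_liftD(5)[OF \<phi>] by (metis less_imp_le pi_ge_zero zero_le_mult_iff zero_le_numeral)
  define n where "n = \<i> * g' (\<phi> \<tau>)"
  have "n = e \<or> n = - e"
  proof -
    define x where "x = cnj (g' s) * e"
    have rx: "Re x = 0" using orth by (simp add: x_def inner_complex_def)
    have "norm x = 1" using e unit by (simp add: x_def norm_mult)
    then have "\<bar>Im x\<bar> = 1" using rx by (simp add: cmod_def)
    then have "x = \<i> \<or> x = - \<i>" using rx by (auto simp: complex_eq_iff abs_if split: if_splits)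
    moreover have "g' s * x = e" using complex_norm_square[of "g' s"] unit[of s] by (simp add: x_def mult.assoc[symmetric])
    ultimately show ?thesis by (auto simp: n_def \<tau> mult.commute)
  qed
  then have zn: "directional_gradient \<phi> n z = 0" if "z \<in> ball 0 1" for z
    using zero[OF that] by (auto simp: directional_gradient_def add_eq_0_iff)
  obtain C where C: "C > 0" "\<And>r \<tau>. 1/4 \<le> r \<Longrightarrow> r < 1 \<Longrightarrow>
     norm (rcis r \<tau> * directional_gradient \<phi> (\<i> * g' (\<phi> \<tau>)) (rcis r \<tau>) + of_real (normal_deriv \<phi> \<tau>)) \<le> C * (1 - r) powr (\<alpha>/2)"
    using normal_gradient_rate[of M] \<phi> by blast
  have "\<forall>\<^sub>F r in at_left 1. C * (1 - r) powr (\<alpha>/2) < normal_deriv \<phi> \<tau>"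
    by (rule order_tendstoD(2)[OF gap_powr_tendsto_0]) (use pos[of \<tau>] \<alpha>_pos in auto)
  moreover have "\<forall>\<^sub>F r in at_left 1. 1/4 < r \<and> r < (1::real)"
    by (intro eventually_mono[OF eventually_at_left_real[of "1/4" 1]]) auto
  ultimately have "\<forall>\<^sub>F r in at_left (1::real). False"
  proof eventually_elim
    case (elim r)
    then show ?case using C(2)[of r \<tau>] zn[of "rcis r \<tau>"] pos[of \<tau>] by (simp add: n_def)
  qed
  then show False by simp
qed

text \<open>The gradients of the perturbed lifts have no zeros and converge locally uniformly, so Hurwitz's theorem
applies unless the limit is constant; a constant limit is nonzero because the limit does not vanish
identically.\<close>

lemma directional_gradient_nonzero:
  assumes \<phi>: "boundary_lift M \<phi>" and pos: "\<And>\<tau>. normal_deriv \<phi> \<tau> > 0"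
    and e: "norm e = 1" and z: "z \<in> ball 0 1"
  shows "directional_gradient \<phi> e z \<noteq> 0"
proof (cases "directional_gradient \<phi> e constant_on ball 0 1")
  case True
  then show ?thesis
    using directional_gradient_not_identically_zero[OF \<phi> pos e] z by (auto simp: constant_on_def)
next
  case False
  obtain d where d: "d > 0" "\<And>\<tau>. d \<le> normal_deriv \<phi> \<tau>" using normal_deriv_lower_bound[OF \<phi> pos] by blast
  have "\<forall>\<^sub>F \<epsilon> in at_right 0. \<forall>\<tau>. \<bar>normal_deriv (perturbed_lift \<phi> \<epsilon>) \<tau> - normal_deriv \<phi> \<tau>\<bar> < d/2"
    using d by (intro normal_deriv_perturbed[OF \<phi>]) auto
  then obtain b where b: "b > 0" "\<And>\<epsilon> \<tau>. 0 < \<epsilon> \<Longrightarrow> \<epsilon> < b \<Longrightarrow> \<bar>normal_deriv (perturbed_lift \<phi> \<epsilon>) \<tau> - normal_deriv \<phi> \<tau>\<bar> < d/2"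
    unfolding eventually_at_right_field by blast
  \<comment> \<open>The shift by \<open>2\<close> makes \<open>\<epsilon> n < b\<close> strict.\<close>
  define \<epsilon> where "\<epsilon> n = min b 1 / (real n + 2)" for n
  have \<epsilon>: "0 < \<epsilon> n" "\<epsilon> n < b" "\<epsilon> n \<le> 1" for n
  proof -
    show "0 < \<epsilon> n" using b by (simp add: \<epsilon>_def)
    have "min b 1 / (real n + 2) < min b 1 / 1" using b by (intro divide_strict_left_mono) auto
    then have "\<epsilon> n < min b 1" by (simp add: \<epsilon>_def)
    then show "\<epsilon> n < b" "\<epsilon> n \<le> 1" by auto
  qed
  have \<epsilon>0: "\<epsilon> \<longlonglongrightarrow> 0"
    unfolding \<epsilon>_def by (rule tendsto_divide_0[OF tendsto_const]) (intro filterlim_at_top_imp_at_infinity filterlim_tendsto_add_at_top[OF tendsto_const filterlim_real_sequentially, of 2, simplified add.commute])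
  let ?\<psi> = "\<lambda>n. perturbed_lift \<phi> (\<epsilon> n)"
  have \<psi>: "boundary_lift M (?\<psi> n)" for n using \<epsilon>[of n] by (intro perturbed_lift_boundary_lift[OF \<phi>]) auto
  obtain K where K: "K > 0" "\<And>\<epsilon> t. 0 \<le> \<epsilon> \<Longrightarrow> \<bar>perturbed_lift \<phi> \<epsilon> t - \<phi> t\<bar> \<le> K * \<epsilon>"
    using perturbed_lift_close[OF \<phi>] by blast
  show ?thesis
  proof (rule Hurwitz_no_zeros[of "ball 0 1" "\<lambda>n. directional_gradient (?\<psi> n) e" "directional_gradient \<phi> e"])
    show "directional_gradient (?\<psi> n) e holomorphic_on ball 0 1" for n by (rule directional_gradient_holomorphic[OF \<psi>])
    show "directional_gradient \<phi> e holomorphic_on ball 0 1" by (rule directional_gradient_holomorphic[OF \<phi>])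
    show "directional_gradient (?\<psi> n) e z \<noteq> 0" if "z \<in> ball 0 1" for n z
    proof (rule directional_gradient_nonzero_strict[OF \<psi> _ _ _ _ e that])
      show "0 < \<epsilon> n * (l / (2 * pi))" using \<epsilon>[of n] l_pos by simp
      show "(\<epsilon> n * (l / (2 * pi))) * (t - s) \<le> ?\<psi> n t - ?\<psi> n s" if "s \<le> t" for s t
        using \<epsilon>[of n] that by (intro perturbed_lift_slope[OF \<phi>]) auto
      show "0 < d/2" using d by simp
      show "d/2 \<le> normal_deriv (?\<psi> n) \<tau>" for \<tau>
        using b(2)[OF \<epsilon>(1,2), of n \<tau>] d(2)[of \<tau>] by linarith
    qed
    fix S :: "complex set" assume S: "compact S" "S \<subseteq> ball 0 1"
    have "\<exists>\<rho><1. \<forall>z\<in>S. norm z \<le> \<rho>"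
    proof (cases "S = {}")
      case False
      then obtain x where "x \<in> S" "\<forall>y\<in>S. norm y \<le> norm x"
        using continuous_attains_sup[OF S(1), of norm] by (auto intro!: continuous_intros)
      then show ?thesis using S(2) by (intro exI[of _ "norm x"]) auto
    qed (auto intro: exI[of _ 0])
    then obtain \<rho> where \<rho>: "\<rho> < 1" "\<And>z. z \<in> S \<Longrightarrow> norm z \<le> \<rho>" by blast
    have close: "norm (directional_gradient (?\<psi> n) e z - directional_gradient \<phi> e z) \<le> 2 * (K * \<epsilon> n / (1 - \<rho>)\<^sup>2)" if "z \<in> S" for n z
    proof -
      have gd: "norm (g (?\<psi> n t) - g (\<phi> t)) \<le> K * \<epsilon> n" for t
        using order_trans[OF g_lipschitz K(2)] \<epsilon>[of n] by simp
      have gd': "norm (cnj (g (?\<psi> n t)) - cnj (g (\<phi> t))) \<le> K * \<epsilon> n" for t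
        using gd[of t] by (simp add: complex_cnj_diff[symmetric] del: complex_cnj_diff)
      define a where "a = w_z (?\<psi> n) z - w_z \<phi> z"
      define b where "b = w_zbar_cnj (?\<psi> n) z - w_zbar_cnj \<phi> z"
      have "norm a \<le> K * \<epsilon> n / (1 - \<rho>)\<^sup>2"
        unfolding a_def by (rule cauchy_transform_deriv_diff_bound[OF continuous_boundary_values[OF \<psi>] continuous_boundary_values[OF \<phi>] \<rho>(1) \<rho>(2)[OF that] gd])
      moreover have "norm b \<le> K * \<epsilon> n / (1 - \<rho>)\<^sup>2"
        unfolding b_def by (rule cauchy_transform_deriv_diff_bound[OF _ _ \<rho>(1) \<rho>(2)[OF that] gd'])
          (intro continuous_intros continuous_boundary_values[OF \<psi>] continuous_boundary_values[OF \<phi>])+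
      moreover have "directional_gradient (?\<psi> n) e z - directional_gradient \<phi> e z = cnj e * a + e * b"
        by (simp add: directional_gradient_def a_def b_def algebra_simps)
      moreover have "norm (cnj e * a + e * b) \<le> norm a + norm b"
        using norm_triangle_ineq[of "cnj e * a" "e * b"] e by (simp add: norm_mult)
      ultimately show ?thesis by simp
    qed
    have lim: "(\<lambda>n. 2 * (K * \<epsilon> n / (1 - \<rho>)\<^sup>2)) \<longlonglongrightarrow> 2 * (K * 0 / (1 - \<rho>)\<^sup>2)"
      using \<rho>(1) by (intro tendsto_intros \<epsilon>0) auto
    show "uniform_limit S (\<lambda>n. directional_gradient (?\<psi> n) e) (directional_gradient \<phi> e) sequentially"
    proof (rule uniform_limitI)
      fix \<eta> :: real assume "\<eta> > 0"
      then have "\<forall>\<^sub>F n in sequentially. 2 * (K * \<epsilon> n / (1 - \<rho>)\<^sup>2) < \<eta>" using order_tendstoD(2)[OF lim, of \<eta>] by simp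
      then show "\<forall>\<^sub>F n in sequentially. \<forall>z\<in>S. dist (directional_gradient (?\<psi> n) e z) (directional_gradient \<phi> e z) < \<eta>"
        by eventually_elim (use close in \<open>auto simp: dist_norm intro: le_less_trans\<close>)
    qed
  qed (use False z in auto)
qed

text \<open>If \<open>|p| = |q|\<close>, some unit \<open>e\<close> satisfies \<open>cnj e p + e q = 0\<close>: a square root of \<open>- p / q\<close>.\<close>

lemma jacobian_nonzero:
  assumes \<phi>: "boundary_lift M \<phi>" and pos: "\<And>\<tau>. normal_deriv \<phi> \<tau> > 0" and z: "z \<in> ball 0 1"
  shows "norm (w_z \<phi> z) \<noteq> norm (w_zbar_cnj \<phi> z)"
proof
  assume eq: "norm (w_z \<phi> z) = norm (w_zbar_cnj \<phi> z)"
  let ?p = "w_z \<phi> z" and ?q = "w_zbar_cnj \<phi> z"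
  have "\<exists>e. norm e = 1 \<and> cnj e * ?p + e * ?q = 0"
  proof (cases "?q = 0")
    case True
    then show ?thesis using eq by (intro exI[of _ 1]) auto
  next
    case False
    define e where "e = csqrt (- ?p / ?q)"
    have e2: "e * e = - ?p / ?q" unfolding e_def by (metis power2_csqrt power2_eq_square)
    have "norm e * norm e = 1" using arg_cong[OF e2, of norm] eq False by (simp add: norm_mult norm_divide)
    then have ne: "norm e = 1" by (metis norm_ge_zero abs_of_nonneg real_sqrt_mult_self real_sqrt_one real_sqrt_abs2)
    have "cnj e * e = 1" using ne complex_norm_square[of e] by (simp add: mult.commute)
    then have "cnj e * ?p + e * ?q = cnj e * (?p + (e * e) * ?q)" by (simp add: algebra_simps)
    also have "\<dots> = 0" unfolding e2 using False by simp
    finally show ?thesis using ne by blast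
  qed
  then show False using directional_gradient_nonzero[OF \<phi> pos _ z] by (auto simp: directional_gradient_def)
qed

end

section \<open>Local homeomorphisms onto a Jordan domain\<close>

text \<open>The fibre over \<open>p\<close> is compact and discrete, hence finite; \<open>w\<close> is injective on disjoint discs \<open>V z\<close>
around its points. By properness, the points that are mapped near \<open>p\<close> but lie outside these discs have a
compact image \<open>w ` L\<close> that misses \<open>p\<close>. Removing it from the intersection of the \<open>w ` V z\<close> leaves an evenly covered
neighbourhood of \<open>p\<close>.\<close>

lemma proper_local_homeo_covering:
  fixes w :: "complex \<Rightarrow> complex"
  assumes U: "open U" and D: "open D" and cont: "continuous_on U w" and im: "w ` U = D"
    and loc: "\<And>z. z \<in> U \<Longrightarrow> \<exists>N. open N \<and> z \<in> N \<and> N \<subseteq> U \<and> inj_on w N"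
    and proper: "\<And>K. compact K \<Longrightarrow> K \<subseteq> D \<Longrightarrow> compact (U \<inter> w -` K)"
  shows "covering_space U w D"
proof (rule covering_spaceI [OF cont im])
  fix p assume p: "p \<in> D"
  obtain N where N: "\<And>z. z \<in> U \<Longrightarrow> open (N z) \<and> z \<in> N z \<and> N z \<subseteq> U \<and> inj_on w (N z)"
    using loc by metis
  define Fb where "Fb = U \<inter> w -` {p}"
  have "compact Fb" unfolding Fb_def using p by (intro proper) auto
  moreover have "Fb \<subseteq> \<Union>(N ` Fb)" "\<forall>B\<in>N ` Fb. open B" using N by (auto simp: Fb_def)
  ultimately obtain X where X: "X \<subseteq> N ` Fb" "finite X" "Fb \<subseteq> \<Union>X" using compactE by metis
  then obtain Y where Y: "Y \<subseteq> Fb" "finite Y" "X = N ` Y" by (metis finite_subset_image)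
  have "Fb \<subseteq> Y"
  proof
    fix x assume x: "x \<in> Fb"
    then obtain y where y: "y \<in> Y" "x \<in> N y" using X Y by auto
    then have "y \<in> U" "w y = w x" using x Y by (auto simp: Fb_def)
    then have "x = y" using N[of y] y x by (metis inj_onD)
    then show "x \<in> Y" using y by simp
  qed
  then have fin: "finite Fb" using Y finite_subset by blast
  have FbU: "Fb \<subseteq> U" by (auto simp: Fb_def)
  have "\<exists>\<delta>>0. \<forall>z\<in>Fb. ball z \<delta> \<subseteq> N z"
  proof -
    have "\<exists>d>0. ball z d \<subseteq> N z" if "z \<in> Fb" for z using N[of z] FbU that open_contains_ball by blast
    then obtain d where d: "\<And>z. z \<in> Fb \<Longrightarrow> d z > 0 \<and> ball z (d z) \<subseteq> N z" by metis
    show ?thesis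
    proof (cases "Fb = {}")
      case False
      have "Min (d ` Fb) > 0" using fin False d by (subst Min_gr_iff) auto
      moreover have "ball z (Min (d ` Fb)) \<subseteq> N z" if "z \<in> Fb" for z
      proof -
        have "Min (d ` Fb) \<le> d z" using fin that by (intro Min_le) auto
        then show ?thesis using d[OF that] subset_ball by blast
      qed
      ultimately show ?thesis by blast
    qed (auto intro: exI[of _ 1])
  qed
  then obtain \<delta>1 where \<delta>1: "\<delta>1 > 0" "\<And>z. z \<in> Fb \<Longrightarrow> ball z \<delta>1 \<subseteq> N z" by blast
  have "\<exists>\<delta>>0. \<forall>x\<in>Fb. \<forall>y\<in>Fb. x \<noteq> y \<longrightarrow> \<delta> \<le> dist x y"
  proof -
    let ?A = "(\<lambda>(x, y). dist x y) ` ({(x, y). x \<in> Fb \<and> y \<in> Fb \<and> x \<noteq> y})"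
    have "finite {(x, y). x \<in> Fb \<and> y \<in> Fb \<and> x \<noteq> y}" by (rule finite_subset[of _ "Fb \<times> Fb"]) (use fin in auto)
    then have fA: "finite (insert 1 ?A)" by simp
    have "Min (insert 1 ?A) > 0" using fA by (subst Min_gr_iff) auto
    moreover have "Min (insert 1 ?A) \<le> dist x y" if "x \<in> Fb" "y \<in> Fb" "x \<noteq> y" for x y
      using that by (intro Min_le fA) (auto intro!: image_eqI[of _ _ "(x, y)"])
    ultimately show ?thesis by blast
  qed
  then obtain \<delta>2 where \<delta>2: "\<delta>2 > 0" "\<And>x y. x \<in> Fb \<Longrightarrow> y \<in> Fb \<Longrightarrow> x \<noteq> y \<Longrightarrow> \<delta>2 \<le> dist x y" by blast
  define \<delta> where "\<delta> = min \<delta>1 (\<delta>2 / 2)"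
  have \<delta>: "\<delta> > 0" using \<delta>1 \<delta>2 by (simp add: \<delta>_def)
  define V where "V z = ball z \<delta>" for z :: complex
  have VN: "V z \<subseteq> N z" if "z \<in> Fb" for z using \<delta>1(2)[OF that] by (auto simp: V_def \<delta>_def)
  have VU: "V z \<subseteq> U" if "z \<in> Fb" for z using VN[OF that] N[of z] FbU that by blast
  have Vinj: "inj_on w (V z)" if "z \<in> Fb" for z using VN[OF that] N[of z] FbU that inj_on_subset by blast
  have Vdis: "V x \<inter> V y = {}" if "x \<in> Fb" "y \<in> Fb" "x \<noteq> y" for x y
  proof -
    have "2 * \<delta> \<le> dist x y" using \<delta>2(2)[OF that] by (simp add: \<delta>_def)
    then show ?thesis unfolding V_def by (intro disjoint_ballI) simp
  qed
  have wV: "open (w ` V z)" if "z \<in> Fb" for z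
    by (rule invariance_of_domain) (use VU[OF that] Vinj[OF that] cont continuous_on_subset in \<open>auto simp: V_def\<close>)
  obtain r0 where r0: "r0 > 0" "cball p r0 \<subseteq> D" using D p open_contains_cball by blast
  define L where "L = (U \<inter> w -` cball p r0) - (\<Union>z\<in>Fb. V z)"
  have "compact L" unfolding L_def by (intro compact_diff proper r0) (auto simp: V_def)
  then have "compact (w ` L)" by (intro compact_continuous_image continuous_on_subset[OF cont]) (auto simp: L_def)
  then have oL: "open (- (w ` L))" by (simp add: compact_imp_closed open_Compl)
  have pL: "p \<notin> w ` L" using \<delta> by (auto simp: L_def Fb_def V_def)
  define Q where "Q = ball p r0 \<inter> - (w ` L) \<inter> (\<Inter>z\<in>Fb. w ` V z)"
  have "open Q" unfolding Q_def using fin wV by (intro open_Int open_INT oL) auto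
  moreover have "p \<in> Q" unfolding Q_def using pL r0 \<delta> by (auto simp: Fb_def V_def intro!: image_eqI)
  ultimately obtain T where T: "p \<in> T" "open T" "T \<subseteq> Q" by blast
  have TD: "T \<subseteq> D" using T(3) r0(2) ball_subset_cball[of p r0] unfolding Q_def by blast
  define v where "v = (\<lambda>z. V z \<inter> w -` T) ` Fb"
  have openV: "open (V z \<inter> w -` T)" if "z \<in> Fb" for z
    using VU[OF that] T(2) by (intro continuous_open_preimage continuous_on_subset[OF cont]) (auto simp: V_def)
  show "\<exists>T. p \<in> T \<and> openin (top_of_set D) T \<and> (\<exists>v. \<Union>v = U \<inter> w -` T \<and> (\<forall>u\<in>v. openin (top_of_set U) u) \<and>
           pairwise disjnt v \<and> (\<forall>u\<in>v. \<exists>q. homeomorphism u T w q))"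
  proof (intro exI[of _ T] exI[of _ v] conjI ballI)
    show "p \<in> T" by fact
    show "openin (top_of_set D) T" using T(2) TD by (simp add: open_subset)
    show "\<Union>v = U \<inter> w -` T"
    proof
      show "\<Union>v \<subseteq> U \<inter> w -` T" using VU by (auto simp: v_def)
      show "U \<inter> w -` T \<subseteq> \<Union>v"
      proof
        fix x assume x: "x \<in> U \<inter> w -` T"
        then have "w x \<in> Q" using T by auto
        then have "x \<notin> L" "w x \<in> cball p r0" by (auto simp: Q_def)
        then show "x \<in> \<Union>v" using x by (auto simp: L_def v_def)
      qed
    qed
    show "openin (top_of_set U) u" if u: "u \<in> v" for u
    proof -
      obtain z where z: "z \<in> Fb" "u = V z \<inter> w -` T" using u unfolding v_def by blast
      have "u \<subseteq> U" using VU[OF z(1)] z(2) by blast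
      then show ?thesis using openV[OF z(1)] z(2) by (simp add: open_subset)
    qed
    show "pairwise disjnt v"
      unfolding pairwise_def v_def disjnt_def
    proof (intro ballI impI)
      fix A B assume "A \<in> (\<lambda>z. V z \<inter> w -` T) ` Fb" "B \<in> (\<lambda>z. V z \<inter> w -` T) ` Fb" "A \<noteq> B"
      then obtain x y where "x \<in> Fb" "y \<in> Fb" "A = V x \<inter> w -` T" "B = V y \<inter> w -` T" "x \<noteq> y" by blast
      then show "A \<inter> B = {}" using Vdis[of x y] by blast
    qed
    fix u assume "u \<in> v"
    then obtain z where z: "z \<in> Fb" "u = V z \<inter> w -` T" by (auto simp: v_def)
    have "T \<subseteq> w ` V z" using T(3) z(1) unfolding Q_def by blast
    then have "w ` u = T" unfolding z(2) by blast
    moreover have "\<exists>q. homeomorphism u (w ` u) w q"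
    proof -
      have "u \<subseteq> U" "inj_on w u" "open u"
        using VU[OF z(1)] z(2) inj_on_subset[OF Vinj[OF z(1)]] openV[OF z(1)] by auto
      then show ?thesis
        using invariance_of_domain_homeomorphism[of u w] continuous_on_subset[OF cont] by blast
    qed
    ultimately show "\<exists>q. homeomorphism u T w q" by simp
  qed
qed

text \<open>A simply connected base has a section \<open>q\<close>. By uniqueness of lifts on the connected space \<open>U\<close>, \<open>q \<circ> w\<close>
is the identity as soon as it fixes one point, and it fixes every point in the range of \<open>q\<close>.\<close>

lemma covering_of_simply_connected_inj:
  fixes w :: "complex \<Rightarrow> complex"
  assumes cov: "covering_space U w D" and U: "connected U" and D: "simply_connected D" "open D"
  shows "inj_on w U"
proof (cases "U = {}")
  case False
  obtain q where q: "continuous_on D q" "q \<in> D \<rightarrow> U" "\<And>y. y \<in> D \<Longrightarrow> w (q y) = y"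
    using covering_space_lift[OF cov D(1) open_imp_locally_path_connected[OF D(2)], of id] by auto
  have cw: "continuous_on U w" and wU: "w ` U = D"
    using covering_space_imp_continuous[OF cov] covering_space_imp_surjective[OF cov] by auto
  obtain z where z: "z \<in> U" using False by blast
  define a where "a = q (w z)"
  have a: "a \<in> U" using q(2) wU z by (auto simp: a_def)
  have wa: "w a = w z" using q(3) wU z by (auto simp: a_def)
  have "q (w x) = x" if x: "x \<in> U" for x
  proof (rule covering_space_lift_unique[OF cov, of "\<lambda>x. q (w x)" a "\<lambda>x. x" U w x])
    show "q (w a) = a" by (simp add: a_def wa[unfolded a_def])
    show "continuous_on U (\<lambda>x. q (w x))" by (rule continuous_on_compose2[OF q(1) cw]) (use wU in auto)
  qed (use q wU cw U a x in auto)
  then show ?thesis by (metis inj_onI)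
qed simp

text \<open>A connected set that meets \<open>D\<close> but not its frontier lies in \<open>D\<close>. By boundedness \<open>D\<close> cannot contain the
outside of the curve, so it misses the outside and contains the inside.\<close>

lemma jordan_domain_eq_inside:
  fixes c :: "real \<Rightarrow> complex"
  assumes c: "simple_path c" "pathfinish c = pathstart c"
    and D: "open D" "connected D" "D \<noteq> {}" "bounded D" "frontier D = path_image c"
  shows "D = inside (path_image c)"
proof -
  note J = Jordan_inside_outside[OF c]
  have disj: "D \<inter> path_image c = {}" using D(1,5) frontier_disjoint_eq by blast
  have uni: "inside (path_image c) \<union> outside (path_image c) = - path_image c" by (rule inside_Un_outside)
  have "D \<inter> outside (path_image c) = {}"
  proof (rule ccontr)
    assume ne: "D \<inter> outside (path_image c) \<noteq> {}"
    have "\<not> outside (path_image c) \<subseteq> D" using J D(4) bounded_subset by metis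
    then have "outside (path_image c) - D \<noteq> {}" by blast
    moreover have "outside (path_image c) \<inter> D \<noteq> {}" using ne by blast
    moreover have "connected (outside (path_image c))" using J by simp
    ultimately have "outside (path_image c) \<inter> frontier D \<noteq> {}" by (metis connected_Int_frontier)
    then show False using D(5) uni by blast
  qed
  then have sub: "D \<subseteq> inside (path_image c)" using disj uni by blast
  moreover have "inside (path_image c) \<subseteq> D"
  proof (rule ccontr)
    assume "\<not> inside (path_image c) \<subseteq> D"
    then have "inside (path_image c) - D \<noteq> {}" by blast
    moreover have "inside (path_image c) \<inter> D \<noteq> {}" using sub D(3) by blast
    moreover have "connected (inside (path_image c))" using J by simp
    ultimately have "inside (path_image c) \<inter> frontier D \<noteq> {}" by (metis connected_Int_frontier)
    then show False using D(5) uni by blast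
  qed
  ultimately show ?thesis by blast
qed

text \<open>The image of the open disk is open, and its frontier lies on the curve, since the closed disk has a compact
image and the circle goes to the curve. So the image is a union of components of the complement of
the curve and, being bounded, equals \<open>D\<close>. The map is proper because a compact \<open>K\<close> in \<open>D\<close> has no
preimages on the circle.\<close>

lemma local_homeo_onto_jordan_domain:
  fixes W :: "complex \<Rightarrow> complex" and c :: "real \<Rightarrow> complex"
  assumes c: "simple_path c" "pathfinish c = pathstart c"
    and D: "open D" "connected D" "D \<noteq> {}" "bounded D" "frontier D = path_image c"
    and W: "continuous_on (cball 0 1) W" "W ` sphere 0 1 = path_image c"
    and loc: "\<And>z. z \<in> ball 0 1 \<Longrightarrow> \<exists>N. open N \<and> z \<in> N \<and> N \<subseteq> ball 0 1 \<and> inj_on W N"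
  shows "bij_betw W (ball 0 1) D"
proof -
  note J = Jordan_inside_outside[OF c]
  note Deq = jordan_domain_eq_inside[OF c D]
  let ?\<gamma> = "path_image c" and ?V = "W ` ball 0 1"
  have uni: "inside ?\<gamma> \<union> outside ?\<gamma> = - ?\<gamma>" by (rule inside_Un_outside)
  have split: "cball (0::complex) 1 = ball 0 1 \<union> sphere 0 1" by auto
  have cW: "continuous_on (ball 0 1) W" by (rule continuous_on_subset[OF W(1)]) auto
  have openV: "open ?V"
  proof (subst open_subopen, intro ballI)
    fix y assume "y \<in> ?V"
    then obtain z where z: "z \<in> ball 0 1" "y = W z" by blast
    obtain N where N: "open N" "z \<in> N" "N \<subseteq> ball 0 1" "inj_on W N" using loc[OF z(1)] by blast
    have "open (W ` N)" by (rule invariance_of_domain[OF continuous_on_subset[OF cW N(3)] N(1,4)])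
    then show "\<exists>T. open T \<and> y \<in> T \<and> T \<subseteq> ?V" using N z by (intro exI[of _ "W ` N"]) auto
  qed
  have WC: "compact (W ` cball 0 1)" by (intro compact_continuous_image W(1)) auto
  have WCeq: "W ` cball 0 1 = ?V \<union> ?\<gamma>" unfolding split image_Un W(2) ..
  have frV: "frontier ?V \<subseteq> ?\<gamma>"
  proof -
    have "closure ?V \<subseteq> W ` cball 0 1"
      by (rule closure_minimal) (use WC compact_imp_closed in auto)
    then show ?thesis using openV WCeq by (auto simp: frontier_def interior_open)
  qed
  have bV: "bounded ?V" using WC compact_imp_bounded WCeq bounded_subset by (metis Un_upper1)
  have "?V \<inter> outside ?\<gamma> = {}"
  proof (rule ccontr)
    assume ne: "?V \<inter> outside ?\<gamma> \<noteq> {}"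
    have "\<not> outside ?\<gamma> \<subseteq> ?V" using J bV bounded_subset by metis
    then have "outside ?\<gamma> - ?V \<noteq> {}" by blast
    moreover have "outside ?\<gamma> \<inter> ?V \<noteq> {}" using ne by blast
    moreover have "connected (outside ?\<gamma>)" using J by simp
    ultimately have "outside ?\<gamma> \<inter> frontier ?V \<noteq> {}" by (metis connected_Int_frontier)
    then show False using frV uni by blast
  qed
  moreover have "?V \<inter> ?\<gamma> = {}"
  proof (rule ccontr)
    assume "?V \<inter> ?\<gamma> \<noteq> {}"
    then obtain y where y: "y \<in> ?V" "y \<in> ?\<gamma>" by blast
    have "frontier (outside ?\<gamma>) = ?\<gamma>" using J by simp
    then have "y \<in> closure (outside ?\<gamma>)" using y(2) unfolding frontier_def by blast
    then have "?V \<inter> outside ?\<gamma> \<noteq> {}" using openV y(1) open_Int_closure_eq_empty[OF openV] by blast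
    then show False using \<open>?V \<inter> outside ?\<gamma> = {}\<close> by blast
  qed
  ultimately have sub: "?V \<subseteq> D" unfolding Deq using uni by blast
  have V: "?V = D"
  proof (rule ccontr)
    assume "?V \<noteq> D"
    then have "D - ?V \<noteq> {}" using sub by blast
    moreover have "W 0 \<in> ?V" by (intro imageI) simp
    then have "D \<inter> ?V \<noteq> {}" using sub by blast
    ultimately have "D \<inter> frontier ?V \<noteq> {}" by (metis connected_Int_frontier[OF D(2)])
    then show False using frV Deq uni by blast
  qed
  have "covering_space (ball 0 1) W D"
  proof (rule proper_local_homeo_covering[OF open_ball D(1) cW V loc])
    fix K assume K: "compact K" "K \<subseteq> D"
    have "ball 0 1 \<inter> W -` K = cball 0 1 \<inter> W -` K"
      using K(2) W(2) Deq uni unfolding split by blast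
    moreover have "closed (cball 0 1 \<inter> W -` K)"
      by (rule continuous_closed_preimage[OF W(1)]) (use K compact_imp_closed in auto)
    ultimately show "compact (ball 0 1 \<inter> W -` K)"
      by (simp add: compact_eq_bounded_closed bounded_Int)
  qed
  then have "inj_on W (ball 0 1)"
    by (rule covering_of_simply_connected_inj)
       (use D(1) simply_connected_inside_simple_path[OF c(1)] Deq in auto)
  then show ?thesis using V by (simp add: bij_betw_def)
qed

section \<open>Smoothness of the inverse\<close>

text \<open>A class of functions that contains the harmonic maps and the coefficients of the derivative of their
inverses, and that is closed under differentiation. Membership propagates smoothness of all orders at once.\<close>

inductive smooth_algebra :: "complex set \<Rightarrow> (complex \<Rightarrow> complex) \<Rightarrow> bool" for U where
  holo: "f holomorphic_on U \<Longrightarrow> smooth_algebra U f"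
| cnj: "smooth_algebra U f \<Longrightarrow> smooth_algebra U (\<lambda>z. cnj (f z))"
| add: "smooth_algebra U f \<Longrightarrow> smooth_algebra U g \<Longrightarrow> smooth_algebra U (\<lambda>z. f z + g z)"
| mult: "smooth_algebra U f \<Longrightarrow> smooth_algebra U g \<Longrightarrow> smooth_algebra U (\<lambda>z. f z * g z)"
| inv: "smooth_algebra U f \<Longrightarrow> (\<And>z. z \<in> U \<Longrightarrow> f z \<noteq> 0) \<Longrightarrow> smooth_algebra U (\<lambda>z. inverse (f z))"

lemma smooth_algebra_const: "smooth_algebra U (\<lambda>z. c)"
  by (rule smooth_algebra.holo) auto

lemma smooth_algebra_uminus: "smooth_algebra U f \<Longrightarrow> smooth_algebra U (\<lambda>z. - f z)"
  using smooth_algebra.mult[OF smooth_algebra_const[of U "-1"]] by simp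

lemma smooth_algebra_diff: "smooth_algebra U f \<Longrightarrow> smooth_algebra U g \<Longrightarrow> smooth_algebra U (\<lambda>z. f z - g z)"
  using smooth_algebra.add[of U f "\<lambda>z. - g z"] smooth_algebra_uminus by simp

lemmas smooth_algebra_intros = smooth_algebra.cnj smooth_algebra.add smooth_algebra.mult
  smooth_algebra_const smooth_algebra_uminus smooth_algebra_diff

lemma smooth_algebra_derivative:
  assumes U: "open U" and f: "smooth_algebra U f"
  shows "\<exists>f1 f2. smooth_algebra U f1 \<and> smooth_algebra U f2 \<and>
           (\<forall>z\<in>U. (f has_derivative (\<lambda>h. f1 z * h + f2 z * cnj h)) (at z))"
  using f
proof induction
  case (holo f)
  have "(f has_derivative (\<lambda>h. deriv f z * h + 0 * cnj h)) (at z)" if "z \<in> U" for z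
    using holomorphic_derivI[OF holo U that] by (simp add: has_field_derivative_def)
  then show ?case using smooth_algebra.holo[OF holomorphic_deriv[OF holo U]] smooth_algebra_const by blast
next
  case (cnj f)
  then obtain f1 f2 where f: "smooth_algebra U f1" "smooth_algebra U f2"
    "\<And>z. z \<in> U \<Longrightarrow> (f has_derivative (\<lambda>h. f1 z * h + f2 z * cnj h)) (at z)" by blast
  have "((\<lambda>z. cnj (f z)) has_derivative (\<lambda>h. cnj (f2 z) * h + cnj (f1 z) * cnj h)) (at z)" if "z \<in> U" for z
    using has_derivative_cnj[OF f(3)[OF that]] by (simp add: add.commute)
  then show ?case using f smooth_algebra.cnj by blast
next
  case (add f g)
  then obtain f1 f2 g1 g2 where f: "smooth_algebra U f1" "smooth_algebra U f2" "smooth_algebra U g1" "smooth_algebra U g2"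
    "\<And>z. z \<in> U \<Longrightarrow> (f has_derivative (\<lambda>h. f1 z * h + f2 z * cnj h)) (at z)"
    "\<And>z. z \<in> U \<Longrightarrow> (g has_derivative (\<lambda>h. g1 z * h + g2 z * cnj h)) (at z)" by blast
  have "((\<lambda>z. f z + g z) has_derivative (\<lambda>h. (f1 z + g1 z) * h + (f2 z + g2 z) * cnj h)) (at z)" if "z \<in> U" for z
    using has_derivative_add[OF f(5)[OF that] f(6)[OF that]] by (simp add: algebra_simps)
  moreover have "smooth_algebra U (\<lambda>z. f1 z + g1 z)" "smooth_algebra U (\<lambda>z. f2 z + g2 z)"
    by (intro smooth_algebra_intros f)+
  ultimately show ?case by blast
next
  case (mult f g)
  then obtain f1 f2 g1 g2 where f: "smooth_algebra U f1" "smooth_algebra U f2" "smooth_algebra U g1" "smooth_algebra U g2"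
    "\<And>z. z \<in> U \<Longrightarrow> (f has_derivative (\<lambda>h. f1 z * h + f2 z * cnj h)) (at z)"
    "\<And>z. z \<in> U \<Longrightarrow> (g has_derivative (\<lambda>h. g1 z * h + g2 z * cnj h)) (at z)" by blast
  have "((\<lambda>z. f z * g z) has_derivative (\<lambda>h. (f z * g1 z + f1 z * g z) * h + (f z * g2 z + f2 z * g z) * cnj h)) (at z)" if "z \<in> U" for z
    using has_derivative_mult[OF f(5)[OF that] f(6)[OF that]] by (simp add: algebra_simps)
  moreover have "smooth_algebra U (\<lambda>z. f z * g1 z + f1 z * g z)" "smooth_algebra U (\<lambda>z. f z * g2 z + f2 z * g z)"
    by (intro smooth_algebra_intros f mult.hyps)+
  ultimately show ?case by blast
next
  case (inv f)
  then obtain f1 f2 where f: "smooth_algebra U f1" "smooth_algebra U f2"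
    "\<And>z. z \<in> U \<Longrightarrow> (f has_derivative (\<lambda>h. f1 z * h + f2 z * cnj h)) (at z)" by blast
  have i: "smooth_algebra U (\<lambda>z. inverse (f z))" by (intro smooth_algebra.inv inv.hyps)
  have "((\<lambda>z. inverse (f z)) has_derivative (\<lambda>h. (- (f1 z * (inverse (f z) * inverse (f z)))) * h + (- (f2 z * (inverse (f z) * inverse (f z)))) * cnj h)) (at z)" if "z \<in> U" for z
    using Deriv.has_derivative_inverse[OF inv.hyps(2)[OF that] f(3)[OF that]] by (simp add: algebra_simps)
  moreover have "smooth_algebra U (\<lambda>z. - (f1 z * (inverse (f z) * inverse (f z))))" "smooth_algebra U (\<lambda>z. - (f2 z * (inverse (f z) * inverse (f z))))"
    by (intro smooth_algebra_intros f i)+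
  ultimately show ?case by blast
qed

lemma Ck_on_cong:
  assumes S: "open S" and eq: "\<And>x. x \<in> S \<Longrightarrow> f x = g x" and f: "Ck_on k f S"
  shows "Ck_on k g S"
  using eq f
proof (induction k arbitrary: f g)
  case 0
  then show ?case by (metis Ck_on.simps(1) continuous_on_eq)
next
  case (Suc k)
  have tr: "(f has_derivative f') (at x) \<longleftrightarrow> (g has_derivative f') (at x)" if "x \<in> S" for x f'
    using Suc.prems(1) that S by (metis has_derivative_transform_within_open)
  then have fr: "frechet_derivative f (at x) = frechet_derivative g (at x)" if "x \<in> S" for x
    using that by (simp add: frechet_derivative_def)
  have "g differentiable_on S"
    using Suc.prems(2) tr S by (auto simp: differentiable_on_def differentiable_def at_within_open[OF _ S])
  moreover have "Ck_on k (\<lambda>x. frechet_derivative g (at x) b) S" if "b \<in> Basis" for b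
    by (rule Suc.IH[of "\<lambda>x. frechet_derivative f (at x) b"]) (use Suc.prems(2) fr that in auto)
  ultimately show ?case by simp
qed

text \<open>If the derivative of \<open>v\<close> is given by smooth functions evaluated at \<open>v\<close> itself, as it is for an inverse
function, then \<open>v\<close> is smooth: the derivative of \<open>f \<circ> v\<close> is again of the form \<open>m \<circ> v\<close> with \<open>m\<close> in the
algebra, and the induction over \<open>k\<close> closes.\<close>

lemma Ck_on_smooth_algebra_compose:
  fixes v :: "complex \<Rightarrow> complex"
  assumes U: "open U" and D: "open D" and vD: "v ` D \<subseteq> U"
    and a: "smooth_algebra U a" "smooth_algebra U b"
    and v: "\<And>y. y \<in> D \<Longrightarrow> (v has_derivative (\<lambda>h. a (v y) * h + b (v y) * cnj h)) (at y)"
    and f: "smooth_algebra U f"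
  shows "Ck_on k (\<lambda>y. f (v y)) D"
  using f
proof (induction k arbitrary: f)
  case (0 f)
  obtain f1 f2 where "\<And>z. z \<in> U \<Longrightarrow> (f has_derivative (\<lambda>h. f1 z * h + f2 z * cnj h)) (at z)"
    using smooth_algebra_derivative[OF U 0] by blast
  then have "continuous_on U f" using has_derivative_continuous continuous_at_imp_continuous_on by blast
  moreover have "continuous_on D v" using v has_derivative_continuous continuous_at_imp_continuous_on by blast
  ultimately show ?case using vD by (auto intro: continuous_on_compose2)
next
  case (Suc k f)
  obtain f1 f2 where f1: "smooth_algebra U f1" "smooth_algebra U f2"
    "\<And>z. z \<in> U \<Longrightarrow> (f has_derivative (\<lambda>h. f1 z * h + f2 z * cnj h)) (at z)"
    using smooth_algebra_derivative[OF U Suc.prems] by blast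
  define m where "m z = f1 z * a z + f2 z * cnj (b z)" for z
  define n where "n z = f1 z * b z + f2 z * cnj (a z)" for z
  have der: "((\<lambda>y. f (v y)) has_derivative (\<lambda>h. m (v y) * h + n (v y) * cnj h)) (at y)" if y: "y \<in> D" for y
  proof -
    have "((\<lambda>y. f (v y)) has_derivative (\<lambda>h. f1 (v y) * (a (v y) * h + b (v y) * cnj h) + f2 (v y) * cnj (a (v y) * h + b (v y) * cnj h))) (at y)"
      using has_derivative_compose[OF v[OF y] f1(3)] vD y by auto
    then show ?thesis by (simp add: m_def n_def algebra_simps)
  qed
  have fr: "frechet_derivative (\<lambda>y. f (v y)) (at y) h = m (v y) * h + n (v y) * cnj h" if "y \<in> D" for y h
    using frechet_derivative_at[OF der[OF that]] by metis
  have "(\<lambda>y. f (v y)) differentiable_on D"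
    using der by (auto simp: differentiable_on_def differentiable_def intro: has_derivative_at_withinI)
  moreover have "Ck_on k (\<lambda>y. frechet_derivative (\<lambda>y. f (v y)) (at y) h) D" for h
  proof (rule Ck_on_cong[OF D])
    have "smooth_algebra U (\<lambda>z. m z * h + n z * cnj h)"
      unfolding m_def n_def by (intro smooth_algebra_intros a f1)
    then show "Ck_on k (\<lambda>y. m (v y) * h + n (v y) * cnj h) D" by (rule Suc.IH)
  qed (simp add: fr)
  ultimately show ?case by simp
qed

text \<open>The derivative \<open>h \<mapsto> w1 h + w2 cnj h\<close> has the inverse \<open>h \<mapsto> (cnj w1 h - w2 cnj h) / J\<close> with
\<open>J = |w1|\<^sup>2 - |w2|\<^sup>2\<close>.\<close>

lemma smooth_algebra_locally_injective:
  assumes U: "open U" and w1: "smooth_algebra U w1" "smooth_algebra U w2"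
    and der: "\<And>z. z \<in> U \<Longrightarrow> (w has_derivative (\<lambda>h. w1 z * h + w2 z * cnj h)) (at z)"
    and nz: "norm (w1 a) \<noteq> norm (w2 a)" and a: "a \<in> U"
  shows "\<exists>N. open N \<and> a \<in> N \<and> N \<subseteq> U \<and> inj_on w N"
proof -
  have cont: "isCont f a" if "smooth_algebra U f" for f
    using smooth_algebra_derivative[OF U that] a has_derivative_continuous by blast
  define J where "J = (norm (w1 a))\<^sup>2 - (norm (w2 a))\<^sup>2"
  have J: "J \<noteq> 0" using nz by (simp add: J_def)
  define g where "g h = (cnj (w1 a) * h - w2 a * cnj h) / of_real J" for h
  have "bounded_linear g"
    unfolding g_def by (intro bounded_linear_intros bounded_linear_compose[OF bounded_linear_divide]
        bounded_linear_sub bounded_linear_const_mult bounded_linear_cnj bounded_linear_ident)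
  moreover have "g \<circ> (\<lambda>h. w1 a * h + w2 a * cnj h) = id"
  proof
    fix h
    have "cnj (w1 a) * (w1 a * h + w2 a * cnj h) - w2 a * cnj (w1 a * h + w2 a * cnj h)
        = (w1 a * cnj (w1 a) - w2 a * cnj (w2 a)) * h" by (simp add: algebra_simps)
    also have "\<dots> = of_real J * h" unfolding J_def of_real_diff complex_norm_square ..
    finally show "(g \<circ> (\<lambda>h. w1 a * h + w2 a * cnj h)) h = id h" using J by (simp add: g_def)
  qed
  moreover have "\<exists>d>0. \<forall>x. dist a x < d \<longrightarrow> onorm (\<lambda>v. (w1 x * v + w2 x * cnj v) - (w1 a * v + w2 a * cnj v)) < e"
    if e: "e > 0" for e
  proof -
    have "e / 3 > 0" using e by simp
    obtain d1 where d1: "d1 > 0" "\<And>x. dist x a < d1 \<Longrightarrow> dist (w1 x) (w1 a) < e/3"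
      using cont[OF w1(1)] \<open>e / 3 > 0\<close> unfolding continuous_at_eps_delta by blast
    obtain d2 where d2: "d2 > 0" "\<And>x. dist x a < d2 \<Longrightarrow> dist (w2 x) (w2 a) < e/3"
      using cont[OF w1(2)] \<open>e / 3 > 0\<close> unfolding continuous_at_eps_delta by blast
    have "onorm (\<lambda>v. (w1 x * v + w2 x * cnj v) - (w1 a * v + w2 a * cnj v)) < e" if x: "dist a x < min d1 d2" for x
    proof -
      have n: "norm (w1 x - w1 a) < e/3" "norm (w2 x - w2 a) < e/3"
        using d1(2)[of x] d2(2)[of x] x by (auto simp: dist_norm norm_minus_commute)
      have "onorm (\<lambda>v. (w1 x * v + w2 x * cnj v) - (w1 a * v + w2 a * cnj v)) \<le> 2 * (e/3)"
      proof (rule onorm_bound)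
        fix v
        have "(w1 x * v + w2 x * cnj v) - (w1 a * v + w2 a * cnj v) = (w1 x - w1 a) * v + (w2 x - w2 a) * cnj v"
          by (simp add: algebra_simps)
        also have "norm \<dots> \<le> norm ((w1 x - w1 a) * v) + norm ((w2 x - w2 a) * cnj v)" by (rule norm_triangle_ineq)
        also have "\<dots> \<le> (e/3) * norm v + (e/3) * norm v"
          unfolding norm_mult complex_mod_cnj using n by (intro add_mono mult_right_mono) auto
        finally show "norm ((w1 x * v + w2 x * cnj v) - (w1 a * v + w2 a * cnj v)) \<le> 2 * (e/3) * norm v" by simp
      qed (use e in simp)
      then show ?thesis using e by simp
    qed
    then show ?thesis using d1(1) d2(1) by (intro exI[of _ "min d1 d2"]) auto
  qed
  ultimately obtain r where "r > 0" "ball a r \<subseteq> U" "inj_on w (ball a r)"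
    using has_derivative_locally_injective[OF a U, of g "\<lambda>z h. w1 z * h + w2 z * cnj h" w] der by blast
  then show ?thesis by (intro exI[of _ "ball a r"]) auto
qed

text \<open>The coefficients of the derivative of the inverse are \<open>cnj w1 / J\<close> and \<open>- w2 / J\<close>, taken at the preimage;
they belong to the algebra because \<open>J = |w1|\<^sup>2 - |w2|\<^sup>2\<close> has no zeros.\<close>

lemma diffeomorphism_onto_smooth_algebra:
  assumes U: "open U" and D: "open D" and w: "smooth_algebra U w" and bij: "bij_betw w U D"
    and w1: "smooth_algebra U w1" "smooth_algebra U w2"
    and der: "\<And>z. z \<in> U \<Longrightarrow> (w has_derivative (\<lambda>h. w1 z * h + w2 z * cnj h)) (at z)"
    and nz: "\<And>z. z \<in> U \<Longrightarrow> norm (w1 z) \<noteq> norm (w2 z)"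
  shows "diffeomorphism_onto w U D"
proof -
  let ?v = "inv_into U w"
  \<comment> \<open>Smoothness of \<open>w\<close> itself is the case in which \<open>v\<close> is the identity.\<close>
  have "Ck_on k (\<lambda>z. w ((\<lambda>z. z) z)) U" for k
  proof (rule Ck_on_smooth_algebra_compose[OF U U _ smooth_algebra_const[of U 1] smooth_algebra_const[of U 0] _ w])
  qed auto
  moreover have "Ck_on k ?v D" for k
  proof -
    define J where "J z = inverse (w1 z * cnj (w1 z) - w2 z * cnj (w2 z))" for z
    have Jnz: "w1 z * cnj (w1 z) - w2 z * cnj (w2 z) \<noteq> 0" if "z \<in> U" for z
    proof
      assume "w1 z * cnj (w1 z) - w2 z * cnj (w2 z) = 0"
      then have "complex_of_real ((norm (w1 z))\<^sup>2) = of_real ((norm (w2 z))\<^sup>2)"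
        unfolding complex_norm_square by simp
      then have "(norm (w1 z))\<^sup>2 = (norm (w2 z))\<^sup>2" by (simp only: of_real_eq_iff)
      then have "norm (w1 z) = norm (w2 z)" by simp
      then show False using nz[OF that] by simp
    qed
    have Jalg: "smooth_algebra U J" unfolding J_def
      by (rule smooth_algebra.inv) (use Jnz in \<open>auto intro!: smooth_algebra_intros w1\<close>)
    have a1: "smooth_algebra U (\<lambda>z. cnj (w1 z) * J z)" "smooth_algebra U (\<lambda>z. - (w2 z * J z))"
      by (intro smooth_algebra_intros w1 Jalg)+
    have vD: "?v ` D \<subseteq> U" using bij by (auto simp: bij_betw_def inv_into_into)
    have vder: "(?v has_derivative (\<lambda>h. (cnj (w1 (?v y)) * J (?v y)) * h + (- (w2 (?v y) * J (?v y))) * cnj h)) (at y)"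
      if y: "y \<in> D" for y
    proof -
      define z where "z = ?v y"
      have z: "z \<in> U" using vD y by (auto simp: z_def)
      have wz: "w z = y" using bij y by (simp add: z_def bij_betw_def f_inv_into_f)
      have "(?v has_derivative (\<lambda>h. (cnj (w1 z) * J z) * h + (- (w2 z * J z)) * cnj h)) (at (w z))"
      proof (rule has_derivative_inverse_strong[OF U z])
        show "continuous_on U w" using der has_derivative_continuous continuous_at_imp_continuous_on by blast
        show "?v (w x) = x" if "x \<in> U" for x using bij that by (simp add: bij_betw_def)
        show "(w has_derivative (\<lambda>h. w1 z * h + w2 z * cnj h)) (at z)" by (rule der[OF z])
        show "(\<lambda>h. w1 z * h + w2 z * cnj h) \<circ> (\<lambda>h. (cnj (w1 z) * J z) * h + (- (w2 z * J z)) * cnj h) = id"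
        proof
          fix h
          have cJ: "cnj (J z) = J z" by (simp add: J_def mult.commute)
          have "w1 z * (cnj (w1 z) * J z * h + - (w2 z * J z) * cnj h) + w2 z * cnj (cnj (w1 z) * J z * h + - (w2 z * J z) * cnj h)
             = (w1 z * cnj (w1 z) - w2 z * cnj (w2 z)) * J z * h"
            by (simp add: cJ algebra_simps)
          also have "\<dots> = h" using Jnz[OF z] by (simp add: J_def)
          finally show "((\<lambda>h. w1 z * h + w2 z * cnj h) \<circ> (\<lambda>h. (cnj (w1 z) * J z) * h + (- (w2 z * J z)) * cnj h)) h = id h"
            by simp
        qed
      qed
      then show ?thesis unfolding wz by (simp only: z_def)
    qed
    have "Ck_on k (\<lambda>y. (\<lambda>z. z) (?v y)) D"
      by (rule Ck_on_smooth_algebra_compose[OF U D vD a1 vder smooth_algebra.holo]) (auto intro: holomorphic_on_ident)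
    then show ?thesis by simp
  qed
  ultimately show ?thesis using bij by (simp add: diffeomorphism_onto_def)
qed

lemma diffeomorphism_onto_cong:
  fixes w w' :: "complex \<Rightarrow> complex"
  assumes U: "open U" and D: "open D" and eq: "\<And>z. z \<in> U \<Longrightarrow> w z = w' z"
    and w: "diffeomorphism_onto w U D"
  shows "diffeomorphism_onto w' U D"
proof -
  have "inv_into U w = inv_into U w'"
  proof
    fix y
    have "(\<lambda>x. x \<in> U \<and> w x = y) = (\<lambda>x. x \<in> U \<and> w' x = y)" using eq by auto
    then show "inv_into U w y = inv_into U w' y" by (simp add: inv_into_def)
  qed
  moreover have "bij_betw w' U D" using w eq by (auto simp: diffeomorphism_onto_def cong: bij_betw_cong)
  moreover have "Ck_on k w' U" for k
    using w Ck_on_cong[OF U eq] by (auto simp: diffeomorphism_onto_def)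
  ultimately show ?thesis using w by (simp add: diffeomorphism_onto_def)
qed

section \<open>Lifting a weak homeomorphism\<close>

text \<open>A second continuous branch of the angle, for the part of the circle where \<open>Arg\<close> jumps.\<close>

lemma cis_Arg_uminus_add_pi:
  assumes "x \<in> sphere 0 1" shows "cis (Arg (- x) + pi) = x"
proof -
  have "x \<noteq> 0" "norm x = 1" using assms by auto
  then have "cis (Arg (- x)) = - x" using cis_Arg[of "- x"] by (simp add: sgn_div_norm)
  then show ?thesis by (simp add: cis_mult[symmetric])
qed

lemma continuous_on_circle_if_lift_continuous:
  fixes G :: "complex \<Rightarrow> 'b::topological_space"
  assumes cont: "continuous_on UNIV (\<lambda>t. G (cis t))"
  shows "continuous_on (sphere 0 1) G"
  unfolding continuous_on_eq_continuous_within
proof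
  fix z :: complex assume z: "z \<in> sphere 0 1"
  have cG: "isCont (\<lambda>t. G (cis t)) t" for t
    using cont by (simp add: continuous_on_eq_continuous_at)
  show "continuous (at z within sphere 0 1) G"
  proof (cases "z \<in> \<real>\<^sub>\<le>\<^sub>0")
    case False
    have "isCont (\<lambda>x. G (cis (Arg x))) z" by (rule isCont_o2[OF continuous_at_Arg[OF False] cG])
    then have "continuous (at z within sphere 0 1) (\<lambda>x. G (cis (Arg x)))"
      by (rule continuous_at_imp_continuous_at_within)
    moreover have "G (cis (Arg x)) = G x" if "x \<in> sphere 0 1" for x
    proof -
      have "x \<noteq> 0" "norm x = 1" using that by auto
      then show ?thesis by (simp add: cis_Arg sgn_div_norm)
    qed
    ultimately show ?thesis by (rule continuous_transform_within[OF _ zero_less_one z])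
  next
    case True
    then have "- z \<notin> \<real>\<^sub>\<le>\<^sub>0" using z by (auto simp: complex_nonpos_Reals_iff complex_eq_iff cmod_def)
    then have "isCont (\<lambda>x. Arg (- x)) z" by (intro isCont_o2[of z uminus Arg] continuous_at_Arg) auto
    then have "isCont (\<lambda>x. Arg (- x) + pi) z" by (intro continuous_intros)
    then have "isCont (\<lambda>x. G (cis (Arg (- x) + pi))) z" by (rule isCont_o2[OF _ cG])
    then have "continuous (at z within sphere 0 1) (\<lambda>x. G (cis (Arg (- x) + pi)))"
      by (rule continuous_at_imp_continuous_at_within)
    then show ?thesis
      by (rule continuous_transform_within[OF _ zero_less_one z]) (simp add: cis_Arg_uminus_add_pi)
  qed
qed

context smooth_jordan_curve
begin

text \<open>For short arcs the Taylor remainder is at most half of the arc length.\<close>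

lemma g_chord_lower_bound:
  obtains \<delta> where "\<delta> > 0" "\<And>a b. a \<le> b \<Longrightarrow> b - a \<le> \<delta> \<Longrightarrow> (b - a) / 2 \<le> norm (g b - g a)"
proof -
  obtain \<delta> where \<delta>: "\<delta> > 0" "H * \<delta> powr \<alpha> < 1/2"
    by (rule powr_eventually_small[OF \<alpha>_pos, of "1/2" H]) auto
  have "(b - a) / 2 \<le> norm (g b - g a)" if ab: "a \<le> b" "b - a \<le> \<delta>" for a b
  proof -
    have "H * \<bar>b - a\<bar> powr (1 + \<alpha>) = (H * (b - a) powr \<alpha>) * (b - a)"
      using ab by (cases "a = b") (simp_all add: powr_add)
    also have "\<dots> \<le> 1/2 * (b - a)"
    proof (rule mult_right_mono)
      have "H * (b - a) powr \<alpha> \<le> H * \<delta> powr \<alpha>" using ab H_nonneg \<alpha>_pos by (intro mult_left_mono powr_mono2) auto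
      then show "H * (b - a) powr \<alpha> \<le> 1/2" using \<delta>(2) by linarith
    qed (use ab in simp)
    finally have "norm (g b - g a - (b - a) *\<^sub>R g' a) \<le> (b - a) / 2" using g_taylor[of b a] by simp
    moreover have "norm ((b - a) *\<^sub>R g' a) = b - a" using ab by (simp add: unit)
    moreover have "norm ((b - a) *\<^sub>R g' a) \<le> norm (g b - g a) + norm (g b - g a - (b - a) *\<^sub>R g' a)"
      using norm_triangle_ineq4[of "g b - g a" "g b - g a - (b - a) *\<^sub>R g' a"] by simp
    ultimately show ?thesis by simp
  qed
  then show thesis using that \<delta>(1) by blast
qed

text \<open>That \<open>f\<close> is Lipschitz must be deduced from \<open>F\<close>. A chord is at least half of its arc, but only for arcs of
length at most \<open>\<delta>\<close>; \<open>f t - f s\<close> may exceed \<open>\<delta>\<close>. As \<open>f\<close> is onto, it takes the value \<open>f s + \<eta>\<close> for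
every \<open>\<eta>\<close> up to \<open>f t - f s\<close>, and \<open>\<eta> = min \<delta> (f t - f s)\<close> gives \<open>\<eta> \<le> 2 L (t - s)\<close>. For \<open>t - s\<close>
small this rules out \<open>\<eta> = \<delta>\<close>; for the other \<open>t - s\<close> the trivial bound \<open>f t - f s \<le> l\<close> is enough.
Then \<open>f\<close> is extended from one period to the line.\<close>

lemma boundary_lift_exists:
  assumes weak: "weak_homeomorphism F g l f" and lip: "\<exists>L. L-lipschitz_on (sphere 0 1) F"
  obtains M \<phi> where "boundary_lift M \<phi>" "\<And>t. F (cis t) = g (\<phi> t)" "\<And>t. t \<in> {0..2*pi} \<Longrightarrow> \<phi> t = f t"
proof -
  have mono: "\<And>s t. s \<in> {0..2*pi} \<Longrightarrow> t \<in> {0..2*pi} \<Longrightarrow> s \<le> t \<Longrightarrow> f s \<le> f t"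
    and im: "f ` {0..2*pi} = {0..l}" and F: "\<And>t. t \<in> {0..2*pi} \<Longrightarrow> F (cis t) = g (f t)"
    using weak by (auto simp: weak_homeomorphism_def mono_on_def)
  obtain L0 where L0: "L0-lipschitz_on (sphere 0 1) F" using lip by blast
  define L where "L = L0 + 1"
  have L: "L > 0" using lipschitz_on_nonneg[OF L0] by (simp add: L_def)
  have FL: "norm (F (cis t) - F (cis s)) \<le> L * \<bar>t - s\<bar>" for s t
  proof -
    have "norm (F (cis t) - F (cis s)) \<le> L0 * norm (cis t - cis s)"
      using lipschitz_onD[OF L0, of "cis t" "cis s"] by (simp add: dist_norm)
    moreover have "norm (cis t - cis s) \<le> 1 * \<bar>t - s\<bar>"
      by (rule norm_diff_le_vector_derivative[of UNIV cis "\<lambda>x. \<i> * cis x"])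
         (auto intro!: derivative_eq_intros simp: has_vector_derivative_def norm_mult)
    then have "L0 * norm (cis t - cis s) \<le> L0 * \<bar>t - s\<bar>"
      using lipschitz_on_nonneg[OF L0] by (intro mult_left_mono) auto
    moreover have "L0 * \<bar>t - s\<bar> \<le> L * \<bar>t - s\<bar>" by (intro mult_right_mono) (auto simp: L_def)
    ultimately show ?thesis by linarith
  qed
  obtain \<delta> where \<delta>: "\<delta> > 0" "\<And>a b. a \<le> b \<Longrightarrow> b - a \<le> \<delta> \<Longrightarrow> (b - a) / 2 \<le> norm (g b - g a)"
    by (rule g_chord_lower_bound) blast
  have f0l: "0 \<le> f t" "f t \<le> l" if "t \<in> {0..2*pi}" for t using im that by auto
  have f0: "f 0 = 0"
  proof -
    obtain t where t: "t \<in> {0..2*pi}" "f t = 0" using im l_pos by (metis atLeastAtMost_iff imageE less_imp_le order_refl)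
    then show ?thesis using mono[of 0 t] f0l[of 0] by auto
  qed
  have fl: "f (2*pi) = l"
  proof -
    obtain t where t: "t \<in> {0..2*pi}" "f t = l" using im l_pos by (metis atLeastAtMost_iff imageE less_imp_le order_refl)
    then show ?thesis using mono[of t "2*pi"] f0l[of "2*pi"] by auto
  qed
  define M where "M = max (2 * L) (2 * L * l / \<delta>)"
  have fM: "f t - f s \<le> M * (t - s)" if s: "s \<in> {0..2*pi}" "t \<in> {0..2*pi}" "s \<le> t" for s t
  proof (cases "2 * L * (t - s) < \<delta>")
    case True
    define \<eta> where "\<eta> = min \<delta> (f t - f s)"
    have \<eta>: "0 \<le> \<eta>" "\<eta> \<le> \<delta>" "f s + \<eta> \<le> f t" using mono[OF s] \<delta>(1) by (auto simp: \<eta>_def)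
    have "f s + \<eta> \<in> {0..l}" using f0l[OF s(1)] f0l[OF s(2)] \<eta> by auto
    then obtain u where u: "u \<in> {0..2*pi}" "f u = f s + \<eta>" using im by (metis imageE)
    have "\<eta> \<le> 2 * L * (t - s)"
    proof (cases "\<eta> = 0")
      case False
      have "s \<le> u" using mono[of u s] u s \<eta> False by (cases "u \<le> s") auto
      moreover have "u \<le> t \<or> f u = f t" using mono[of t u] u s \<eta> by (cases "t \<le> u") auto
      ultimately obtain u' where u': "u' \<in> {0..2*pi}" "f u' = f s + \<eta>" "s \<le> u'" "u' \<le> t"
        using u s by (metis atLeastAtMost_iff order_refl)
      have "\<eta> / 2 \<le> norm (g (f u') - g (f s))" using \<delta>(2)[of "f s" "f u'"] u' \<eta> by simp
      also have "\<dots> \<le> L * (u' - s)" using FL[of u' s] F[OF u'(1)] F[OF s(1)] u' by simp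
      also have "\<dots> \<le> L * (t - s)" using u' L by (intro mult_left_mono) auto
      finally show ?thesis by simp
    qed (use L s in simp)
    then have "\<eta> = f t - f s" using True by (auto simp: \<eta>_def min_def split: if_splits)
    then have "f t - f s \<le> 2 * L * (t - s)" using \<open>\<eta> \<le> 2 * L * (t - s)\<close> by simp
    also have "\<dots> \<le> M * (t - s)" using s by (intro mult_right_mono) (auto simp: M_def)
    finally show ?thesis .
  next
    case False
    have "f t - f s \<le> l" using f0l[OF s(1)] f0l[OF s(2)] by simp
    also have "l \<le> (2 * L * l / \<delta>) * (t - s)"
    proof -
      have "l * \<delta> \<le> l * (2 * L * (t - s))" using False l_pos by (intro mult_left_mono) auto
      then show ?thesis using \<delta>(1) by (simp add: field_simps)
    qed
    also have "\<dots> \<le> M * (t - s)" using s by (intro mult_right_mono) (auto simp: M_def)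
    finally show ?thesis .
  qed
  define n where "n t = \<lfloor>t / (2 * pi)\<rfloor>" for t
  define \<phi> where "\<phi> t = f (t - 2 * pi * of_int (n t)) + l * of_int (n t)" for t
  have red: "0 \<le> t - 2 * pi * of_int (n t)" "t - 2 * pi * of_int (n t) < 2 * pi" for t
  proof -
    have "of_int (n t) \<le> t / (2 * pi)" "t / (2 * pi) < of_int (n t) + 1" unfolding n_def by linarith+
    then show "0 \<le> t - 2 * pi * of_int (n t)" "t - 2 * pi * of_int (n t) < 2 * pi" by (simp_all add: field_simps)
  qed
  have inr: "t - 2 * pi * of_int (n t) \<in> {0..2*pi}" for t using red[of t] by auto
  have nmono: "n s \<le> n t" if "s \<le> t" for s t unfolding n_def using that by (intro floor_mono divide_right_mono) auto
  have step: "0 \<le> \<phi> t - \<phi> s \<and> \<phi> t - \<phi> s \<le> M * (t - s)" if st: "s \<le> t" for s t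
  proof (cases "n s = n t")
    case True
    have "s - 2 * pi * of_int (n t) \<le> t - 2 * pi * of_int (n t)" using st by simp
    then show ?thesis using fM[OF inr inr, of s t] mono[OF inr inr, of s t] True st by (simp add: \<phi>_def)
  next
    case False
    then have k: "n s + 1 \<le> n t" using nmono[OF st] by simp
    \<comment> \<open>The number of full periods between \<open>s\<close> and \<open>t\<close>.\<close>
    define k where "k = n t - (n s + 1)"
    have k0: "0 \<le> k" using k by (simp add: k_def)
    have nt: "real_of_int (n t) = of_int (n s) + 1 + of_int k" by (simp add: k_def)
    let ?s = "s - 2 * pi * of_int (n s)" and ?t = "t - 2 * pi * of_int (n t)"
    have e: "\<phi> t - \<phi> s = (f ?t - f 0) + l * of_int k + (f (2*pi) - f ?s)"
      unfolding \<phi>_def f0 fl nt by (simp add: algebra_simps)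
    have b1: "0 \<le> f ?t - f 0" "f ?t - f 0 \<le> M * ?t" using mono[of 0 ?t] fM[of 0 ?t] inr[of t] red[of t] by auto
    have b2: "0 \<le> f (2*pi) - f ?s" "f (2*pi) - f ?s \<le> M * (2*pi - ?s)" using mono[of ?s "2*pi"] fM[of ?s "2*pi"] inr[of s] red[of s] by auto
    have lM: "l \<le> M * (2 * pi)" using fM[of 0 "2*pi"] f0 fl by simp
    have b3: "0 \<le> l * of_int k" "l * of_int k \<le> M * (2 * pi) * of_int k"
      using l_pos k0 lM by (auto intro: mult_right_mono)
    have "M * ?t + M * (2 * pi) * of_int k + M * (2*pi - ?s) = M * (t - s)"
      unfolding nt by (simp add: algebra_simps)
    then show ?thesis using e b1 b2 b3 by linarith
  qed
  have per\<phi>: "\<phi> (t + 2 * pi) = \<phi> t + l" for t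
  proof -
    have "n (t + 2 * pi) = n t + 1" by (simp add: n_def add_divide_distrib)
    then show ?thesis by (simp add: \<phi>_def algebra_simps)
  qed
  have bl: "boundary_lift M \<phi>"
    unfolding boundary_lift_def
  proof (intro conjI allI per\<phi>)
    show "mono \<phi>" using step by (intro monoI) (smt (verit))
    show "\<bar>\<phi> t - \<phi> s\<bar> \<le> M * \<bar>t - s\<bar>" for s t
      using step[of s t] step[of t s] by (cases "s \<le> t") auto
  qed
  have gper: "g (a + l * of_int k) = g a" for a k
    using periodic_of_int[where f = g, OF per, of a k] by (simp add: mult.commute)
  have Fg: "F (cis t) = g (\<phi> t)" for t
  proof -
    have "cis t = cis (t - 2 * pi * of_int (n t))"
      using periodic_of_int[where f = cis, OF cis_add_2pi, of "t - 2 * pi * of_int (n t)" "n t"] by (simp add: mult_ac)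
    then show ?thesis using F[OF inr[of t]] gper by (simp add: \<phi>_def)
  qed
  have \<phi>f: "\<phi> t = f t" if "t \<in> {0..2*pi}" for t
  proof (cases "t = 2 * pi")
    case True
    then have "n t = 1" by (simp add: n_def)
    then show ?thesis using True f0 fl by (simp add: \<phi>_def)
  next
    case False
    then have "0 \<le> t / (2*pi)" "t / (2*pi) < 1" using that by auto
    then have "n t = 0" unfolding n_def by linarith
    then show ?thesis by (simp add: \<phi>_def)
  qed
  show thesis by (rule that[OF bl Fg \<phi>f])
qed

end

section \<open>The ratio of the Jacobian to the boundary speed\<close>

locale poisson_boundary = smooth_jordan_curve +
  fixes \<phi> :: "real \<Rightarrow> real" and M :: real and F :: "complex \<Rightarrow> complex"
  assumes lift: "boundary_lift M \<phi>" and F: "\<And>t. F (cis t) = g (\<phi> t)"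
begin

abbreviation "w \<equiv> poisson_extension F"

lemma continuous_F: "continuous_on A (\<lambda>t. F (cis t))"
  using continuous_boundary_values[OF lift] by (simp add: F)

text \<open>The harmonic decomposition, which shows that \<open>w\<close> agrees on the open disk with a member of the smooth algebra.\<close>

definition w_formula :: "complex \<Rightarrow> complex" where
  "w_formula z = cauchy_transform (\<lambda>t. g (\<phi> t)) z + cnj (cauchy_transform (\<lambda>t. cnj (g (\<phi> t))) z)
     + (- integral {0..2*pi} (\<lambda>t. g (\<phi> t)) / (2 * pi))"

lemma w_eq: "z \<in> ball 0 1 \<Longrightarrow> w z = w_formula z"
  using poisson_extension_decomp[OF continuous_F, of z] by (simp add: w_formula_def F)

lemma w_formula_derivative:
  assumes z: "z \<in> ball 0 1"
  shows "(w_formula has_derivative (\<lambda>h. w_z \<phi> z * h + cnj (w_zbar_cnj \<phi> z) * cnj h)) (at z)"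
proof -
  have z1: "norm z < 1" using z by simp
  have c: "continuous_on {0..2*pi} (\<lambda>t. g (\<phi> t))" "continuous_on {0..2*pi} (\<lambda>t. cnj (g (\<phi> t)))"
    by (intro continuous_intros continuous_boundary_values[OF lift])+
  have "(cauchy_transform (\<lambda>t. g (\<phi> t)) has_derivative (\<lambda>h. w_z \<phi> z * h)) (at z)"
    using cauchy_transform_has_derivative[OF c(1) z1] by (simp add: has_field_derivative_def)
  moreover have "((\<lambda>z. cnj (cauchy_transform (\<lambda>t. cnj (g (\<phi> t))) z)) has_derivative (\<lambda>h. cnj (w_zbar_cnj \<phi> z * h))) (at z)"
    using cauchy_transform_has_derivative[OF c(2) z1] by (intro has_derivative_cnj) (simp add: has_field_derivative_def)
  ultimately have "((\<lambda>z. cauchy_transform (\<lambda>t. g (\<phi> t)) z + cnj (cauchy_transform (\<lambda>t. cnj (g (\<phi> t))) z)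
     + (- integral {0..2*pi} (\<lambda>t. g (\<phi> t)) / (2 * pi))) has_derivative (\<lambda>h. w_z \<phi> z * h + cnj (w_zbar_cnj \<phi> z * h) + 0)) (at z)"
    by (intro has_derivative_add has_derivative_const)
  then show ?thesis unfolding w_formula_def[abs_def] by simp
qed

lemma w_derivative:
  assumes z: "z \<in> ball 0 1"
  shows "(w has_derivative (\<lambda>h. w_z \<phi> z * h + cnj (w_zbar_cnj \<phi> z) * cnj h)) (at z)"
  by (rule has_derivative_transform_within_open[OF w_formula_derivative[OF z] open_ball z]) (simp add: w_eq)

lemma jacobian_w:
  assumes z: "z \<in> ball 0 1"
  shows "jacobian w z = (norm (w_z \<phi> z))\<^sup>2 - (norm (w_zbar_cnj \<phi> z))\<^sup>2"
proof -
  have fr: "frechet_derivative w (at z) = (\<lambda>h. w_z \<phi> z * h + cnj (w_zbar_cnj \<phi> z) * cnj h)"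
    using frechet_derivative_at[OF w_derivative[OF z]] by simp
  have "wirtinger w z = w_z \<phi> z" by (simp add: wirtinger_def fr algebra_simps)
  moreover have "wirtinger_bar w z = cnj (w_zbar_cnj \<phi> z)" by (simp add: wirtinger_bar_def fr algebra_simps)
  ultimately show ?thesis by (simp add: jacobian_def)
qed

lemma radial_increment:
  assumes r: "0 \<le> r" "r < 1"
  shows "of_real ((w (rcis r \<tau>) - F (cis \<tau>)) \<bullet> e) =
    of_real (1 - r) * integral {-pi..pi} (\<lambda>s. of_real ((1 + r) / (norm (cis s - of_real r))\<^sup>2) * complex_of_real (increment \<phi> e \<tau> s)) / (2 * pi)"
proof -
  define k where "k s = (1 - r\<^sup>2) / (norm (cis s - of_real r))\<^sup>2" for s
  have ck: "continuous_on A k" for A unfolding k_def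
    using cis_minus_real_nonzero[OF r] by (intro continuous_intros) auto
  have c\<Phi>: "continuous_on A (\<lambda>s. F (cis (\<tau> + s)))" for A
    by (intro continuous_on_compose2 [OF continuous_F[of UNIV]] continuous_intros) auto
  have i: "(\<lambda>s. of_real (k s) * F (cis (\<tau> + s))) integrable_on {-pi..pi}" "(\<lambda>s. complex_of_real (k s)) integrable_on {-pi..pi}"
    by (intro integrable_continuous_real continuous_intros ck c\<Phi>)+
  have "w (rcis r \<tau>) - F (cis \<tau>) = (integral {-pi..pi} (\<lambda>s. of_real (k s) * F (cis (\<tau> + s))) - integral {-pi..pi} (\<lambda>s. complex_of_real (k s) * F (cis \<tau>))) / (2 * pi)"
    using poisson_extension_polar[OF continuous_F r, of \<tau>] integral_poisson_kernel[OF r]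
    unfolding k_def integral_mult_left by (simp add: diff_divide_distrib)
  also have "\<dots> = integral {-pi..pi} (\<lambda>s. k s *\<^sub>R (F (cis (\<tau> + s)) - F (cis \<tau>))) / (2 * pi)"
    using integral_diff[OF i(1) integrable_on_mult_left[OF i(2), of "F (cis \<tau>)"]]
    by (simp add: scaleR_conv_of_real right_diff_distrib)
  finally have eq: "w (rcis r \<tau>) - F (cis \<tau>) = (1 / (2 * pi)) *\<^sub>R integral {-pi..pi} (\<lambda>s. k s *\<^sub>R (F (cis (\<tau> + s)) - F (cis \<tau>)))"
    by (simp add: scaleR_conv_of_real)
  have i2: "(\<lambda>s. k s *\<^sub>R (F (cis (\<tau> + s)) - F (cis \<tau>))) integrable_on {-pi..pi}"
    by (intro integrable_continuous_real continuous_intros ck c\<Phi>)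
  have i3: "(\<lambda>s. k s * increment \<phi> e \<tau> s) integrable_on {-pi..pi}"
    by (intro integrable_continuous_real continuous_intros ck continuous_increment[OF lift])
  have "(w (rcis r \<tau>) - F (cis \<tau>)) \<bullet> e = (1 / (2 * pi)) * integral {-pi..pi} (\<lambda>s. k s * increment \<phi> e \<tau> s)"
    unfolding eq inner_scaleR_left
    using integral_linear[OF i2 bounded_linear_inner_left[of e]] by (simp add: o_def increment_def F)
  then have "complex_of_real ((w (rcis r \<tau>) - F (cis \<tau>)) \<bullet> e) = complex_of_real (integral {-pi..pi} (\<lambda>s. k s * increment \<phi> e \<tau> s)) / (2 * complex_of_real pi)"
    by simp
  also have "complex_of_real (integral {-pi..pi} (\<lambda>s. k s * increment \<phi> e \<tau> s)) = integral {-pi..pi} (\<lambda>s. of_real (k s * increment \<phi> e \<tau> s))"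
    using integral_linear[OF i3, of complex_of_real, OF bounded_linear_of_real] by (simp add: o_def)
  also have "(\<lambda>s. complex_of_real (k s * increment \<phi> e \<tau> s)) = (\<lambda>s. of_real (1 - r) * (of_real ((1 + r) / (norm (cis s - of_real r))\<^sup>2) * of_real (increment \<phi> e \<tau> s)))"
    by (rule ext) (simp add: k_def power2_eq_square algebra_simps)
  also have "integral {-pi..pi} \<dots> = of_real (1 - r) * integral {-pi..pi} (\<lambda>s. of_real ((1 + r) / (norm (cis s - of_real r))\<^sup>2) * of_real (increment \<phi> e \<tau> s))"
    by (rule integral_mult_right)
  finally show ?thesis by simp
qed

text \<open>The growth estimate for the kernel \<open>(1 + r) / |cis s - r|\<^sup>2\<close>, multiplied by \<open>1 - r\<close>. The uniformity in
\<open>\<tau>\<close> gives the continuous extension of \<open>w\<close> to the closed disk.\<close>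

lemma boundary_convergence_rate:
  "\<exists>C>0. \<forall>r \<tau>. 1/4 \<le> r \<longrightarrow> r < 1 \<longrightarrow> norm (w (rcis r \<tau>) - F (cis \<tau>)) \<le> C * (1 - r) powr (1/2)"
proof -
  obtain C where C: "kernel_growth_const (1/2) C" using kernel_growth_const_exists[of "1/2"] by auto
  then have C0: "C > 0" by (simp add: kernel_growth_const_def)
  have "norm (w (rcis r \<tau>) - F (cis \<tau>)) \<le> (C * (M + 1)) * (1 - r) powr (1/2)" if r: "1/4 \<le> r" "r < 1" for r \<tau>
  proof -
    define d where "d = w (rcis r \<tau>) - F (cis \<tau>)"
    \<comment> \<open>The direction in which the increment is largest; the kernel estimates are for real functions.\<close>
    define e where "e = (if d = 0 then 1 else sgn d)"
    have e: "norm e = 1" by (simp add: e_def norm_sgn)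
    have de: "d \<bullet> e = norm d" by (auto simp: e_def sgn_div_norm inner_commute dot_square_norm power2_eq_square)
    let ?k = "\<lambda>s. complex_of_real ((1 + r) / (norm (cis s - of_real r))\<^sup>2)"
    let ?I = "integral {-pi..pi} (\<lambda>s. ?k s * of_real (increment \<phi> e \<tau> s))"
    have ck: "continuous_on {-pi..pi} ?k"
      using cis_minus_real_nonzero[of r] r by (intro continuous_intros) auto
    have I: "norm ?I \<le> C * M * (1 - r) powr (-(1/2))"
    proof (rule kernel_growth_constD[OF C r ck continuous_increment[OF lift] _ abs_increment_le[OF lift e]])
      show "norm (?k s) \<le> 2 / (norm (cis s - of_real r))\<^sup>2" for s
        unfolding norm_of_real using r by (simp add: divide_right_mono)
    qed
    have "complex_of_real (norm d) = of_real (1 - r) * ?I / (2 * pi)"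
      using radial_increment[of r \<tau> e] r de by (simp add: d_def)
    then have "norm (complex_of_real (norm d)) = norm (of_real (1 - r) * ?I / (2 * pi))" by simp
    also have "\<dots> = (1 - r) * norm ?I / (2 * pi)"
      using r norm_of_real[of "1 - r", where 'a = complex] by (simp add: norm_divide norm_mult del: of_real_diff)
    also have "\<dots> \<le> (1 - r) * norm ?I / 1" using pi_gt3 r by (intro divide_left_mono) auto
    also have "\<dots> \<le> (1 - r) * (C * M * (1 - r) powr (-(1/2)))" using I r by (simp add: mult_left_mono)
    also have "\<dots> = C * M * ((1 - r) powr 1 * (1 - r) powr (-(1/2)))" using r by simp
    also have "(1 - r) powr 1 * (1 - r) powr (-(1/2)) = (1 - r) powr (1/2)" unfolding powr_add[symmetric] by simp
    also have "C * M * (1 - r) powr (1/2) \<le> (C * (M + 1)) * (1 - r) powr (1/2)"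
      using C0 by (intro mult_right_mono mult_left_mono) auto
    finally show ?thesis by (simp add: d_def)
  qed
  moreover have "C * (M + 1) > 0" using C0 boundary_liftD(4)[OF lift] by simp
  ultimately show ?thesis by blast
qed

lemma radial_quotient_limit:
  "((\<lambda>r. ((w (rcis r \<tau>) - F (cis \<tau>)) \<bullet> (\<i> * g' (\<phi> \<tau>))) / (1 - r)) \<longlongrightarrow> normal_deriv \<phi> \<tau>) (at_left 1)"
proof -
  have B0: "0 \<le> (2 + 2 * pi) * pi\<^sup>2" by simp
  obtain C where C: "kernel_limit_const \<alpha> ((2 + 2 * pi) * pi\<^sup>2) (\<lambda>s. of_real (1 * normal_kernel s)) C"
    using kernel_limit_const_exists [OF \<alpha>_pos \<alpha>_le B0 normal_kernel_measurable[of 1]] by blast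
  let ?n = "\<i> * g' (\<phi> \<tau>)"
  let ?q = "\<lambda>r. ((w (rcis r \<tau>) - F (cis \<tau>)) \<bullet> ?n) / (1 - r)"
  have bound: "\<bar>?q r - normal_deriv \<phi> \<tau>\<bar> \<le> (C * (H * M powr (1 + \<alpha>))) * (1 - r) powr (\<alpha>/2)" if r: "1/4 \<le> r" "r < 1" for r
  proof -
    let ?k = "\<lambda>s. complex_of_real ((1 + r) / (norm (cis s - of_real r))\<^sup>2)"
    let ?\<psi> = "increment \<phi> ?n \<tau>"
    let ?I = "integral {-pi..pi} (\<lambda>s. ?k s * of_real (?\<psi> s))"
    let ?J = "integral {-pi..pi} (\<lambda>s. of_real (1 * normal_kernel s) * of_real (?\<psi> s)) :: complex"
    have ck: "continuous_on {-pi..pi} ?k"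
      using cis_minus_real_nonzero[of r] r by (intro continuous_intros) auto
    have near: "norm (?k s - of_real (1 * normal_kernel s)) \<le> ((2 + 2 * pi) * pi\<^sup>2) * (1 - r) / (norm (cis s - of_real r) * s\<^sup>2)"
      if "\<bar>s\<bar> \<le> pi" "s \<noteq> 0" for s
      using poisson_quotient_near_normal_kernel[OF r that] by simp
    note * = kernel_limit_constD[OF C r ck continuous_increment[OF lift] near abs_increment_normal_le[OF lift]]
    have ri: "(\<lambda>s. normal_kernel s * ?\<psi> s) integrable_on {-pi..pi}"
      using integrable_linear[OF *(1) bounded_linear_Re] by (simp add: o_def)
    have J: "?J = of_real (2 * pi * normal_deriv \<phi> \<tau>)"
      using integral_linear[OF ri, of complex_of_real, OF bounded_linear_of_real] by (simp add: o_def normal_deriv_def)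
    have "complex_of_real ((w (rcis r \<tau>) - F (cis \<tau>)) \<bullet> ?n) = of_real (1 - r) * ?I / (2 * pi)"
      using radial_increment[of r \<tau> ?n] r by simp
    then have "complex_of_real (?q r) = ?I / (2 * pi)"
      using r by (simp only: of_real_divide) (simp add: field_simps)
    then have "complex_of_real (?q r - normal_deriv \<phi> \<tau>) = (?I - ?J) / (2 * pi)"
      unfolding J by (simp add: field_simps)
    then have "norm (complex_of_real (?q r - normal_deriv \<phi> \<tau>)) = norm ((?I - ?J) / (2 * pi))" by simp
    also have "\<dots> = norm (?I - ?J) / (2 * pi)" by (simp add: norm_divide norm_mult)
    also have "\<dots> \<le> norm (?I - ?J) / 1" using pi_gt3 by (intro divide_left_mono) auto
    also have "\<dots> \<le> C * (H * M powr (1 + \<alpha>)) * (1 - r) powr (\<alpha>/2)" using *(2) by simp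
    finally show ?thesis unfolding norm_of_real .
  qed
  have lim: "((\<lambda>r. (C * (H * M powr (1 + \<alpha>))) * (1 - r) powr (\<alpha>/2)) \<longlongrightarrow> 0) (at_left 1)"
    using \<alpha>_pos by (intro gap_powr_tendsto_0) simp
  have "((\<lambda>r. ?q r - normal_deriv \<phi> \<tau>) \<longlongrightarrow> 0) (at_left 1)"
  proof (rule Lim_null_comparison[OF _ lim])
    show "\<forall>\<^sub>F r in at_left 1. norm (?q r - normal_deriv \<phi> \<tau>) \<le> (C * (H * M powr (1 + \<alpha>))) * (1 - r) powr (\<alpha>/2)"
      by (rule eventually_mono[OF eventually_at_left_real[of "1/4" 1]]) (use bound in auto)
  qed
  then show ?thesis by (simp add: LIM_zero_iff)
qed

text \<open>In \<open>r\<^sup>2 J\<^sub>w = Re A * Im B - Im A * Re B\<close> the factor \<open>Re B\<close> need not converge, but \<open>Im A\<close> decays faster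
than \<open>Re B\<close> can grow.\<close>

lemma jacobian_limit:
  assumes D: "(\<phi> has_real_derivative D) (at \<tau>)"
  shows "((\<lambda>r. jacobian w (rcis r \<tau>)) \<longlongrightarrow> normal_deriv \<phi> \<tau> * D) (at_left 1)"
proof -
  obtain C1 where C1: "C1 > 0" "\<And>r \<tau>. 1/4 \<le> r \<Longrightarrow> r < 1 \<Longrightarrow>
     norm (rcis r \<tau> * directional_gradient \<phi> (\<i> * g' (\<phi> \<tau>)) (rcis r \<tau>) + of_real (normal_deriv \<phi> \<tau>)) \<le> C1 * (1 - r) powr (\<alpha>/2)"
    using normal_gradient_rate[of M] lift by blast
  obtain C2 where C2: "C2 > 0" "\<And>r \<tau>. 1/4 \<le> r \<Longrightarrow> r < 1 \<Longrightarrow>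
     norm (rcis r \<tau> * directional_gradient \<phi> (g' (\<phi> \<tau>)) (rcis r \<tau>)) \<le> C2 * (1 - r) powr (-(\<alpha>/4))"
    using tangential_gradient_growth[of M] lift by blast
  define A where "A r = rcis r \<tau> * directional_gradient \<phi> (\<i> * g' (\<phi> \<tau>)) (rcis r \<tau>)" for r
  define B where "B r = rcis r \<tau> * directional_gradient \<phi> (g' (\<phi> \<tau>)) (rcis r \<tau>)" for r
  have near: "\<forall>\<^sub>F r in at_left 1. 1/4 < r \<and> r < (1::real)"
    by (rule eventually_mono[OF eventually_at_left_real[of "1/4" 1]]) auto
  have "((\<lambda>r. A r + of_real (normal_deriv \<phi> \<tau>)) \<longlongrightarrow> 0) (at_left 1)"
    by (rule Lim_null_comparison[OF eventually_mono[OF near] gap_powr_tendsto_0[of "\<alpha>/2" C1]]) (use C1(2) \<alpha>_pos in \<open>auto simp: A_def\<close>)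
  then have "((\<lambda>r. (A r + of_real (normal_deriv \<phi> \<tau>)) - of_real (normal_deriv \<phi> \<tau>)) \<longlongrightarrow> 0 - of_real (normal_deriv \<phi> \<tau>)) (at_left 1)"
    by (intro tendsto_diff tendsto_const)
  then have "((\<lambda>r. Re (A r)) \<longlongrightarrow> Re (- of_real (normal_deriv \<phi> \<tau>))) (at_left 1)" by (intro tendsto_Re) simp
  then have A: "((\<lambda>r. Re (A r)) \<longlongrightarrow> - normal_deriv \<phi> \<tau>) (at_left 1)" by simp
  have B: "((\<lambda>r. Im (B r)) \<longlongrightarrow> - D) (at_left 1)" unfolding B_def by (rule tangential_gradient_limit[OF lift D])
  have AB: "((\<lambda>r. Im (A r) * Re (B r)) \<longlongrightarrow> 0) (at_left 1)"
  proof (rule Lim_null_comparison[OF eventually_mono[OF near] gap_powr_tendsto_0[of "\<alpha>/4" "C1 * C2"]])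
    fix r :: real assume r: "1/4 < r \<and> r < 1"
    have "\<bar>Im (A r)\<bar> \<le> C1 * (1 - r) powr (\<alpha>/2)"
      using order_trans[OF abs_Im_le_cmod C1(2)[of r \<tau>]] r by (simp add: A_def)
    moreover have "\<bar>Re (B r)\<bar> \<le> C2 * (1 - r) powr (-(\<alpha>/4))"
      unfolding B_def by (rule order_trans[OF abs_Re_le_cmod C2(2)]) (use r in auto)
    ultimately have "\<bar>Im (A r) * Re (B r)\<bar> \<le> (C1 * (1 - r) powr (\<alpha>/2)) * (C2 * (1 - r) powr (-(\<alpha>/4)))"
      unfolding abs_mult using C1(1) by (intro mult_mono) auto
    also have "\<dots> = C1 * C2 * ((1 - r) powr (\<alpha>/2) * (1 - r) powr (-(\<alpha>/4)))" by simp
    also have "(1 - r) powr (\<alpha>/2) * (1 - r) powr (-(\<alpha>/4)) = (1 - r) powr (\<alpha>/4)"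
      unfolding powr_add[symmetric] by simp
    finally show "norm (Im (A r) * Re (B r)) \<le> C1 * C2 * (1 - r) powr (\<alpha>/4)" by simp
  qed (use \<alpha>_pos in simp)
  have "((\<lambda>r. (Re (A r) * Im (B r) - Im (A r) * Re (B r)) / r\<^sup>2) \<longlongrightarrow> ((- normal_deriv \<phi> \<tau>) * (- D) - 0) / 1\<^sup>2) (at_left 1)"
    by (intro tendsto_intros A B AB) auto
  moreover have "\<forall>\<^sub>F r in at_left 1. (Re (A r) * Im (B r) - Im (A r) * Re (B r)) / r\<^sup>2 = jacobian w (rcis r \<tau>)"
    using near
  proof eventually_elim
    case (elim r)
    have "jacobian w (rcis r \<tau>) = (norm (w_z \<phi> (rcis r \<tau>)))\<^sup>2 - (norm (w_zbar_cnj \<phi> (rcis r \<tau>)))\<^sup>2"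
      using elim by (intro jacobian_w) simp
    then have "r\<^sup>2 * jacobian w (rcis r \<tau>) = Re (A r) * Im (B r) - Im (A r) * Re (B r)"
      unfolding A_def B_def using jacobian_polar[of r \<phi> \<tau>] by (simp only:)
    moreover have "r\<^sup>2 \<noteq> 0" using elim by simp
    ultimately show ?case by (metis nonzero_mult_div_cancel_left)
  qed
  ultimately show ?thesis using tendsto_cong by fastforce
qed

lemma circle_deriv_F:
  assumes "(\<phi> has_real_derivative D) (at \<tau>)"
  shows "(\<lambda>s. F (cis s)) differentiable (at \<tau>)" "circle_deriv F \<tau> = D *\<^sub>R g' (\<phi> \<tau>)"
proof -
  have "((\<lambda>s. F (cis s)) has_vector_derivative D *\<^sub>R g' (\<phi> \<tau>)) (at \<tau>)"
    using vector_diff_chain_at[of \<phi> D \<tau> g "g' (\<phi> \<tau>)"] assms der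
    by (simp add: o_def has_real_derivative_iff_has_vector_derivative F)
  then show "(\<lambda>s. F (cis s)) differentiable (at \<tau>)" "circle_deriv F \<tau> = D *\<^sub>R g' (\<phi> \<tau>)"
    by (auto simp: circle_deriv_def vector_derivative_at intro: differentiableI_vector)
qed

lemma lift_derivative_nonneg:
  assumes "(\<phi> has_real_derivative D) (at \<tau>)" shows "0 \<le> D"
  using mono_on_imp_deriv_nonneg[of UNIV \<phi> D \<tau>] assms boundary_liftD(1)[OF lift] by simp

lemma ae_differentiable: "AE t in lebesgue_on {0..2*pi}. \<phi> differentiable (at t)"
proof -
  have "negligible {x. \<not> \<phi> differentiable (at x)}"
    using mono_lipschitz_ae_differentiable[of \<phi> M] boundary_liftD(1,2)[OF lift] by blast
  then have "AE t in lebesgue. \<phi> differentiable (at t)"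
    by (auto simp: negligible_iff_null_sets intro!: AE_I'[of "{x. \<not> \<phi> differentiable (at x)}"])
  then show ?thesis by (subst AE_restrict_space_iff) auto
qed

definition jacobian_ratio :: "complex \<Rightarrow> real" where "jacobian_ratio z = normal_deriv \<phi> (Arg z)"

lemma normal_deriv_eq_if_cis_eq:
  assumes "cis s = cis t" shows "normal_deriv \<phi> s = normal_deriv \<phi> t"
proof -
  obtain n :: int where "s = t + 2 * pi * of_int n"
    using assms by (metis complex_eq_iff cis.sel sin_cos_eq_iff mult.commute mult.left_commute)
  then show ?thesis
    using periodic_of_int[where f = "normal_deriv \<phi>", OF normal_deriv_periodic[OF lift], of t n] by (simp add: mult_ac)
qed

lemma jacobian_ratio_cis: "jacobian_ratio (cis t) = normal_deriv \<phi> t"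
  unfolding jacobian_ratio_def by (rule normal_deriv_eq_if_cis_eq) (simp add: cis_Arg sgn_div_norm)

lemma continuous_jacobian_ratio: "continuous_on (sphere 0 1) jacobian_ratio"
  by (rule continuous_on_circle_if_lift_continuous) (simp add: jacobian_ratio_cis continuous_normal_deriv[OF lift])

lemma jacobian_ratio_extension_exists:
  assumes f: "\<And>t. t \<in> {0..2*pi} \<Longrightarrow> \<phi> t = f t" and gd: "\<And>s. vector_derivative g (at s) = g' s"
  shows "jacobian_ratio_extension F g f jacobian_ratio"
  unfolding jacobian_ratio_extension_def
proof (intro conjI ballI impI)
  show "continuous_on (sphere 0 1) jacobian_ratio" by (rule continuous_jacobian_ratio)
  show "AE t in lebesgue_on {0..2*pi}. (\<lambda>s. F (cis s)) differentiable (at t) \<and>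
        (\<exists>J. ((\<lambda>r. jacobian w (rcis r t)) \<longlongrightarrow> J) (at_left 1) \<and>
             (circle_deriv F t \<noteq> 0 \<longrightarrow> jacobian_ratio (cis t) = J / norm (circle_deriv F t)))"
    using ae_differentiable
  proof eventually_elim
    case (elim t)
    then obtain D where D: "(\<phi> has_real_derivative D) (at t)" using real_differentiable_def by blast
    have "circle_deriv F t \<noteq> 0 \<longrightarrow> jacobian_ratio (cis t) = normal_deriv \<phi> t * D / norm (circle_deriv F t)"
      unfolding circle_deriv_F(2)[OF D] jacobian_ratio_cis using lift_derivative_nonneg[OF D] by (simp add: unit)
    then show ?case using circle_deriv_F(1)[OF D] jacobian_limit[OF D] by blast
  qed
  show "((\<lambda>r. ((w (rcis r t) - F (cis t)) \<bullet> (\<i> * vector_derivative g (at (f t)))) / (1 - r)) \<longlongrightarrow> jacobian_ratio (cis t)) (at_left 1)"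
    if "t \<in> {0..2*pi}" for t
    using radial_quotient_limit[of t] by (simp add: jacobian_ratio_cis gd f[OF that, symmetric])
qed

text \<open>Where \<open>T\<close> and the normal derivative differ, \<open>\<phi>' = 0\<close> almost everywhere by the limit of the Jacobian. The set
of these points is open by continuity, so \<open>\<phi>\<close> is constant on an arc around each of them; but there \<open>T\<close> is
the limit of the radial difference quotient, which is the normal derivative.\<close>

lemma jacobian_ratio_extension_unique:
  assumes f: "\<And>t. t \<in> {0..2*pi} \<Longrightarrow> \<phi> t = f t" and gd: "\<And>s. vector_derivative g (at s) = g' s"
    and T: "jacobian_ratio_extension F g f T" and t: "t \<in> {0..2*pi}"
  shows "T (cis t) = normal_deriv \<phi> t"
proof -
  have T1: "continuous_on (sphere 0 1) T"
    and T2: "AE t in lebesgue_on {0..2*pi}. (\<lambda>s. F (cis s)) differentiable (at t) \<and>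
        (\<exists>J. ((\<lambda>r. jacobian w (rcis r t)) \<longlongrightarrow> J) (at_left 1) \<and>
             (circle_deriv F t \<noteq> 0 \<longrightarrow> T (cis t) = J / norm (circle_deriv F t)))"
    and T3: "\<And>t. t\<in>{0..2*pi} \<Longrightarrow> \<forall>\<^sub>F s in nhds t. F (cis s) = F (cis t) \<Longrightarrow>
        ((\<lambda>r. ((w (rcis r t) - F (cis t)) \<bullet> (\<i> * vector_derivative g (at (f t)))) / (1 - r)) \<longlongrightarrow> T (cis t)) (at_left 1)"
    using T unfolding jacobian_ratio_extension_def by blast+
  have cT: "continuous_on UNIV (\<lambda>t. T (cis t) - normal_deriv \<phi> t)"
    by (intro continuous_intros continuous_on_compose2[OF T1] continuous_normal_deriv[OF lift]) auto
  let ?d = "\<lambda>t. T (cis t) - normal_deriv \<phi> t"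
  have ae: "AE t in lebesgue_on {0..2*pi}. ?d t = 0 \<or> (\<phi> has_real_derivative 0) (at t)"
    using T2 ae_differentiable
  proof eventually_elim
    case (elim t)
    then obtain D where D: "(\<phi> has_real_derivative D) (at t)" using real_differentiable_def by blast
    show ?case
    proof (cases "D = 0")
      case False
      obtain J where J: "((\<lambda>r. jacobian w (rcis r t)) \<longlongrightarrow> J) (at_left 1)"
        "circle_deriv F t \<noteq> 0 \<longrightarrow> T (cis t) = J / norm (circle_deriv F t)" using elim by blast
      have "J = normal_deriv \<phi> t * D" by (rule tendsto_unique[OF _ J(1) jacobian_limit[OF D]]) simp
      moreover have "g' (\<phi> t) \<noteq> 0" using unit[of "\<phi> t"] by auto
      ultimately show ?thesis using J(2) False lift_derivative_nonneg[OF D]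
        unfolding circle_deriv_F(2)[OF D] by (simp add: unit)
    qed (use D in simp)
  qed
  have inside: "?d \<tau> = 0" if \<tau>: "\<tau> \<in> {0<..<2*pi}" for \<tau>
  proof (rule ccontr)
    assume nz: "?d \<tau> \<noteq> 0"
    have "open {t. ?d t \<noteq> 0}"
      using cT by (intro open_Collect_neq) (auto intro: continuous_on_const)
    then have "open ({t. ?d t \<noteq> 0} \<inter> {0<..<2*pi})" by (intro open_Int) auto
    moreover have "\<tau> \<in> {t. ?d t \<noteq> 0} \<inter> {0<..<2*pi}" using nz \<tau> by simp
    ultimately obtain e where e: "e > 0" "cball \<tau> e \<subseteq> {t. ?d t \<noteq> 0} \<inter> {0<..<2*pi}"
      using open_contains_cball by blast
    have "negligible {t\<in>{0..2*pi}. \<not> (?d t = 0 \<or> (\<phi> has_real_derivative 0) (at t))}"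
    proof -
      have "AE t in lebesgue. t \<in> {0..2*pi} \<longrightarrow> (?d t = 0 \<or> (\<phi> has_real_derivative 0) (at t))"
        using ae by (subst (asm) AE_restrict_space_iff) auto
      then obtain N where N: "N \<in> null_sets lebesgue" "{t \<in> space lebesgue. \<not> (t \<in> {0..2*pi} \<longrightarrow> (?d t = 0 \<or> (\<phi> has_real_derivative 0) (at t)))} \<subseteq> N"
        unfolding eventually_ae_filter by blast
      show ?thesis by (rule negligible_subset[of N]) (use N in \<open>auto simp: negligible_iff_null_sets\<close>)
    qed
    then have neg: "negligible {t\<in>{\<tau>-e..\<tau>+e}. \<not> (\<phi> has_real_derivative 0) (at t)}"
      by (rule negligible_subset) (use e(2) in \<open>auto simp: cball_eq_atLeastAtMost\<close>)
    have const: "\<phi> (\<tau> - e) = \<phi> (\<tau> + e)"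
      by (rule mono_lipschitz_zero_derivative_constant[OF boundary_liftD(1,2)[OF lift] neg]) (use e in simp)
    have "\<forall>\<^sub>F s in nhds \<tau>. F (cis s) = F (cis \<tau>)"
      unfolding eventually_nhds_metric
    proof (intro exI[of _ e] conjI allI impI)
      fix s assume "dist s \<tau> < e"
      then have "\<tau> - e \<le> s" "s \<le> \<tau> + e" by (auto simp: dist_real_def)
      then have "\<phi> s = \<phi> \<tau>"
        using const boundary_liftD(1)[OF lift] e(1) by (smt (verit) monoD)
      then show "F (cis s) = F (cis \<tau>)" by (simp add: F)
    qed (use e in simp)
    then have "((\<lambda>r. ((w (rcis r \<tau>) - F (cis \<tau>)) \<bullet> (\<i> * vector_derivative g (at (f \<tau>)))) / (1 - r)) \<longlongrightarrow> T (cis \<tau>)) (at_left 1)"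
      using \<tau> by (intro T3) auto
    then have "((\<lambda>r. ((w (rcis r \<tau>) - F (cis \<tau>)) \<bullet> (\<i> * g' (\<phi> \<tau>))) / (1 - r)) \<longlongrightarrow> T (cis \<tau>)) (at_left 1)"
      using f[of \<tau>] \<tau> by (simp add: gd)
    then have "T (cis \<tau>) = normal_deriv \<phi> \<tau>"
      by (rule tendsto_unique[OF _ _ radial_quotient_limit, rotated]) simp
    then show False using nz by simp
  qed
  have "t \<in> closure {0<..<2*pi}" using t by simp
  then have "?d t = 0"
    using continuous_constant_on_closure[of "{0<..<2*pi}" ?d 0 t] inside continuous_on_subset[OF cT] by blast
  then show ?thesis by simp
qed

section \<open>The diffeomorphism\<close>

lemma diffeomorphism_if_normal_deriv_pos:
  assumes pos: "\<And>\<tau>. normal_deriv \<phi> \<tau> > 0"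
    and c: "simple_path c" "pathfinish c = pathstart c" "path_image c = range g"
    and D: "open D" "connected D" "D \<noteq> {}" "bounded D" "frontier D = path_image c"
  shows "diffeomorphism_onto w (ball 0 1) D"
proof -
  note hol = w_z_holomorphic[OF lift]
  have alg: "smooth_algebra (ball 0 1) (w_z \<phi>)" "smooth_algebra (ball 0 1) (\<lambda>z. cnj (w_zbar_cnj \<phi> z))"
    by (intro smooth_algebra.holo smooth_algebra.cnj hol)+
  have nz: "norm (w_z \<phi> z) \<noteq> norm (cnj (w_zbar_cnj \<phi> z))" if "z \<in> ball 0 1" for z
    using jacobian_nonzero[OF lift pos that] by simp
  have wf: "smooth_algebra (ball 0 1) w_formula"
    unfolding w_formula_def[abs_def]
    by (intro smooth_algebra.add smooth_algebra.cnj smooth_algebra_const smooth_algebra.holo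
        cauchy_transform_holomorphic continuous_intros continuous_boundary_values[OF lift])
  \<comment> \<open>The integral that defines \<open>w\<close> does not give the boundary values on the circle itself, so they are
put in by hand.\<close>
  define W where "W z = (if z \<in> ball 0 1 then w z else F z)" for z
  obtain C where C: "C > 0" "\<And>r \<tau>. 1/4 \<le> r \<Longrightarrow> r < 1 \<Longrightarrow> norm (w (rcis r \<tau>) - F (cis \<tau>)) \<le> C * (1 - r) powr (1/2)"
    using boundary_convergence_rate by blast
  have cF: "continuous_on (sphere 0 1) F"
    by (rule continuous_on_circle_if_lift_continuous) (rule continuous_F)
  have cW: "continuous_on (cball 0 1) W"
    unfolding continuous_on_eq_continuous_within
  proof
    fix z :: complex assume z: "z \<in> cball 0 1"
    show "continuous (at z within cball 0 1) W"
    proof (cases "z \<in> ball 0 1")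
      case True
      have "isCont w z" using w_derivative[OF True] has_derivative_continuous by blast
      moreover have "\<forall>\<^sub>F x in nhds z. W x = w x"
        using eventually_nhds_in_open[OF open_ball True] by eventually_elim (simp add: W_def)
      ultimately have "isCont W z" using isCont_cong by blast
      then show ?thesis by (rule continuous_at_imp_continuous_at_within)
    next
      case False
      then have nz1: "norm z = 1" using z by simp
      have "isCont (\<lambda>x::complex. sgn x) z" using nz1 by (intro isCont_sgn) auto
      then have "((\<lambda>x. sgn x) \<longlongrightarrow> sgn z) (at z within cball 0 1)"
        unfolding isCont_def by (rule tendsto_within_subset) simp
      moreover have "sgn z = z" using nz1 by (simp add: sgn_div_norm)
      ultimately have sg: "((\<lambda>x. sgn x) \<longlongrightarrow> z) (at z within cball 0 1)" by simp
      have ev0: "\<forall>\<^sub>F x in at z within cball 0 1. 1/2 < norm x"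
      proof -
        have "((\<lambda>x. norm x) \<longlongrightarrow> norm z) (at z within cball 0 1)" by (intro tendsto_intros)
        then show ?thesis using nz1 by (intro order_tendstoD(1)) auto
      qed
      have evc: "\<forall>\<^sub>F x in at z within cball 0 1. x \<in> cball 0 1"
        by (simp add: eventually_at_topological) (metis UNIV_I open_UNIV)
      have Fs: "((\<lambda>x. F (sgn x)) \<longlongrightarrow> F z) (at z within cball 0 1)"
      proof (rule continuous_on_tendsto_compose[OF cF sg])
        show "z \<in> sphere 0 1" using nz1 by simp
        show "\<forall>\<^sub>F x in at z within cball 0 1. sgn x \<in> sphere 0 1"
          using ev0 by eventually_elim (auto simp: norm_sgn)
      qed
      have l0: "((\<lambda>x. C * (1 - norm x) powr (1/2)) \<longlongrightarrow> C * (1 - norm z) powr (1/2)) (at z within cball 0 1)"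
        by (intro tendsto_intros) (use evc in \<open>auto elim!: eventually_mono\<close>)
      then have l0: "((\<lambda>x. C * (1 - norm x) powr (1/2)) \<longlongrightarrow> 0) (at z within cball 0 1)" using nz1 by simp
      have "((\<lambda>x. W x - F (sgn x)) \<longlongrightarrow> 0) (at z within cball 0 1)"
      proof (rule Lim_null_comparison[OF _ l0])
        show "\<forall>\<^sub>F x in at z within cball 0 1. norm (W x - F (sgn x)) \<le> C * (1 - norm x) powr (1/2)"
          using ev0 evc
        proof eventually_elim
          case (elim x)
          show ?case
          proof (cases "norm x < 1")
            case True
            have "x = rcis (norm x) (Arg x)" by (simp add: rcis_cmod_Arg)
            moreover have "sgn x = cis (Arg x)" using elim by (subst cis_Arg) auto
            ultimately show ?thesis using C(2)[of "norm x" "Arg x"] True elim by (simp add: W_def)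
          next
            case False
            then have "norm x = 1" using elim by simp
            then show ?thesis by (simp add: W_def sgn_div_norm)
          qed
        qed
      qed
      then have "((\<lambda>x. (W x - F (sgn x)) + F (sgn x)) \<longlongrightarrow> 0 + F z) (at z within cball 0 1)"
        by (intro tendsto_add Fs)
      moreover have "W z = F z" using False by (simp add: W_def)
      ultimately show ?thesis by (simp add: continuous_within)
    qed
  qed
  have Wsph: "W ` sphere 0 1 = path_image c"
  proof -
    have sph: "sphere 0 1 = range cis"
    proof (intro equalityI subsetI)
      fix x :: complex assume "x \<in> sphere 0 1"
      then have "x \<noteq> 0" "norm x = 1" by auto
      then have "x = cis (Arg x)" by (simp add: cis_Arg sgn_div_norm)
      then show "x \<in> range cis" by blast
    qed auto
    have "W ` sphere 0 1 = F ` sphere 0 1" by (intro image_cong) (auto simp: W_def)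
    also have "\<dots> = F ` range cis" unfolding sph ..
    also have "\<dots> = g ` range \<phi>" by (simp add: image_image F)
    also have "range \<phi> = UNIV"
    proof (intro equalityI subsetI UNIV_I)
      fix y :: real
      have per_int: "\<phi> (of_int n * (2 * pi)) = \<phi> 0 + of_int n * l" for n
        using periodic_of_int[where f = "\<lambda>t. \<phi> t - l / (2 * pi) * t" and p = "2 * pi" and t = 0 and n = n]
          boundary_liftD(3)[OF lift] by (simp add: field_simps)
      define n where "n = \<lfloor>(y - \<phi> 0) / l\<rfloor>"
      have "of_int n \<le> (y - \<phi> 0) / l" "(y - \<phi> 0) / l \<le> of_int (n + 1)" unfolding n_def by linarith+
      then have "\<phi> (of_int n * (2 * pi)) \<le> y" "y \<le> \<phi> (of_int (n + 1) * (2 * pi))"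
        unfolding per_int using l_pos by (simp_all add: field_simps)
      moreover have "of_int n * (2 * pi) \<le> of_int (n + 1) * (2 * pi)" by (intro mult_right_mono) auto
      ultimately show "y \<in> range \<phi>" using IVT'[of \<phi> _ y] boundary_liftD(5)[OF lift] by blast
    qed
    finally show ?thesis using c(3) by simp
  qed
  have "bij_betw W (ball 0 1) D"
  proof (rule local_homeo_onto_jordan_domain[OF c(1,2) D cW Wsph])
    fix z :: complex assume z: "z \<in> ball 0 1"
    have "\<exists>N. open N \<and> z \<in> N \<and> N \<subseteq> ball 0 1 \<and> inj_on w N"
      by (rule smooth_algebra_locally_injective[OF open_ball alg w_derivative nz[OF z] z])
    moreover have "inj_on W N" if "N \<subseteq> ball 0 1" "inj_on w N" for N
    proof -
      have "W x = w x" if "x \<in> N" for x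
        using subsetD[OF \<open>N \<subseteq> ball 0 1\<close> that] unfolding W_def by (rule if_P)
      then show ?thesis using \<open>inj_on w N\<close> by (simp cong: inj_on_cong)
    qed
    ultimately show "\<exists>N. open N \<and> z \<in> N \<and> N \<subseteq> ball 0 1 \<and> inj_on W N" by blast
  qed
  then have bij: "bij_betw w_formula (ball 0 1) D"
    by (subst bij_betw_cong[of _ _ W]) (simp_all add: W_def w_eq)
  have "diffeomorphism_onto w_formula (ball 0 1) D"
    by (rule diffeomorphism_onto_smooth_algebra[OF open_ball D(1) wf bij alg w_formula_derivative nz])
  then show ?thesis by (rule diffeomorphism_onto_cong[OF open_ball D(1), rotated]) (simp add: w_eq)
qed

end

theorem theorem1p2:
  fixes F :: "complex \<Rightarrow> complex" and g :: "real \<Rightarrow> complex" and f :: "real \<Rightarrow> real"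
    and \<gamma> D :: "complex set" and l \<alpha> :: real
  assumes "0 < \<alpha>" and "\<alpha> \<le> 1"
    and "arc_length_param g l \<gamma>"
    and "C1_holder \<alpha> g"
    and "open D" and "connected D" and "D \<noteq> {}" and "bounded D" and "frontier D = \<gamma>"
    and "positively_oriented g D"
    and "weak_homeomorphism F g l f"
    and "\<exists>L. L-lipschitz_on (sphere 0 1) F"
  shows "(\<exists>T. jacobian_ratio_extension F g f T) \<and>
         (\<forall>T. jacobian_ratio_extension F g f T \<longrightarrow> (\<forall>z\<in>sphere 0 1. T z > 0) \<longrightarrow>
              diffeomorphism_onto (poisson_extension F) (ball 0 1) D)"
proof -
  have l: "0 < l" and per: "\<And>s. g (s + l) = g s" and sp: "simple_path (\<lambda>x. g (l * x))"
    and im: "path_image (\<lambda>x. g (l * x)) = \<gamma>" and df: "\<And>s. g differentiable (at s)"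
    and unit: "\<And>s. norm (vector_derivative g (at s)) = 1"
    using assms(3) by (auto simp: arc_length_param_def)
  obtain C where C: "\<And>s t. norm (vector_derivative g (at t) - vector_derivative g (at s)) \<le> C * \<bar>t - s\<bar> powr \<alpha>"
    using assms(4) by (auto simp: C1_holder_def)
  have per_int: "g (s + of_int n * l) = g s" for s n
    by (rule periodic_of_int[where f = g, OF per])
  \<comment> \<open>A simple closed path is injective on the half open period; translating both parameters by the same
multiple of \<open>l\<close> gives injectivity on every open period.\<close>
  have inj0: "x = y" if "x \<in> {0..<l}" "y \<in> {0..<l}" "g x = g y" for x y
  proof -
    have "x / l \<in> {0..1}" "y / l \<in> {0..1}" "x / l \<noteq> 1" "y / l \<noteq> 1" using that l by auto
    moreover have "g (l * (x / l)) = g (l * (y / l))" using that l by simp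
    ultimately have "x / l = y / l" using sp unfolding simple_path_def loop_free_def by blast
    then show ?thesis using l by simp
  qed
  have red: "\<exists>n::int. s + of_int n * l \<in> {0..<l}" for s
    using translate_into_period[OF l, of s] by blast
  have inj: "g s \<noteq> g t" if st: "s < t" "t < s + l" for s t
  proof
    assume eq: "g s = g t"
    obtain n :: int where n: "s + of_int n * l \<in> {0..<l}" using red by blast
    show False
    proof (cases "t + of_int n * l < l")
      case True
      then have "s + of_int n * l = t + of_int n * l" using n st eq by (intro inj0) (auto simp: per_int)
      then show False using st by simp
    next
      case False
      have "g (t + of_int n * l - l) = g t" using per[of "t + of_int n * l - l"] per_int by simp
      then have "s + of_int n * l = t + of_int n * l - l"
        using n st eq False by (intro inj0) (auto simp: per_int)
      then show False using st by simp
    qed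
  qed
  interpret smooth_jordan_curve g "\<lambda>s. vector_derivative g (at s)" l \<alpha> "\<bar>C\<bar>"
  proof
    show "(g has_vector_derivative vector_derivative g (at s)) (at s)" for s
      using df vector_derivative_works by blast
    show "norm (vector_derivative g (at t) - vector_derivative g (at s)) \<le> \<bar>C\<bar> * \<bar>t - s\<bar> powr \<alpha>" for s t
      by (rule order_trans[OF C mult_right_mono]) auto
  qed (use assms(1,2) l per unit inj in auto)
  obtain M \<phi> where \<phi>: "boundary_lift M \<phi>" "\<And>t. F (cis t) = g (\<phi> t)" "\<And>t. t \<in> {0..2*pi} \<Longrightarrow> \<phi> t = f t"
    by (rule boundary_lift_exists[OF assms(11,12)]) blast
  interpret poisson_boundary g "\<lambda>s. vector_derivative g (at s)" l \<alpha> "\<bar>C\<bar>" \<phi> M F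
    by unfold_locales (use \<phi> in auto)
  have "diffeomorphism_onto (poisson_extension F) (ball 0 1) D"
    if T: "jacobian_ratio_extension F g f T" "\<forall>z\<in>sphere 0 1. T z > 0" for T
  proof (rule diffeomorphism_if_normal_deriv_pos)
    fix \<tau>
    obtain n :: int where n: "\<tau> + of_int n * (2 * pi) \<in> {0..<2*pi}" by (rule translate_into_period[of "2 * pi"]) auto
    have "normal_deriv \<phi> \<tau> = normal_deriv \<phi> (\<tau> + of_int n * (2 * pi))"
      using periodic_of_int[where f = "normal_deriv \<phi>", OF normal_deriv_periodic[OF \<phi>(1)]] by simp
    also have "\<dots> = T (cis (\<tau> + of_int n * (2 * pi)))"
      using jacobian_ratio_extension_unique[OF \<phi>(3) refl T(1), of "\<tau> + of_int n * (2 * pi)"] n by simp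
    finally show "normal_deriv \<phi> \<tau> > 0" using T(2) by simp
  next
    show "simple_path (\<lambda>x. g (l * x))" by (rule sp)
    show "pathfinish (\<lambda>x. g (l * x)) = pathstart (\<lambda>x. g (l * x))"
      using per[of 0] by (simp add: pathfinish_def pathstart_def)
    show "path_image (\<lambda>x. g (l * x)) = range g"
    proof (intro equalityI subsetI)
      fix y assume "y \<in> range g"
      then obtain s where s: "y = g s" by blast
      obtain n :: int where n: "s + of_int n * l \<in> {0..<l}" using red by blast
      define x where "x = (s + of_int n * l) / l"
      have "x \<in> {0..1}" "y = g (l * x)" using n l per_int[of s n] s by (auto simp: x_def)
      then show "y \<in> path_image (\<lambda>x. g (l * x))" by (auto simp: path_image_def)
    qed (auto simp: path_image_def)
    show "frontier D = path_image (\<lambda>x. g (l * x))" using assms(9) im by simp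
  qed (use assms in auto)
  moreover have "jacobian_ratio_extension F g f jacobian_ratio"
    by (rule jacobian_ratio_extension_exists[OF \<phi>(3) refl])
  ultimately show ?thesis by blast
qed

end
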